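(* Let $n\ge 1$, let $f\in\mathbb{C}[x_1,\dots,x_n]$ be a non-degenerate weighted homogeneous polynomial with weights $w_1,\dots,w_n$, and let $G\subset \mathrm{SL}_n(\mathbb{C})$ be a finite abelian subgroup acting diagonally on $\mathbb{C}^n$ and leaving $f$ invariant. Put $\hat c:=n-2\sum_{i=1}^n w_i$. Then $$\mathrm{Var}_{(f,G)}=\sum_{p,q\in\mathbb{Q}}(-1)^{(p-n)+q}\left(q-\frac n2\right)^2 h^{p,q}(f,G)=\frac{1}{12}\,\hat c\cdot\mu_{(f,G)}.$$
   Context: Weighted homogeneous polynomials: $f(x_1,\dots,x_n)$ is non-degenerate weighted homogeneous if it has an isolated singularity at the origin and there are positive rational numbers (weights) $w_1,\dots,w_n$ with $f(\lambda^{w_1}x_1,\dots,\lambda^{w_n}x_n)=\lambda f(x_1,\dots,x_n)$ for $\lambda\in\mathbb{C}\setminus\{0\}$. Group: every $g\in G$ is a diagonal matrix $g=\mathrm{diag}(e^{2\pi\sqrt{-1}a_1/r},\dots,e^{2\pi\sqrt{-1}a_n/r})$ with $r$ the order of $g$ and integers $0\le a_i<r$; its age is $\mathrm{age}(g):=\frac1r\sum_{i=1}^n a_i$, a non-negative integer since $G\subset \mathrm{SL}_n(\mathbb{C})$. $\mathrm{Fix}\,g:=\{x\in\mathbb{C}^n: gx=x\}$, $n_g:=\dim\mathrm{Fix}\,g$, $f^g:=f|_{\mathrm{Fix}\,g}$ (a polynomial in $n_g$ variables with an isolated singularity at the origin). The bigraded space $\mathcal{H}_f=\bigoplus_{p,q\in\mathbb{Q}}\mathcal{H}_f^{p,q}$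 for a polynomial $f$ in $n$ variables with an isolated singularity at $0$: let $Y_f$ be the Milnor fibre of $f$ at $0$, $F^\bullet$ the Hodge filtration of Steenbrink's mixed Hodge structure on $H^{n-1}(Y_f,\mathbb{C})$ (reduced cohomology if $n=1$), and let the subscript $\lambda$ denote the (generalized) $\lambda$-eigenspace of the monodromy. Then $\mathcal{H}^{p,q}_f:=0$ if $p+q\ne n$; $\mathcal{H}^{p,q}_f:=\mathrm{Gr}^p_{F^\bullet}H^{n-1}(Y_f,\mathbb{C})_1$ if $p+q=n$ and $p\in\mathbb{Z}$; $\mathcal{H}^{p,q}_f:=\mathrm{Gr}^{[p]}_{F^\bullet}H^{n-1}(Y_f,\mathbb{C})_{e^{2\pi\sqrt{-1}p}}$ if $p+q=n$ and $p\notin\mathbb{Z}$, where $[p]$ is the largest integer less than $p$. For a function on a point (zero variables), $\mathcal{H}=\mathbb{C}$ in bidegree $(0,0)$ with trivial group action. As a vector space with group action, $\mathcal{H}_f$ is identified with $\Omega_f:=\Omega^n_{\mathbb{C}^n,0}/(df\wedge\Omega^{n-1}_{\mathbb{C}^n,0})=\mathcal{O}_{\mathbb{C}^n,0}/(\partial f/\partial x_1,\dots,\partial f/\partial x_n)\cdot dx_1\wedge\dots\wedge dx_n$, with the action induced by the diagonal action on coordinates (including the factor $dx_1\wedge\dots\wedge dx_n$). If $f$ is non-degenerate weighted homogeneous with weights $w_i$, then under this identification $\mathcal{H}_f^{n-l,l}$ corresponds to the span of the classes of $x_1^{k_1}\cdots x_n^{k_n}dx_1\wedge\dots\wedge dx_n$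 with $\sum_i w_i(k_i+1)=l$. The group $G$ acts on $\mathcal{H}_{f^g}$ through the restriction of its action to $\mathrm{Fix}\,g$. For the pair: $\mathcal{H}_{f,G}:=\bigoplus_{g\in G}(\mathcal{H}_{f^g})^G(-\mathrm{age}(g),-\mathrm{age}(g))$, where $(\cdot)^G$ denotes $G$-invariants and the bidegree $(p,q)$ part of $V(-a,-a)$ is $V^{p-a,q-a}$. Hodge numbers: $h^{p,q}(f,G):=\dim_{\mathbb{C}}\mathcal{H}^{p,q}_{f,G}$, $p,q\in\mathbb{Q}$. Milnor number of the pair: $\mu_{(f,G)}:=\sum_{p,q\in\mathbb{Q}}(-1)^{(p-n)+q}h^{p,q}(f,G)$. (One has $p+q\in\mathbb{Z}$ whenever $h^{p,q}(f,G)\neq0$.) Variance of the set of exponents: $\mathrm{Var}_{(f,G)}:=\sum_{p,q\in\mathbb{Q}}(-1)^{(p-n)+q}(q-\frac n2)^2h^{p,q}(f,G)$. *)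

theory Defs
  imports
    "HOL-Analysis.Analysis"
    "HOL-Algebra.Multiplicative_Group"
    "HOL-Library.Poly_Mapping"
    "HOL-Library.Groups_Big_Fun"
    "Jordan_Normal_Form.Missing_VectorSpace"
begin

text \<open>
  The variables are indexed by a finite type \<open>'n\<close>, so that \<open>n = CARD('n) \<ge> 1\<close>.  A polynomial is
  its finitely supported coefficient function, a power series an arbitrary coefficient function.
\<close>

type_synonym 'n monomial = "'n \<Rightarrow>\<^sub>0 nat"
type_synonym 'n cpoly = "'n monomial \<Rightarrow>\<^sub>0 complex"
type_synonym 'n cseries = "'n monomial \<Rightarrow> complex"

section \<open>Polynomials, partial derivatives, weighted homogeneity\<close>

text \<open>The sum ranges over the support; the value is meaningful for finitely supported series.\<close>

definition eval_series :: "'n::finite cseries \<Rightarrow> complex ^ 'n \<Rightarrow> complex" where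
  "eval_series a x = Sum_any (\<lambda>m. a m * (\<Prod>i\<in>UNIV. (x $ i) ^ Poly_Mapping.lookup m i))"

definition partial :: "'n \<Rightarrow> 'n cseries \<Rightarrow> 'n cseries" where
  "partial i a = (\<lambda>m. of_nat (Poly_Mapping.lookup m i + 1) * a (m + Poly_Mapping.single i 1))"

definition isolated_singularity_at_0 :: "'n::finite cpoly \<Rightarrow> bool" where
  "isolated_singularity_at_0 f \<longleftrightarrow>
     (\<forall>i. eval_series (partial i (Poly_Mapping.lookup f)) 0 = 0) \<and>
     (\<forall>\<^sub>F x in at 0. \<exists>i. eval_series (partial i (Poly_Mapping.lookup f)) x \<noteq> 0)"

definition nondegenerate_weighted_homogeneous :: "'n::finite cpoly \<Rightarrow> ('n \<Rightarrow> rat) \<Rightarrow> bool" where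
  "nondegenerate_weighted_homogeneous f w \<longleftrightarrow>
     isolated_singularity_at_0 f \<and> (\<forall>i. w i > 0) \<and>
     (\<forall>t::complex. t \<noteq> 0 \<longrightarrow> (\<forall>x. eval_series (Poly_Mapping.lookup f) (\<chi> i. (t powr of_rat (w i)) * x $ i)
                                  = t * eval_series (Poly_Mapping.lookup f) x))"

section \<open>Diagonal groups\<close>

definition SL :: "(complex ^ 'n ^ 'n) monoid" where
  "SL = \<lparr>carrier = {A. det A = 1}, mult = (**), one = mat 1\<rparr>"

definition is_diagonal :: "complex ^ 'n ^ 'n \<Rightarrow> bool" where
  "is_diagonal A \<longleftrightarrow> (\<forall>i j. i \<noteq> j \<longrightarrow> A $ i $ j = 0)"

definition age :: "complex ^ 'n ^ 'n \<Rightarrow> rat" where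
  "age g = (let r = group.ord SL g in
     (\<Sum>i\<in>UNIV. of_nat (THE a::nat. a < r \<and>
        g $ i $ i = exp (2 * of_real pi * \<i> * of_nat a / of_nat r))) / of_nat r)"

definition Fix :: "complex ^ 'n ^ 'n \<Rightarrow> (complex ^ 'n) set" where
  "Fix g = {x. g *v x = x}"

text \<open>
  For diagonal \<open>g\<close> the space \<open>Fix g\<close> is the coordinate subspace of the following variables
  (lemma \<open>Fix_diagonal\<close> below), and \<open>f\<^sup>g\<close> is a polynomial in these variables.
\<close>

definition fix_vars :: "complex ^ 'n ^ 'n \<Rightarrow> 'n set" where
  "fix_vars g = {i. axis i 1 \<in> Fix g}"

definition restrict_vars :: "'n set \<Rightarrow> 'n cseries \<Rightarrow> 'n cseries" where
  "restrict_vars I a = (\<lambda>m. if Poly_Mapping.keys m \<subseteq> I then a m else 0)"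

lemma matrix_vector_mult_diagonal:
  assumes "is_diagonal g"
  shows "(g *v x) $ i = g $ i $ i * x $ i"
proof -
  have "(g *v x) $ i = (\<Sum>j\<in>UNIV. g $ i $ j * x $ j)"
    by (simp add: matrix_vector_mult_def)
  also have "\<dots> = (\<Sum>j\<in>UNIV. if j = i then g $ i $ i * x $ i else 0)"
    using assms by (intro sum.cong) (auto simp: is_diagonal_def)
  finally show ?thesis by simp
qed

lemma fix_vars_diagonal:
  assumes "is_diagonal g"
  shows "fix_vars g = {i. g $ i $ i = 1}"
  by (auto simp: fix_vars_def Fix_def vec_eq_iff matrix_vector_mult_diagonal[OF assms] axis_def)

lemma Fix_diagonal:
  assumes "is_diagonal g"
  shows "Fix g = {x. \<forall>i. i \<notin> fix_vars g \<longrightarrow> x $ i = 0}"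
  unfolding fix_vars_diagonal[OF assms]
  by (auto simp: Fix_def vec_eq_iff matrix_vector_mult_diagonal[OF assms])

lemma dim_Fix_diagonal:
  fixes g :: "complex ^ 'n ^ 'n"
  assumes "is_diagonal g"
  shows "vec.dim (Fix g) = card (fix_vars g)"
proof -
  let ?B = "(\<lambda>i. axis i 1 :: complex ^ 'n) ` fix_vars g"
  have inj: "inj (\<lambda>i. axis i 1 :: complex ^ 'n)"
    by (auto simp: inj_on_def axis_eq_axis)
  have "vec.span ?B = Fix g"
  proof (rule antisym)
    show "vec.span ?B \<subseteq> Fix g"
    proof (rule vec.span_minimal)
      show "?B \<subseteq> Fix g" by (auto simp: fix_vars_def)
      show "vec.subspace (Fix g)"
        by (simp add: Fix_diagonal[OF assms] vec.subspace_def)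
    qed
    show "Fix g \<subseteq> vec.span ?B"
    proof
      fix x assume x: "x \<in> Fix g"
      have "x = (\<Sum>i\<in>UNIV. x $ i *s axis i 1)"
        by (simp add: basis_expansion)
      also have "\<dots> \<in> vec.span ?B"
      proof (rule vec.span_sum)
        fix i
        show "x $ i *s axis i 1 \<in> vec.span ?B"
          using x by (cases "i \<in> fix_vars g")
            (auto simp: Fix_diagonal[OF assms] vec.span_zero intro: vec.span_scale vec.span_base)
      qed
      finally show "x \<in> vec.span ?B" .
    qed
  qed
  moreover have "vec.independent ?B"
    by (rule vec.independent_mono[OF independent_cart_basis]) (unfold cart_basis_def, blast)
  ultimately have "vec.dim (Fix g) = card ?B"
    using vec.dim_span_eq_card_independent[of ?B] by simp
  then show ?thesis
    using inj by (simp add: card_image inj_on_subset)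
qed

lemma eval_series_restrict_vars:
  fixes g :: "complex ^ 'n ^ 'n"
  assumes "is_diagonal g" "x \<in> Fix g"
  shows "eval_series (restrict_vars (fix_vars g) a) x = eval_series a x"
  unfolding eval_series_def
proof (rule Sum_any.cong)
  fix m
  have "(\<Prod>i\<in>UNIV. (x $ i) ^ Poly_Mapping.lookup m i) = 0" if "\<not> Poly_Mapping.keys m \<subseteq> fix_vars g"
  proof -
    from that obtain i where i: "i \<in> Poly_Mapping.keys m" "i \<notin> fix_vars g" by auto
    then have "(x $ i) ^ Poly_Mapping.lookup m i = 0"
      using assms by (auto simp: Fix_diagonal in_keys_iff)
    then show ?thesis by (meson UNIV_I finite prod_zero)
  qed
  then show "restrict_vars (fix_vars g) a m * (\<Prod>i\<in>UNIV. (x $ i) ^ Poly_Mapping.lookup m i)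
      = a m * (\<Prod>i\<in>UNIV. (x $ i) ^ Poly_Mapping.lookup m i)"
    by (auto simp: restrict_vars_def)
qed

section \<open>Quotients and direct sums of vector spaces\<close>

text \<open>The fields \<open>mult\<close> and \<open>one\<close> of a module record carry no meaning.\<close>

definition complex_field :: "complex ring" where
  "complex_field = \<lparr>carrier = UNIV, mult = (*), one = 1, zero = 0, add = (+)\<rparr>"

definition quotient_module :: "('a, 'b) module \<Rightarrow> 'b set \<Rightarrow> ('a, 'b set) module" where
  "quotient_module M N =
     \<lparr>carrier = a_rcosets\<^bsub>M\<^esub> N, mult = undefined, one = undefined, zero = N,
      add = set_add M, smult = (\<lambda>c A. \<Union>a\<in>A. N +>\<^bsub>M\<^esub> (c \<odot>\<^bsub>M\<^esub> a))\<rparr>"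

text \<open>For a finite index set the direct sum is the product.\<close>

definition finite_direct_sum :: "'i set \<Rightarrow> ('i \<Rightarrow> ('a, 'b) module) \<Rightarrow> ('a, 'i \<Rightarrow> 'b) module" where
  "finite_direct_sum A M =
     \<lparr>carrier = (\<Pi>\<^sub>E i\<in>A. carrier (M i)), mult = undefined, one = undefined,
      zero = (\<lambda>i\<in>A. \<zero>\<^bsub>M i\<^esub>), add = (\<lambda>x y. \<lambda>i\<in>A. x i \<oplus>\<^bsub>M i\<^esub> y i),
      smult = (\<lambda>c x. \<lambda>i\<in>A. c \<odot>\<^bsub>M i\<^esub> x i)\<rparr>"

section \<open>The space of top forms modulo \<open>df\<close>\<close>

text \<open>
  \<open>germs I\<close> is the ring of germs at \<open>0\<close> of holomorphic functions in the variables \<open>x\<^sub>i\<close>,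
  \<open>i \<in> I\<close>, as convergent power series.  A germ \<open>a\<close> stands also for the top form \<open>a dx\<^sub>I\<close>,
  \<open>dx\<^sub>I\<close> the exterior product of the \<open>dx\<^sub>i\<close>, \<open>i \<in> I\<close>.
\<close>

definition germs :: "'n::finite set \<Rightarrow> 'n cseries set" where
  "germs I = {a. (\<forall>m. a m \<noteq> 0 \<longrightarrow> Poly_Mapping.keys m \<subseteq> I) \<and>
     (\<exists>r>0. (\<lambda>m. norm (a m) * r ^ (\<Sum>i\<in>UNIV. Poly_Mapping.lookup m i)) summable_on UNIV)}"

definition germ_mult :: "'n cseries \<Rightarrow> 'n cseries \<Rightarrow> 'n cseries" where
  "germ_mult a b = (\<lambda>m. \<Sum>(k, l) | k + l = m. a k * b l)"

definition germ_module :: "'n::finite set \<Rightarrow> (complex, 'n cseries) module" where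
  "germ_module I =
     \<lparr>carrier = germs I, mult = undefined, one = undefined, zero = (\<lambda>m. 0),
      add = (\<lambda>a b m. a m + b m), smult = (\<lambda>c a m. c * a m)\<rparr>"

definition jacobian_ideal :: "'n::finite set \<Rightarrow> 'n cseries \<Rightarrow> 'n cseries set" where
  "jacobian_ideal I f =
     {(\<lambda>m. \<Sum>i\<in>I. germ_mult (partial i f) (h i) m) | h. \<forall>i\<in>I. h i \<in> germs I}"

definition Omega :: "'n::finite set \<Rightarrow> 'n cseries \<Rightarrow> (complex, 'n cseries set) module" where
  "Omega I f = quotient_module (germ_module I) (jacobian_ideal I f)"

definition monomial_form :: "'n::finite set \<Rightarrow> 'n cseries \<Rightarrow> 'n monomial \<Rightarrow> 'n cseries set" where
  "monomial_form I f k =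
     jacobian_ideal I f +>\<^bsub>germ_module I\<^esub> (\<lambda>m. if m = k then 1 else 0)"

text \<open>
  For a weighted homogeneous \<open>f\<close> with weights \<open>w\<close> in the variables \<open>x\<^sub>i\<close>, \<open>i \<in> I\<close>, the bidegree
  \<open>(p, q)\<close> part of Steenbrink's Hodge structure on the vanishing cohomology under its identification
  with \<open>Omega I f\<close>: it lives on \<open>p + q = card I\<close>, where it is spanned by the
  monomial forms of weight \<open>q\<close>; the weight of a form includes the factor \<open>dx\<^sub>I\<close>.  For \<open>I = {}\<close> this is \<open>\<complex>\<close> in bidegree \<open>(0, 0)\<close>.
\<close>

definition hodge_space ::
    "'n::finite set \<Rightarrow> 'n cseries \<Rightarrow> ('n \<Rightarrow> rat) \<Rightarrow> rat \<Rightarrow> rat \<Rightarrow> 'n cseries set set" where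
  "hodge_space I f w p q =
     (if p + q = of_nat (card I)
      then LinearCombinations.module.span complex_field (Omega I f)
             {monomial_form I f k | k.
                Poly_Mapping.keys k \<subseteq> I \<and> (\<Sum>i\<in>I. w i * (of_nat (Poly_Mapping.lookup k i) + 1)) = q}
      else {\<zero>\<^bsub>Omega I f\<^esub>})"

text \<open>
  Pullback of \<open>a dx\<^sub>I\<close> along the diagonal matrix \<open>g\<close>; the exponent \<open>+ 1\<close> comes from \<open>dx\<^sub>I\<close>.
  The action by inverse pullback has the same invariants.
\<close>

definition act_form :: "'n::finite set \<Rightarrow> complex ^ 'n ^ 'n \<Rightarrow> 'n cseries \<Rightarrow> 'n cseries" where
  "act_form I g a = (\<lambda>m. (\<Prod>i\<in>I. (g $ i $ i) ^ (Poly_Mapping.lookup m i + 1)) * a m)"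

definition invariants ::
    "'n::finite set \<Rightarrow> (complex ^ 'n ^ 'n) set \<Rightarrow> 'n cseries set set \<Rightarrow> 'n cseries set set" where
  "invariants I G V = {c \<in> V. \<forall>g\<in>G. act_form I g ` c = c}"

section \<open>The bigraded space, Hodge numbers and variance of a pair\<close>

definition sector ::
    "'n::finite cpoly \<Rightarrow> ('n \<Rightarrow> rat) \<Rightarrow> (complex ^ 'n ^ 'n) set \<Rightarrow> rat \<Rightarrow> rat
      \<Rightarrow> complex ^ 'n ^ 'n \<Rightarrow> (complex, 'n cseries set) module" where
  "sector f w G p q g =
     (let I = fix_vars g; fg = restrict_vars I (Poly_Mapping.lookup f) in
      (Omega I fg)\<lparr>carrier := invariants I G (hodge_space I fg w (p - age g) (q - age g))\<rparr>)"

definition orbifold_hodge_space ::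
    "'n::finite cpoly \<Rightarrow> ('n \<Rightarrow> rat) \<Rightarrow> (complex ^ 'n ^ 'n) set \<Rightarrow> rat \<Rightarrow> rat
      \<Rightarrow> (complex, complex ^ 'n ^ 'n \<Rightarrow> 'n cseries set) module" where
  "orbifold_hodge_space f w G p q = finite_direct_sum G (sector f w G p q)"

definition hodge_number ::
    "'n::finite cpoly \<Rightarrow> ('n \<Rightarrow> rat) \<Rightarrow> (complex ^ 'n ^ 'n) set \<Rightarrow> rat \<Rightarrow> rat \<Rightarrow> nat" where
  "hodge_number f w G p q = vectorspace.dim complex_field (orbifold_hodge_space f w G p q)"

text \<open>
  Sums over all \<open>(p, q) \<in> \<rat>\<^sup>2\<close> are sums over the support, which is finite.  The floor in the
  exponent of the sign is harmless, as \<open>p + q\<close> is an integer wherever the Hodge number is nonzero.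
\<close>

definition milnor_number ::
    "'n::finite cpoly \<Rightarrow> ('n \<Rightarrow> rat) \<Rightarrow> (complex ^ 'n ^ 'n) set \<Rightarrow> rat" where
  "milnor_number f w G = Sum_any (\<lambda>(p, q).
     (-1) powi \<lfloor>(p - of_nat CARD('n)) + q\<rfloor> * of_nat (hodge_number f w G p q))"

definition variance ::
    "'n::finite cpoly \<Rightarrow> ('n \<Rightarrow> rat) \<Rightarrow> (complex ^ 'n ^ 'n) set \<Rightarrow> rat" where
  "variance f w G = Sum_any (\<lambda>(p, q).
     (-1) powi \<lfloor>(p - of_nat CARD('n)) + q\<rfloor> * (q - of_nat CARD('n) / 2)\<^sup>2
       * of_nat (hodge_number f w G p q))"

definition c_hat :: "('n::finite \<Rightarrow> rat) \<Rightarrow> rat" where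
  "c_hat w = of_nat CARD('n) - 2 * (\<Sum>i\<in>UNIV. w i)"

end

theory Submission
  imports Defs
    "HOL-Computational_Algebra.Fundamental_Theorem_Algebra"
    "HOL-Library.Function_Algebras"
    "HOL-Real_Asymp.Real_Asymp"
begin

text \<open>
  Fix \<open>g \<in> G\<close> and let \<open>I\<close> be the set of variables fixed by \<open>g\<close>.  The partial derivatives of \<open>f\<^sup>g\<close>
  vanish simultaneously only at the origin, so powers of the variables lie in the Jacobian ideal and
  the Koszul complex of the partial derivatives is exact.  The dimension of the \<open>G\<close>-invariant part of
  weight \<open>l\<close> of \<open>\<Omega>\<close> is therefore an Euler characteristic, and its generating function in \<open>e\<^sup>z\<close> is the
  average over \<open>h \<in> G\<close> of the product over \<open>i \<in> I\<close> of
  \<open>(h\<^sub>i exp (w\<^sub>i z) - exp z) / (1 - h\<^sub>i exp (w\<^sub>i z))\<close>.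

  Write \<open>g\<^sub>i = exp (2\<pi>\<i> \<theta>\<^sub>i)\<close> with \<open>0 \<le> \<theta>\<^sub>i < 1\<close>.  The shift by the age together with the sign turns every
  variable not fixed by \<open>g\<close> into a factor \<open>- exp ((\<theta>\<^sub>i - 1/2) z)\<close>.  So the signed generating function
  of the exponents, centred at \<open>n/2\<close>, is a double average over \<open>g, h \<in> G\<close> of products of \<open>n\<close> factors.  Its
  value at \<open>z = 0\<close> is the Milnor number and its second derivative there is the variance.
  The expansion of the factors to second order reduces the claim to sums over \<open>G\<close>.  There the
  square of the sum of the logarithmic derivatives drops out, because the sawtooth and the cotangent
  forms of Dedekind sums cancel, and what remains is \<open>(1 - 2 w\<^sub>i) / 12\<close> for every variable.
\<close>

section \<open>Koszul complexes\<close>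

text \<open>The squared logarithmic derivatives cancel only between sectors: \<open>saw\<close>
  stems from the age shift in variables moved by \<open>g\<close>, \<open>ell\<close> from the
  average over \<open>h\<close> in variables fixed by \<open>g\<close>. Up to sign
  \<open>ell\<close> is the discrete Fourier transform of \<open>saw\<close>, so the cancellation is
  Parseval's identity. As for 1/12: where \<open>g\<close> and \<open>h\<close> have entry 1, the
  centred factor is sinh((1 - w) z / 2) / sinh(w z / 2), an even function with relative second
  derivative (1 - 2 w) / 12 at 0; other entries of \<open>h\<close> add multiples of 1 - 2 w that
  restore this constant on average. Two obstacles shape the rest. The geometric series converge only
  for z < 0, and factors can be 0/0 at 0; hence a finite sum of exponentials is compared with the
  product formula on the left of 0, by second order expansions. The forms have convergent power
  series as coefficients, while dimensions are counted with polynomials: positive weights make every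
  graded piece finite-dimensional, and cutting cofactors down to one weight and character passes
  from germs to polynomials.\<close>

definition lin_ideal :: "(nat \<Rightarrow> 'r::comm_ring_1) \<Rightarrow> nat \<Rightarrow> 'r set" where
  "lin_ideal a k = {(\<Sum>j<k. c j * a j) | c. True}"

lemma lin_ideal_0: "0 \<in> lin_ideal a k"
  unfolding lin_ideal_def by (auto intro!: exI[of _ "\<lambda>_. 0"])

lemma lin_ideal_add: "x \<in> lin_ideal a k \<Longrightarrow> y \<in> lin_ideal a k \<Longrightarrow> x + y \<in> lin_ideal a k"
proof -
  assume "x \<in> lin_ideal a k" "y \<in> lin_ideal a k"
  then obtain c c' where "x = (\<Sum>j<k. c j * a j)" "y = (\<Sum>j<k. c' j * a j)"
    unfolding lin_ideal_def by auto
  then have "x + y = (\<Sum>j<k. (c j + c' j) * a j)"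
    by (simp add: sum.distrib distrib_right)
  then show ?thesis unfolding lin_ideal_def by (intro CollectI exI[of _ "\<lambda>j. c j + c' j"]) simp
qed

lemma lin_ideal_mult: "x \<in> lin_ideal a k \<Longrightarrow> r * x \<in> lin_ideal a k"
proof -
  assume "x \<in> lin_ideal a k"
  then obtain c where "x = (\<Sum>j<k. c j * a j)"
    unfolding lin_ideal_def by auto
  then have "r * x = (\<Sum>j<k. (r * c j) * a j)"
    by (simp add: sum_distrib_left mult.assoc)
  then show ?thesis unfolding lin_ideal_def by (intro CollectI exI[of _ "\<lambda>j. r * c j"]) simp
qed

lemma lin_ideal_diff: "x \<in> lin_ideal a k \<Longrightarrow> y \<in> lin_ideal a k \<Longrightarrow> x - y \<in> lin_ideal a k"
  using lin_ideal_add[of x a k "- y"] lin_ideal_mult[of y a k "-1"] by simp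

lemma lin_ideal_sum: "(\<And>i. i \<in> A \<Longrightarrow> x i \<in> lin_ideal a k) \<Longrightarrow> sum x A \<in> lin_ideal a k"
  by (induction A rule: infinite_finite_induct) (auto intro: lin_ideal_0 lin_ideal_add)

text \<open>Divisibility by \<open>a k\<close> modulo the smaller ideal: this is how the quotient
  \<open>u\<close> in \<open>exact_mod\<close> is obtained.\<close>

lemma lin_ideal_Suc: "x \<in> lin_ideal a (Suc k) \<longleftrightarrow> (\<exists>u. x - a k * u \<in> lin_ideal a k)"
proof
  assume "x \<in> lin_ideal a (Suc k)"
  then obtain c where "x = (\<Sum>j<Suc k. c j * a j)"
    unfolding lin_ideal_def by auto
  then have "x - a k * c k = (\<Sum>j<k. c j * a j)" by (simp add: mult.commute)
  then show "\<exists>u. x - a k * u \<in> lin_ideal a k" unfolding lin_ideal_def by blast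
next
  assume "\<exists>u. x - a k * u \<in> lin_ideal a k"
  then obtain u c where "x - a k * u = (\<Sum>j<k. c j * a j)"
    unfolding lin_ideal_def by auto
  then have "x = (\<Sum>j<Suc k. (c(k := u)) j * a j)"
    by (simp add: mult.commute diff_eq_eq)
  then show "x \<in> lin_ideal a (Suc k)" unfolding lin_ideal_def by blast
qed

locale koszul =
  fixes I :: "'i set" and ord :: "'i \<Rightarrow> nat" and f :: "'i \<Rightarrow> 'r::comm_ring_1"
  assumes fin: "finite I" and inj: "inj_on ord I"
begin

text \<open>Koszul signs. A chain is read as the sum over \<open>S\<close> of
  \<open>\<omega> S\<close> times the exterior product of the basis vectors of \<open>S\<close> in
  the order given by \<open>ord\<close>; \<open>sg i S\<close> is the sign of moving the
  \<open>i\<close>-th vector past those before it. Thus \<open>d\<close> is contraction with the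
  \<open>f i\<close> and lowers the degree, and \<open>e i\<close> is exterior multiplication by the
  \<open>i\<close>-th basis vector.\<close>

definition sg :: "'i \<Rightarrow> 'i set \<Rightarrow> 'r" where
  "sg i S = (-1) ^ card {j \<in> S. ord j < ord i}"

definition d :: "('i set \<Rightarrow> 'r) \<Rightarrow> 'i set \<Rightarrow> 'r" where
  "d \<omega> S = (if S \<subseteq> I then \<Sum>i\<in>I - S. sg i S * f i * \<omega> (insert i S) else 0)"

definition e :: "'i \<Rightarrow> ('i set \<Rightarrow> 'r) \<Rightarrow> 'i set \<Rightarrow> 'r" where
  "e i \<omega> S = (if i \<in> S then sg i S * \<omega> (S - {i}) else 0)"

definition chains :: "nat \<Rightarrow> ('i set \<Rightarrow> 'r) set" where
  "chains j = {\<omega>. \<forall>S. \<omega> S \<noteq> 0 \<longrightarrow> S \<subseteq> I \<and> card S = j}"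

lemma sg_sq: "sg i S * sg i S = 1"
  by (simp add: sg_def flip: power_mult_distrib)

lemma sg_insert:
  assumes "finite S" "i \<notin> S"
  shows "sg j (insert i S) = (if ord i < ord j then - sg j S else sg j S)"
proof -
  have "{l \<in> insert i S. ord l < ord j} =
      (if ord i < ord j then insert i {l \<in> S. ord l < ord j} else {l \<in> S. ord l < ord j})"
    by auto
  then show ?thesis using assms by (simp add: sg_def)
qed

lemma sg_remove: "finite S \<Longrightarrow> sg i (S - {i}) = sg i S"
  unfolding sg_def by (rule arg_cong[where f = "\<lambda>A. (-1) ^ card A"]) auto

text \<open>Exactly one of the two orders of inserting \<open>i\<close> and \<open>j\<close> picks
  up a sign, namely the one where the element inserted first precedes the other.\<close>

lemma sg_swap:
  assumes "finite S" "i \<notin> S" "j \<notin> S" "i \<noteq> j" "i \<in> I" "j \<in> I"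
  shows "sg i S * sg j (insert i S) = - (sg j S * sg i (insert j S))"
proof -
  have "ord i \<noteq> ord j" using inj assms by (auto dest: inj_onD)
  then show ?thesis using assms by (auto simp: sg_insert)
qed

lemma d_add: "d (\<lambda>S. x S + y S) S = d x S + d y S"
  by (simp add: d_def algebra_simps sum.distrib)

lemma d_mult: "d (\<lambda>S. r * x S) S = r * d x S"
  by (simp add: d_def algebra_simps sum_distrib_left)

lemma d_diff: "d (\<lambda>S. x S - y S) S = d x S - d y S"
  using d_add[of x "\<lambda>S. (-1) * y S" S] d_mult[of "-1" y S] by simp

lemma d_sum: "d (\<lambda>S. \<Sum>i\<in>A. x i S) S = (\<Sum>i\<in>A. d (x i) S)"
proof (induction A rule: infinite_finite_induct)
  case (insert i A)
  have "d (\<lambda>S. \<Sum>i\<in>insert i A. x i S) S = d (\<lambda>S. x i S + (\<Sum>i\<in>A. x i S)) S"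
    using insert.hyps by simp
  also have "\<dots> = (\<Sum>i\<in>insert i A. d (x i) S)"
    using insert by (subst d_add) simp
  finally show ?case .
qed (auto simp: d_def)

lemma d_in_ideal: "(\<And>S. x S \<in> lin_ideal a k) \<Longrightarrow> d x S \<in> lin_ideal a k"
  by (auto simp: d_def lin_ideal_0 intro!: lin_ideal_sum lin_ideal_mult)

lemma e_in_ideal: "(\<And>S. x S \<in> lin_ideal a k) \<Longrightarrow> e i x S \<in> lin_ideal a k"
  by (auto simp: e_def lin_ideal_0 intro!: lin_ideal_mult)

text \<open>Two indices outside \<open>S\<close> are contracted in both orders, with opposite signs;
  \<open>L\<close> and \<open>U\<close> collect the two orders and are exchanged by swapping the
  pair.\<close>

lemma d_d: "d (d \<omega>) S = 0"
proof (cases "S \<subseteq> I")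
  case True
  then have finS: "finite S" using fin by (rule finite_subset)
  define T where "T = (\<lambda>(i, j). sg i S * sg j (insert i S) * (f i * f j * \<omega> (insert j (insert i S))))"
  define L where "L = {(i, j). i \<in> I - S \<and> j \<in> I - S \<and> ord i < ord j}"
  define U where "U = {(i, j). i \<in> I - S \<and> j \<in> I - S \<and> ord j < ord i}"
  have LU: "finite L" "finite U" "L \<inter> U = {}"
    by (auto simp: L_def U_def fin intro: finite_subset[of _ "I \<times> I"])
  have "d (d \<omega>) S = (\<Sum>i\<in>I - S. \<Sum>j\<in>I - insert i S. T (i, j))"
    using True by (auto simp: d_def T_def sum_distrib_left mult_ac intro!: sum.cong)
  also have "\<dots> = (\<Sum>(i, j)\<in>Sigma (I - S) (\<lambda>i. I - insert i S). T (i, j))"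
    using fin by (subst sum.Sigma) auto
  also have "Sigma (I - S) (\<lambda>i. I - insert i S) = L \<union> U"
    using inj by (auto simp: L_def U_def inj_on_def) (metis nat_neq_iff)+
  also have "(\<Sum>(i, j)\<in>L \<union> U. T (i, j)) = (\<Sum>x\<in>L. T x) + (\<Sum>x\<in>U. T x)"
    using LU by (simp add: sum.union_disjoint)
  also have "(\<Sum>x\<in>U. T x) = (\<Sum>(i, j)\<in>L. T (j, i))"
    by (rule sum.reindex_bij_witness[of _ prod.swap prod.swap]) (auto simp: L_def U_def)
  also have "\<dots> = (\<Sum>x\<in>L. - T x)"
  proof (rule sum.cong[OF refl], clarify)
    fix i j assume "(i, j) \<in> L"
    then have "sg j S * sg i (insert j S) = - (sg i S * sg j (insert i S))"
      using finS by (intro sg_swap) (auto simp: L_def)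
    moreover have "T (j, i) = (sg j S * sg i (insert j S)) * (f i * f j * \<omega> (insert j (insert i S)))"
      by (simp add: T_def insert_commute mult.commute)
    ultimately show "T (j, i) = - T (i, j)"
      by (simp add: T_def)
  qed
  also have "(\<Sum>x\<in>L. T x) + \<dots> = 0" by (simp add: sum_negf)
  finally show ?thesis .
qed (simp add: d_def)

text \<open>The formula of Cartan type that makes multiplication by \<open>f i\<close>
  null-homotopic. If \<open>i\<close> lies in \<open>S\<close>, the terms that insert some
  \<open>j\<close> outside \<open>S\<close> cancel by \<open>sg_swap\<close>, and the term of
  \<open>e i (d \<omega>)\<close> that puts \<open>i\<close> back survives; otherwise only
  \<open>j = i\<close> contributes to \<open>d (e i \<omega>)\<close>.\<close>

lemma homotopy:
  assumes "i \<in> I" "S \<subseteq> I"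
  shows "d (e i \<omega>) S + e i (d \<omega>) S = f i * \<omega> S"
proof (cases "i \<in> S")
  case False
  have finS: "finite S" using assms fin finite_subset by blast
  have "d (e i \<omega>) S = (\<Sum>j\<in>I - S. if j = i then f i * \<omega> S else 0)"
    using assms False finS sg_sq[of i S]
    by (auto simp: d_def e_def sg_insert mult_ac intro!: sum.cong)
  also have "\<dots> = f i * \<omega> S" using assms False fin by simp
  finally show ?thesis using False by (simp add: e_def)
next
  case True
  have finS: "finite S" using assms fin finite_subset by blast
  let ?S = "S - {i}"
  have S: "insert i ?S = S" "finite ?S" "i \<notin> ?S" using True finS by auto
  have "d (e i \<omega>) S = (\<Sum>j\<in>I - S. sg j S * sg i (insert j S) * (f j * \<omega> (insert j ?S)))"
    using assms True by (auto simp: d_def e_def mult_ac insert_Diff_if intro!: sum.cong)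
  moreover have "e i (d \<omega>) S = sg i S * (\<Sum>j\<in>I - ?S. sg j ?S * f j * \<omega> (insert j ?S))"
    using assms True by (auto simp: d_def e_def)
  moreover have "I - ?S = insert i (I - S)" using assms by auto
  moreover have "(\<Sum>j\<in>insert i (I - S). sg j ?S * f j * \<omega> (insert j ?S)) =
     sg i S * f i * \<omega> S + (\<Sum>j\<in>I - S. sg j ?S * f j * \<omega> (insert j ?S))"
    using fin True finS S by (subst sum.insert) (auto simp: sg_remove)
  moreover have "sg i S * (sg i S * f i * \<omega> S) = f i * \<omega> S"
    using sg_sq[of i S] by (metis mult.assoc mult_1)
  moreover have "(\<Sum>j\<in>I - S. sg j S * sg i (insert j S) * (f j * \<omega> (insert j ?S))) =
     - (sg i S * (\<Sum>j\<in>I - S. sg j ?S * f j * \<omega> (insert j ?S)))"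
    unfolding sum_distrib_left sum_negf[symmetric]
  proof (rule sum.cong[OF refl])
    fix j assume j: "j \<in> I - S"
    have "sg j S * sg i (insert j S) = - (sg i S * sg j ?S)"
    proof -
      have "sg i ?S * sg j (insert i ?S) = - (sg j ?S * sg i (insert j ?S))"
        using assms True j S by (intro sg_swap) auto
      moreover have "sg i (insert j ?S) = sg i (insert j S)"
        unfolding sg_def by (rule arg_cong[where f = "\<lambda>A. (-1) ^ card A"]) auto
      ultimately have 1: "sg i S * sg j S = - (sg j ?S * sg i (insert j S))"
        using S finS by (simp add: sg_remove)
      have "sg j S * sg i (insert j S) = (sg i S * sg i S) * (sg j S * sg i (insert j S))"
        by (simp add: sg_sq)
      also have "\<dots> = (sg i S * sg j S) * (sg i S * sg i (insert j S))" by (simp only: mult_ac)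
      also have "\<dots> = - (sg i S * sg j ?S) * (sg i (insert j S) * sg i (insert j S))"
        unfolding 1 by (simp add: mult_ac)
      finally show ?thesis by (simp add: sg_sq)
    qed
    then show "sg j S * sg i (insert j S) * (f j * \<omega> (insert j ?S)) =
       - (sg i S * (sg j ?S * f j * \<omega> (insert j ?S)))"
      by (simp add: mult_ac)
  qed
  ultimately show ?thesis by (simp add: distrib_left)
qed

lemma d_outside: "\<not> S \<subseteq> I \<Longrightarrow> d \<omega> S = 0"
  by (simp add: d_def)

lemma d_chains: "\<omega> \<in> chains (Suc j) \<Longrightarrow> d \<omega> \<in> chains j"
proof -
  assume w: "\<omega> \<in> chains (Suc j)"
  have "card S = j" if "d \<omega> S \<noteq> 0" for S
  proof -
    have S: "S \<subseteq> I" "(\<Sum>i\<in>I - S. sg i S * f i * \<omega> (insert i S)) \<noteq> 0"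
      using that by (auto simp: d_def split: if_splits)
    then obtain i where "i \<in> I - S" "sg i S * f i * \<omega> (insert i S) \<noteq> 0"
      by (meson sum.neutral)
    then have "i \<notin> S" "\<omega> (insert i S) \<noteq> 0" by auto
    then show ?thesis using w S(1) finite_subset[OF S(1) fin] by (force simp: chains_def)
  qed
  then show ?thesis by (auto simp: chains_def d_def)
qed

text \<open>
  Multiplication by \<open>a k\<close> is null-homotopic, by a homotopy \<open>h\<close>.  It turns a cycle \<open>z\<close> modulo
  \<open>a 0, \<dots>, a (k - 1)\<close> into a cycle \<open>h z\<close> of higher degree modulo \<open>a 0, \<dots>, a k\<close>.  Hence the induction
  goes down from \<open>k = card I\<close>, where no degree is left.
\<close>

theorem exact_mod:
  assumes reg: "\<And>k u. k < card I \<Longrightarrow> a k * u \<in> lin_ideal a k \<Longrightarrow> u \<in> lin_ideal a k"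
    and a: "\<And>k. k < card I \<Longrightarrow> \<exists>c. a k = (\<Sum>i\<in>I. c i * f i)"
  shows "k \<le> card I \<Longrightarrow> k < j \<Longrightarrow> z \<in> chains j \<Longrightarrow> (\<And>S. d z S \<in> lin_ideal a k) \<Longrightarrow>
     \<exists>y\<in>chains (Suc j). \<forall>S. z S - d y S \<in> lin_ideal a k"
proof (induction k arbitrary: j z rule: inc_induct)
  case base
  have "z S = 0" for S
    using base by (auto simp: chains_def) (metis card_mono fin leD)
  then show ?case
    by (intro bexI[of _ "\<lambda>_. 0"]) (auto simp: chains_def d_def lin_ideal_0)
next
  case (step k)
  obtain c where c: "a k = (\<Sum>i\<in>I. c i * f i)" using a[of k] step by auto
  define h where "h = (\<lambda>\<omega> S. \<Sum>i\<in>I. c i * e i \<omega> S)"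
  have hom: "d (h \<omega>) S + h (d \<omega>) S = a k * \<omega> S" if "S \<subseteq> I" for \<omega> S
  proof -
    have "d (h \<omega>) S + h (d \<omega>) S = (\<Sum>i\<in>I. c i * (d (e i \<omega>) S + e i (d \<omega>) S))"
      by (simp add: h_def d_sum d_mult distrib_left sum.distrib)
    also have "\<dots> = a k * \<omega> S"
      using that by (simp add: homotopy c sum_distrib_right mult.assoc)
    finally show ?thesis .
  qed
  have h_ideal: "h x S \<in> lin_ideal a k" if "\<And>S. x S \<in> lin_ideal a k" for x S
    unfolding h_def by (intro lin_ideal_sum lin_ideal_mult e_in_ideal that)
  have mono: "x \<in> lin_ideal a (Suc k)" if "x \<in> lin_ideal a k" for x
    unfolding lin_ideal_Suc using that by (intro exI[of _ 0]) simp
  have akS: "a k * x \<in> lin_ideal a (Suc k)" for x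
    unfolding lin_ideal_Suc by (intro exI[of _ x]) (simp add: lin_ideal_0)
  let ?w = "h z"
  have w: "?w \<in> chains (Suc j)"
    unfolding chains_def
  proof (intro CollectI allI impI)
    fix S assume "?w S \<noteq> 0"
    then obtain i where i: "i \<in> I" "e i z S \<noteq> 0"
      unfolding h_def by (metis (no_types, lifting) mult_zero_right sum.neutral)
    then have "i \<in> S" "z (S - {i}) \<noteq> 0" by (auto simp: e_def split: if_splits)
    moreover from this have "S - {i} \<subseteq> I" "card (S - {i}) = j"
      using step.prems by (auto simp: chains_def)
    moreover have "finite S" using calculation fin finite_subset by fastforce
    ultimately show "S \<subseteq> I \<and> card S = Suc j"
      using i by (metis card_Suc_Diff1 insert_Diff insert_subset)
  qed
  have "d ?w S \<in> lin_ideal a (Suc k)" for S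
  proof (cases "S \<subseteq> I")
    case True
    have "d ?w S = a k * z S - h (d z) S" using hom[OF True, of z] by (simp add: eq_diff_eq)
    then show ?thesis using lin_ideal_diff[OF akS mono[OF h_ideal]] step.prems by simp
  qed (simp add: d_outside lin_ideal_0)
  then obtain y where y: "y \<in> chains (Suc (Suc j))" "\<And>S. ?w S - d y S \<in> lin_ideal a (Suc k)"
    using step.IH[of "Suc j" ?w] step.prems w by auto
  define v where "v = (\<lambda>S. ?w S - d y S)"
  have vch: "v \<in> chains (Suc j)" using w d_chains[OF y(1)] unfolding v_def chains_def by (simp, metis diff_zero)
  \<comment> \<open>\<open>u\<close> is required to vanish wherever \<open>v\<close> does, so that
    it stays a chain of degree \<open>Suc j\<close>.\<close>
  have "\<exists>u. (v S - a k * u \<in> lin_ideal a k) \<and> (v S = 0 \<longrightarrow> u = 0)" for S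
    using y(2)[of S] unfolding lin_ideal_Suc v_def
    by (cases "h z S - d y S = 0") (auto intro: lin_ideal_0 exI[of _ 0])
  then obtain u where u: "\<And>S. v S - a k * u S \<in> lin_ideal a k" "\<And>S. v S = 0 \<Longrightarrow> u S = 0"
    by metis
  have uch: "u \<in> chains (Suc j)" using vch u(2) by (auto simp: chains_def)
  have "z S - d u S \<in> lin_ideal a k" for S
  proof (cases "S \<subseteq> I")
    case True
    have "d v S = d ?w S" unfolding v_def by (simp add: d_diff d_d)
    \<comment> \<open>Since \<open>v\<close> and \<open>h z\<close> have the same boundary,
      \<open>a k\<close> times the defect of \<open>u\<close> lies in the ideal, and regularity
      cancels \<open>a k\<close>.\<close>
    have "a k * (z S - d u S) = d (\<lambda>S. v S - a k * u S) S + h (d z) S"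
      using hom[OF True, of z] unfolding d_diff d_mult \<open>d v S = d ?w S\<close> by (simp add: algebra_simps)
    also have "\<dots> \<in> lin_ideal a k"
      by (rule lin_ideal_add[OF d_in_ideal[OF u(1)] h_ideal[OF step.prems(3)]])
    finally show ?thesis using reg step by auto
  next
    case False
    then have "z S = 0" using step.prems by (auto simp: chains_def)
    with False show ?thesis by (simp add: d_outside lin_ideal_0)
  qed
  with uch show ?case by blast
qed

text \<open>The bottom case \<open>k = 0\<close>, where the ideal is zero. The regular sequence
  \<open>a\<close> may be any one of length \<open>card I\<close> in the ideal generated by the
  \<open>f i\<close>, so it can be much simpler than the \<open>f i\<close> themselves.\<close>

corollary exact:
  assumes "\<And>k u. k < card I \<Longrightarrow> a k * u \<in> lin_ideal a k \<Longrightarrow> u \<in> lin_ideal a k"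
    and "\<And>k. k < card I \<Longrightarrow> \<exists>c. a k = (\<Sum>i\<in>I. c i * f i)"
    and "z \<in> chains j" "0 < j" "\<And>S. d z S = 0"
  shows "\<exists>y\<in>chains (Suc j). z = d y"
proof -
  have "\<exists>y\<in>chains (Suc j). \<forall>S. z S - d y S \<in> lin_ideal a 0"
    by (rule exact_mod) (use assms in \<open>auto simp: lin_ideal_0\<close>)
  then show ?thesis by (auto simp: lin_ideal_def)
qed

end

section \<open>Dedekind sums over diagonal groups\<close>

text \<open>The sawtooth of the angle: \<open>x - 1 / 2\<close> at \<open>cis (2 * pi * x)\<close>
  for \<open>0 < x < 1\<close>. The value 0 at 1, the mean of the one-sided limits, makes
  \<open>saw\<close> odd under inversion.\<close>

definition saw :: "complex \<Rightarrow> complex" where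
  "saw z = (if z = 1 then 0 else of_real (Arg2pi z / (2 * pi) - 1 / 2))"

text \<open>On the unit circle \<open>ell (cis t) = (\<i> / 2) cot (t / 2)\<close>.\<close>

definition ell :: "complex \<Rightarrow> complex" where
  "ell z = (if z = 1 then 0 else 1 / (1 - z) - 1 / 2)"

section \<open>Sums over roots of unity\<close>

definition roots1 :: "nat \<Rightarrow> complex set" where
  "roots1 c = {z. z ^ c = 1}"

definition rt :: "nat \<Rightarrow> nat \<Rightarrow> complex" where
  "rt c k = cis (2 * pi * (real k / real c))"

lemma bij_rt: "c > 0 \<Longrightarrow> bij_betw (rt c) {..<c} (roots1 c)"
  using Complex.bij_betw_roots_unity[of c] by (simp add: rt_def[abs_def] roots1_def)

lemma sum_rt: "c > 0 \<Longrightarrow> (\<Sum>z\<in>roots1 c. F z) = (\<Sum>k<c. F (rt c k))"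
  by (rule sum.reindex_bij_betw[symmetric, OF bij_rt])

lemma finite_roots1: "c > 0 \<Longrightarrow> finite (roots1 c)"
  using bij_rt bij_betw_finite by blast

lemma card_roots1: "c > 0 \<Longrightarrow> card (roots1 c) = c"
  using bij_betw_same_card[OF bij_rt] by simp

lemma rt_power: "rt c k = rt c 1 ^ k"
  unfolding rt_def Complex.DeMoivre by (simp add: mult_ac)

lemma rt_mem:
  assumes "c > 0"
  shows "rt c k \<in> roots1 c"
proof -
  have "rt c k ^ c = cis (2 * pi * real k)"
    using assms unfolding rt_def Complex.DeMoivre by simp
  then show ?thesis by (simp add: roots1_def cis_multiple_2pi)
qed

lemma Arg2pi_cis': "0 \<le> x \<Longrightarrow> x < 1 \<Longrightarrow> Arg2pi (cis (2 * pi * x)) = 2 * pi * x"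
  by (rule Arg2pi_unique[of 1]) (auto simp: cis_conv_exp)

lemma cis_eq_1: "0 \<le> x \<Longrightarrow> x < 1 \<Longrightarrow> cis (2 * pi * x) = 1 \<longleftrightarrow> x = 0"
  using Arg2pi_cis'[of x] Arg2pi_cis'[of 0] by auto

lemma saw_cis:
  assumes "0 \<le> x" "x < 1"
  shows "saw (cis (2 * pi * x)) = (if x = 0 then 0 else of_real (x - 1 / 2))"
  using cis_eq_1[OF assms] by (simp add: saw_def Arg2pi_cis'[OF assms])

lemma saw_inverse:
  assumes "norm z = 1"
  shows "saw (inverse z) = - saw z"
proof -
  define x where "x = Arg2pi z / (2 * pi)"
  have x: "0 \<le> x" "x < 1" using Arg2pi[of z] by (auto simp: x_def)
  have z: "z = cis (2 * pi * x)"
    using Arg2pi_eq[of z] assms by (simp add: x_def cis_conv_exp)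
  show ?thesis
  proof (cases "x = 0")
    case False
    have "inverse z = cis (2 * pi * (1 - x))"
      by (simp add: z cis_inverse right_diff_distrib flip: cis_divide) (simp add: divide_inverse)
    then have "saw (inverse z) = of_real ((1 - x) - 1 / 2)"
      using False x by (simp only: saw_cis) simp
    moreover have "saw z = of_real (x - 1 / 2)" using False x by (simp add: z saw_cis)
    ultimately show ?thesis by simp
  qed (simp add: z saw_def)
qed

lemma ell_inverse: "z \<noteq> 0 \<Longrightarrow> ell (inverse z) = - ell z"
  by (auto simp: ell_def field_simps)

lemma sum_powers_roots1:
  assumes "z \<in> roots1 c"
  shows "(\<Sum>k<c. z ^ k) = (if z = 1 then of_nat c else 0)"
  using assms by (auto simp: roots1_def geometric_sum)

lemma norm_roots1: "c > 0 \<Longrightarrow> z \<in> roots1 c \<Longrightarrow> norm z = 1"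
  unfolding roots1_def using power_eq_1_iff[of z c] by auto

lemma saw_rt: "k < c \<Longrightarrow> saw (rt c k) = (if k = 0 then 0 else of_nat k / of_nat c - 1 / 2)"
  unfolding rt_def by (subst saw_cis) auto

text \<open>Up to sign, \<open>ell\<close> is the discrete Fourier transform of \<open>saw\<close>
  on the cyclic group of order \<open>c\<close>. Both cases rest on the value of the sum of
  \<open>a * z ^ a\<close>.\<close>

lemma ell_fourier:
  assumes "c > 0" "z \<in> roots1 c"
  shows "ell z = - (\<Sum>a<c. saw (rt c a) * z ^ a)"
proof -
  have *: "(\<Sum>a<c. saw (rt c a) * z ^ a) = (\<Sum>a<c. of_nat a * z ^ a) / of_nat c - ((\<Sum>a<c. z ^ a) - 1) / 2"
  proof -
    have "(\<Sum>a<c. saw (rt c a) * z ^ a) =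
        (\<Sum>a<c. of_nat a * z ^ a / of_nat c - z ^ a / 2 + (if a = 0 then 1 / 2 else 0))"
      by (rule sum.cong) (auto simp: saw_rt algebra_simps)
    also have "\<dots> = (\<Sum>a<c. of_nat a * z ^ a) / of_nat c - ((\<Sum>a<c. z ^ a) - 1) / 2"
      using assms by (simp add: sum.distrib sum_subtractf sum_divide_distrib diff_divide_distrib)
    finally show ?thesis .
  qed
  show ?thesis
  proof (cases "z = 1")
    case True
    have "2 * (\<Sum>a<c. of_nat a :: complex) = of_nat c * (of_nat c - 1)"
      by (induction c) (auto simp: algebra_simps)
    with True show ?thesis unfolding * using assms by (simp add: ell_def field_simps)
  next
    case False
    \<comment> \<open>The differentiated geometric series, in a form without division.\<close>
    have "(z - 1) * (\<Sum>a<n. of_nat a * z ^ a) = of_nat n * z ^ n - z * (\<Sum>a<n. z ^ a)" for n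
      by (induction n) (auto simp: algebra_simps)
    from this[of c] have "(z - 1) * (\<Sum>a<c. of_nat a * z ^ a) = of_nat c"
      using False assms(2) by (simp add: sum_powers_roots1[OF assms(2)] roots1_def)
    then have S: "(\<Sum>a<c. of_nat a * z ^ a) = of_nat c / (z - 1)"
      using False by (simp add: field_simps)
    show ?thesis unfolding * S sum_powers_roots1[OF assms(2)]
      using False assms(1) by (simp add: ell_def field_simps)
  qed
qed

lemma roots1_closed:
  "z \<in> roots1 c \<Longrightarrow> u \<in> roots1 c \<Longrightarrow> z * u \<in> roots1 c"
  "z \<in> roots1 c \<Longrightarrow> inverse z \<in> roots1 c"
  "z \<in> roots1 c \<Longrightarrow> z ^ k \<in> roots1 c"
  "1 \<in> roots1 c"
  by (auto simp: roots1_def power_mult_distrib power_inverse)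
     (metis power_commutes power_mult power_one mult.commute)

lemma roots1_nz: "c > 0 \<Longrightarrow> z \<in> roots1 c \<Longrightarrow> z \<noteq> 0"
  by (auto simp: roots1_def power_0_left)

lemma sum_roots1_shift:
  assumes "c > 0" "u \<in> roots1 c"
  shows "(\<Sum>z\<in>roots1 c. F (u * z)) = (\<Sum>z\<in>roots1 c. F z)"
  using assms roots1_nz[OF assms]
  by (intro sum.reindex_bij_witness[of _ "\<lambda>z. inverse u * z" "\<lambda>z. u * z"])
     (auto intro: roots1_closed)

lemma sum_roots1_inverse:
  shows "(\<Sum>z\<in>roots1 c. F (inverse z)) = (\<Sum>z\<in>roots1 c. F z)"
  by (intro sum.reindex_bij_witness[of _ inverse inverse]) (auto intro: roots1_closed)

lemma sum_roots1_power:
  assumes c: "c > 0"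
  shows "(\<Sum>z\<in>roots1 c. z ^ j) = (if c dvd j then of_nat c else 0)"
proof (cases "c dvd j")
  case True
  then have "z ^ j = 1" if "z \<in> roots1 c" for z
    using that by (auto simp: roots1_def power_mult)
  then show ?thesis using True by (simp add: card_roots1[OF c])
next
  case False
  define k where "k = j mod c"
  have k: "0 < k" "k < c" using False c by (auto simp: k_def dvd_eq_mod_eq_0)
  have "rt c 1 ^ j = rt c 1 ^ k * (rt c 1 ^ c) ^ (j div c)"
    by (simp add: k_def flip: power_mult power_add)
  also have "\<dots> = rt c k"
    using rt_mem[OF c, of 1] by (simp add: roots1_def rt_power[of c k])
  also have "\<dots> \<noteq> 1" using k cis_eq_1[of "real k / real c"] by (simp add: rt_def)
  finally have ne: "rt c 1 ^ j \<noteq> 1" .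
  have "(\<Sum>z\<in>roots1 c. z ^ j) = rt c 1 ^ j * (\<Sum>z\<in>roots1 c. z ^ j)"
    using sum_roots1_shift[OF c rt_mem[OF c, of 1], of "\<lambda>z. z ^ j"]
    by (simp add: power_mult_distrib sum_distrib_left)
  then show ?thesis using ne False by simp
qed

text \<open>Parseval's identity. With both factors expanded by \<open>ell_fourier\<close>, the sum
  over \<open>z\<close> is a character sum, which survives only where \<open>rt c a\<close> is the
  inverse of \<open>\<sigma> (rt c b)\<close>. It contributes the factor \<open>c\<close>, and
  \<open>saw_inverse\<close> the minus sign.\<close>

lemma dedekind_reciprocity_hom:
  assumes c: "c > 0"
    and hom: "\<And>z u. z \<in> roots1 c \<Longrightarrow> u \<in> roots1 c \<Longrightarrow> \<sigma> (z * u) = \<sigma> z * \<sigma> u"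
    and map: "\<And>z. z \<in> roots1 c \<Longrightarrow> \<sigma> z \<in> roots1 c"
  shows "(\<Sum>z\<in>roots1 c. ell z * ell (\<sigma> z)) = - of_nat c * (\<Sum>z\<in>roots1 c. saw z * saw (\<sigma> z))"
proof -
  let ?s = "\<lambda>a. saw (rt c a)"
  have one: "\<sigma> 1 = 1"
    using hom[of 1 1] map[of 1] roots1_nz[OF c, of "\<sigma> 1"] by (simp add: roots1_closed)
  have pow: "\<sigma> (z ^ k) = \<sigma> z ^ k" if "z \<in> roots1 c" for z k
    by (induction k) (use that in \<open>auto simp: one hom roots1_closed\<close>)
  have "(\<Sum>z\<in>roots1 c. ell z * ell (\<sigma> z)) =
      (\<Sum>z\<in>roots1 c. \<Sum>a<c. \<Sum>b<c. ?s a * ?s b * (z ^ a * \<sigma> z ^ b))"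
  proof (rule sum.cong[OF refl])
    fix z assume z: "z \<in> roots1 c"
    show "ell z * ell (\<sigma> z) = (\<Sum>a<c. \<Sum>b<c. ?s a * ?s b * (z ^ a * \<sigma> z ^ b))"
      unfolding ell_fourier[OF c z] ell_fourier[OF c map[OF z]]
      by (simp add: sum_product mult_ac)
  qed
  also have "\<dots> = (\<Sum>b<c. \<Sum>a<c. ?s a * ?s b * (\<Sum>z\<in>roots1 c. z ^ a * \<sigma> z ^ b))"
    by (subst sum.swap, subst (2) sum.swap, subst sum.swap) (simp add: sum_distrib_left)
  also have "\<dots> = (\<Sum>b<c. \<Sum>a<c. ?s a * ?s b * (if rt c a * \<sigma> (rt c b) = 1 then of_nat c else 0))"
  proof (intro sum.cong refl)
    fix a b
    let ?v = "rt c a * \<sigma> (rt c b)"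
    have v: "?v \<in> roots1 c" by (intro roots1_closed map rt_mem c)
    \<comment> \<open>For \<open>z = rt c k\<close> the exponents can be exchanged with
      \<open>k\<close>, because the roots are the powers of \<open>rt c 1\<close> and
      \<open>\<sigma>\<close> respects powers; the summand becomes \<open>?v ^ k\<close>.\<close>
    have "(\<Sum>z\<in>roots1 c. z ^ a * \<sigma> z ^ b) = (\<Sum>k<c. ?v ^ k)"
      unfolding sum_rt[OF c]
    proof (rule sum.cong[OF refl])
      fix k
      have "\<sigma> (rt c k) ^ b = \<sigma> (rt c b) ^ k"
        using pow rt_mem[OF c, of 1] by (simp add: rt_power[of c k] rt_power[of c b] flip: power_mult)
           (simp add: mult.commute)
      moreover have "rt c k ^ a = rt c a ^ k"
        by (simp add: rt_power[of c k] rt_power[of c a] mult.commute flip: power_mult)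
      ultimately show "rt c k ^ a * \<sigma> (rt c k) ^ b = ?v ^ k" by (simp add: power_mult_distrib)
    qed
    then show "?s a * ?s b * (\<Sum>z\<in>roots1 c. z ^ a * \<sigma> z ^ b) =
        ?s a * ?s b * (if ?v = 1 then of_nat c else 0)"
      by (simp add: sum_powers_roots1[OF v])
  qed
  also have "\<dots> = (\<Sum>b<c. ?s b * (of_nat c * - saw (\<sigma> (rt c b))))"
  proof (rule sum.cong[OF refl])
    fix b
    let ?u = "\<sigma> (rt c b)"
    have u: "?u \<in> roots1 c" by (intro map rt_mem c)
    have "(\<Sum>a<c. ?s a * (if rt c a * ?u = 1 then of_nat c else 0)) =
        (\<Sum>z\<in>roots1 c. saw z * (if z * ?u = 1 then of_nat c else 0))"
      by (simp add: sum_rt[OF c])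
    also have "\<dots> = (\<Sum>z\<in>roots1 c. if z = inverse ?u then of_nat c * saw (inverse ?u) else 0)"
    proof (rule sum.cong[OF refl])
      fix z
      have "z * ?u = 1 \<longleftrightarrow> z = inverse ?u" using roots1_nz[OF c u] by (auto simp: field_simps)
      then show "saw z * (if z * ?u = 1 then of_nat c else 0) =
          (if z = inverse ?u then of_nat c * saw (inverse ?u) else 0)"
        by simp
    qed
    also have "\<dots> = of_nat c * - saw ?u"
      using finite_roots1[OF c] roots1_closed(2)[OF u]
      by (simp add: saw_inverse norm_roots1[OF c u])
    finally have *: "(\<Sum>a<c. ?s a * (if rt c a * ?u = 1 then of_nat c else 0)) = of_nat c * - saw ?u" .
    have "(\<Sum>a<c. ?s a * ?s b * (if rt c a * ?u = 1 then of_nat c else 0)) =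
        ?s b * (\<Sum>a<c. ?s a * (if rt c a * ?u = 1 then of_nat c else 0))"
      by (simp add: sum_distrib_left mult_ac)
    then show "(\<Sum>a<c. ?s a * ?s b * (if rt c a * ?u = 1 then of_nat c else 0)) =
        ?s b * (of_nat c * - saw ?u)"
      by (simp only: *)
  qed
  also have "\<dots> = - of_nat c * (\<Sum>z\<in>roots1 c. saw z * saw (\<sigma> z))"
    by (simp add: sum_rt[OF c] sum_distrib_left mult_ac sum_negf)
  finally show ?thesis .
qed

text \<open>If \<open>z ^ b = 1\<close>, both sides vanish because \<open>ell\<close> is odd.
  Otherwise \<open>1 / (1 - z * \<xi>)\<close> is a finite geometric sum over
  \<open>1 - z ^ b\<close>, and summation over \<open>\<xi>\<close> keeps only the exponent
  0.\<close>

lemma ell_distribution: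
  assumes b: "b > 0"
  shows "(\<Sum>\<xi>\<in>roots1 b. ell (z * \<xi>)) = of_nat b * ell (z ^ b)"
proof (cases "z ^ b = 1")
  case True
  then have z: "z \<in> roots1 b" by (simp add: roots1_def)
  have "(\<Sum>\<xi>\<in>roots1 b. ell \<xi>) = (\<Sum>\<xi>\<in>roots1 b. ell (inverse \<xi>))"
    by (rule sum_roots1_inverse[symmetric])
  also have "\<dots> = - (\<Sum>\<xi>\<in>roots1 b. ell \<xi>)"
    unfolding sum_negf[symmetric] using roots1_nz[OF b] by (intro sum.cong) (auto simp: ell_inverse)
  finally have "(\<Sum>\<xi>\<in>roots1 b. ell \<xi>) = 0" by simp
  moreover have "ell 1 = 0" by (simp add: ell_def)
  ultimately show ?thesis using sum_roots1_shift[OF b z, of ell] by (simp add: True)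
next
  case False
  have "ell (z * \<xi>) = (\<Sum>k<b. z ^ k * \<xi> ^ k) / (1 - z ^ b) - 1 / 2" if "\<xi> \<in> roots1 b" for \<xi>
  proof -
    have *: "(z * \<xi>) ^ b = z ^ b" using that by (simp add: power_mult_distrib roots1_def)
    then have ne: "z * \<xi> \<noteq> 1" using False by auto
    then have "(\<Sum>k<b. (z * \<xi>) ^ k) = (1 - z ^ b) / (1 - z * \<xi>)"
      using geometric_sum[of "z * \<xi>" b] * by (simp add: divide_simps) (simp add: algebra_simps)
    then have "(\<Sum>k<b. z ^ k * \<xi> ^ k) / (1 - z ^ b) = 1 / (1 - z * \<xi>)"
      using False by (simp add: power_mult_distrib)
    then show ?thesis using ne by (simp add: ell_def)
  qed
  then have "(\<Sum>\<xi>\<in>roots1 b. ell (z * \<xi>)) =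
      (\<Sum>\<xi>\<in>roots1 b. (\<Sum>k<b. z ^ k * \<xi> ^ k) / (1 - z ^ b) - 1 / 2)"
    by (intro sum.cong) auto
  also have "\<dots> = (\<Sum>k<b. z ^ k * (\<Sum>\<xi>\<in>roots1 b. \<xi> ^ k)) / (1 - z ^ b) - of_nat b / 2"
    by (simp add: sum_subtractf card_roots1[OF b] sum_distrib_left sum.swap[of _ "{..<b}"]
        flip: sum_divide_distrib)
  also have "(\<Sum>k<b. z ^ k * (\<Sum>\<xi>\<in>roots1 b. \<xi> ^ k)) = (\<Sum>k<b. if k = 0 then of_nat b else 0)"
  proof (rule sum.cong[OF refl])
    fix k assume k: "k \<in> {..<b}"
    have "(\<Sum>\<xi>\<in>roots1 b. \<xi> ^ k) = (\<Sum>j<b. rt b k ^ j)"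
      unfolding sum_rt[OF b] by (rule sum.cong) (metis power_mult mult.commute rt_power)+
    also have "\<dots> = (if rt b k = 1 then of_nat b else 0)"
      by (rule sum_powers_roots1[OF rt_mem[OF b]])
    also have "rt b k = 1 \<longleftrightarrow> k = 0" using k b cis_eq_1[of "real k / real b"] by (simp add: rt_def)
    finally show "z ^ k * (\<Sum>\<xi>\<in>roots1 b. \<xi> ^ k) = (if k = 0 then of_nat b else 0)" by auto
  qed
  finally show ?thesis using False b by (simp add: ell_def field_simps)
qed

text \<open>The replication formula of the sawtooth. Unlike the relation for \<open>ell\<close> it
  carries no factor \<open>b\<close>; this asymmetry is one source of the group orders in
  \<open>dedekind_reciprocity\<close>.\<close>

lemma saw_distribution:
  assumes b: "b > 0" and z: "norm z = 1"
  shows "(\<Sum>\<xi>\<in>roots1 b. saw (z * \<xi>)) = saw (z ^ b)"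
proof -
  define x where "x = Arg2pi z / (2 * pi)"
  have x: "0 \<le> x" "x < 1" using Arg2pi[of z] by (auto simp: x_def)
  have zx: "z = cis (2 * pi * x)"
    using Arg2pi_eq[of z] z by (simp add: x_def cis_conv_exp)
  \<comment> \<open>Removing the root of unity \<open>rt b k\<close> moves the angle of
    \<open>z\<close> into the interval from 0 to \<open>1 / b\<close>, so that all \<open>b\<close>
    translated angles stay below 1.\<close>
  define k where "k = nat \<lfloor>of_nat b * x\<rfloor>"
  have k: "real k \<le> b * x" "b * x < real k + 1"
    using x b unfolding k_def by (auto simp: of_nat_nat)
  define y where "y = x - real k / real b"
  have "real k / real b \<le> x" "x < (real k + 1) / real b" using k b by (auto simp: field_simps)
  then have y: "0 \<le> y" "y < 1 / real b" by (auto simp: y_def add_divide_distrib)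
  have zy: "z = cis (2 * pi * y) * rt b k"
    by (simp add: zx y_def rt_def cis_mult algebra_simps)
  have "(\<Sum>\<xi>\<in>roots1 b. saw (z * \<xi>)) = (\<Sum>\<xi>\<in>roots1 b. saw (cis (2 * pi * y) * \<xi>))"
    using sum_roots1_shift[OF b rt_mem[OF b, of k], of "\<lambda>\<xi>. saw (cis (2 * pi * y) * \<xi>)"]
    by (simp add: zy mult_ac)
  also have "\<dots> = (\<Sum>j<b. saw (cis (2 * pi * (y + real j / real b))))"
    by (simp add: sum_rt[OF b] rt_def cis_mult algebra_simps)
  \<comment> \<open>The last summand corrects for the angle 0, where \<open>saw\<close> is 0 and not
    \<open>- 1 / 2\<close>.\<close>
  also have "\<dots> = (\<Sum>j<b. (of_real y - 1 / 2) + of_nat j / of_nat b + (if j = 0 \<and> y = 0 then 1 / 2 else 0))"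
  proof (rule sum.cong[OF refl])
    fix j assume j: "j \<in> {..<b}"
    have "y + real j / real b < 1 / real b + real j / real b" using y by simp
    also have "\<dots> \<le> 1" using j b by (auto simp: field_simps)
    finally have "y + real j / real b < 1" .
    moreover have "y + real j / real b = 0 \<longleftrightarrow> y = 0 \<and> j = 0"
      using y b by (simp add: add_nonneg_eq_0_iff)
    ultimately show "saw (cis (2 * pi * (y + real j / real b))) =
        (of_real y - 1 / 2) + of_nat j / of_nat b + (if j = 0 \<and> y = 0 then 1 / 2 else 0)"
      using y by (subst saw_cis) auto
  qed
  also have "\<dots> = of_nat b * (of_real y - 1 / 2) + (\<Sum>j<b. of_nat j) / of_nat b + (if y = 0 then 1 / 2 else 0)"
    using b by (auto simp: sum.distrib sum_divide_distrib)
  also have "(\<Sum>j<b. of_nat j :: complex) = of_nat b * (of_nat b - 1) / 2"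
    by (induction b) (auto simp: field_simps)
  also have "of_nat b * (of_real y - 1 / 2) + of_nat b * (of_nat b - 1) / 2 / of_nat b + (if y = 0 then 1 / 2 else 0)
     = (if b * y = 0 then 0 else of_real (b * y - 1 / 2) :: complex)"
    using b by (auto simp: field_simps)
  also have "\<dots> = saw (cis (2 * pi * (b * y)))"
    using y b by (subst saw_cis) (auto simp: field_simps)
  also have "cis (2 * pi * (b * y)) = z ^ b"
    using rt_mem[OF b, of k] by (simp add: zy power_mult_distrib Complex.DeMoivre roots1_def mult_ac)
  finally show ?thesis .
qed

text \<open>The Dedekind sum \<open>s(1, c)\<close>. The summand \<open>a = 0\<close> of the sum of
  squares equals \<open>1 / 4\<close> and has to be taken out again, since
  \<open>saw 1 = 0\<close>.\<close>

lemma sum_saw_sq: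
  assumes "c > 0"
  shows "(\<Sum>z\<in>roots1 c. saw z * saw z) = (of_nat c - 1) * (of_nat c - 2) / (12 * of_nat c)"
proof -
  have "12 * (\<Sum>a<c. (of_nat a - x) * (of_nat a - x) :: complex) =
      2 * of_nat c * (of_nat c - 1) * (2 * of_nat c - 1) - 12 * x * of_nat c * (of_nat c - 1) + 12 * of_nat c * x * x" for x
    by (induction c) (auto simp: algebra_simps)
  from this[of "of_nat c / 2"]
  have *: "(\<Sum>a<c. (of_nat a - of_nat c / 2) * (of_nat a - of_nat c / 2) :: complex) =
     of_nat c * (of_nat c * of_nat c + 2) / 12"
    by (simp add: field_simps)
  have "(\<Sum>z\<in>roots1 c. saw z * saw z) = (\<Sum>a<c. (of_nat a - of_nat c / 2) * (of_nat a - of_nat c / 2) / (of_nat c)\<^sup>2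
      - (if a = 0 then 1 / 4 else 0))"
    unfolding sum_rt[OF assms] using assms
    by (intro sum.cong) (auto simp: saw_rt field_simps power2_eq_square)
  also have "\<dots> = (\<Sum>a<c. (of_nat a - of_nat c / 2) * (of_nat a - of_nat c / 2)) / (of_nat c)\<^sup>2 - 1 / 4"
    using assms by (simp add: sum_subtractf sum_divide_distrib)
  also have "\<dots> = (of_nat c - 1) * (of_nat c - 2) / (12 * of_nat c)"
    unfolding * using assms by (simp add: field_simps power2_eq_square)
  finally show ?thesis .
qed

text \<open>For \<open>z \<noteq> 1\<close> the summand is \<open>(ell z)^2 - 1 / 4\<close>, on the
  unit circle \<open>- 1 / (4 sin^2 (t / 2))\<close>. So the classical sum of squared cosecants is
  the case of the identity map in \<open>dedekind_reciprocity_hom\<close>.\<close>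

lemma sum_roots1_csc:
  assumes c: "c > 0"
  shows "(\<Sum>z\<in>roots1 c. if z = 1 then 0 else z / (1 - z)\<^sup>2) = - ((of_nat c)\<^sup>2 - 1) / 12"
proof -
  have "(\<Sum>z\<in>roots1 c. if z = 1 then 0 else z / (1 - z)\<^sup>2) =
      (\<Sum>z\<in>roots1 c. ell z * ell z - 1 / 4 + (if z = 1 then 1 / 4 else 0))"
  proof (rule sum.cong[OF refl])
    fix z :: complex
    have *: "(1 - u) / u\<^sup>2 = (1 / u - 1 / 2) * (1 / u - 1 / 2) - 1 / 4" if "u \<noteq> 0" for u :: complex
      using that by (simp add: field_simps power2_eq_square)
    show "(if z = 1 then 0 else z / (1 - z)\<^sup>2) = ell z * ell z - 1 / 4 + (if z = 1 then 1 / 4 else 0)"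
      using *[of "1 - z"] by (simp add: ell_def)
  qed
  also have "\<dots> = (\<Sum>z\<in>roots1 c. ell z * ell z) - of_nat c / 4 + 1 / 4"
    using finite_roots1[OF c] by (simp add: sum.distrib sum_subtractf card_roots1[OF c] roots1_closed)
  also have "(\<Sum>z\<in>roots1 c. ell z * ell z) = - of_nat c * (\<Sum>z\<in>roots1 c. saw z * saw z)"
    using dedekind_reciprocity_hom[OF c, of "\<lambda>z. z"] by simp
  also have "\<dots> - of_nat c / 4 + 1 / 4 = - ((of_nat c)\<^sup>2 - 1) / 12"
    unfolding sum_saw_sq[OF c] using c by (simp add: field_simps power2_eq_square)
  finally show ?thesis .
qed

text \<open>
  The factor of a variable of weight \<open>w\<close> in the sector of \<open>g\<close>, twisted by \<open>h\<close>, is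
  \<open>c (1 + l z + (l\<^sup>2 + q) z\<^sup>2 / 2) + o(z\<^sup>2)\<close> with \<open>c\<close>, \<open>l\<close>, \<open>q\<close> the following three values
  (lemma \<open>jet_cfactor\<close>).  This form makes \<open>l\<close> and \<open>q\<close> additive under products.
\<close>

definition lval :: "complex \<Rightarrow> complex \<Rightarrow> complex" where
  "lval g h = saw g + (if g = 1 then ell h else 0)"

definition qval :: "complex \<Rightarrow> complex \<Rightarrow> complex \<Rightarrow> complex" where
  "qval w g h = (if g \<noteq> 1 then 0
     else if h \<noteq> 1 then (2 * w - 1) * (h / (1 - h)\<^sup>2) else (1 - 2 * w) / 12)"

definition cval :: "complex \<Rightarrow> complex \<Rightarrow> complex \<Rightarrow> complex" where
  "cval w g h = (if g = 1 \<and> h = 1 then (1 - w) / w else - 1)"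

section \<open>Averages over a finite group of diagonal matrices, given by their diagonal
  entries\<close>

locale diag_group =
  fixes H :: "('n \<Rightarrow> complex) set"
  assumes fin: "finite H" and one: "(\<lambda>_. 1) \<in> H"
    and mult: "g \<in> H \<Longrightarrow> h \<in> H \<Longrightarrow> (\<lambda>i. g i * h i) \<in> H"
    and inv: "g \<in> H \<Longrightarrow> (\<lambda>i. inverse (g i)) \<in> H"
    and nz: "g \<in> H \<Longrightarrow> g i \<noteq> 0"
begin

lemma card_pos: "card H > 0"
  using fin one by (auto simp: card_gt_0_iff)

lemma sum_shift:
  assumes "k \<in> H"
  shows "(\<Sum>g\<in>H. F (\<lambda>i. k i * g i)) = (\<Sum>g\<in>H. F g)"
  using assms nz
  by (intro sum.reindex_bij_witness[of _ "\<lambda>g i. inverse (k i) * g i" "\<lambda>g i. k i * g i"])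
     (auto intro: mult inv simp flip: mult.assoc)

lemma sum_inverse: "(\<Sum>g\<in>H. F (\<lambda>i. inverse (g i))) = (\<Sum>g\<in>H. F g)"
  by (intro sum.reindex_bij_witness[of _ "\<lambda>g i. inverse (g i)" "\<lambda>g i. inverse (g i)"]) (auto intro: inv)

lemma power_closed: "g \<in> H \<Longrightarrow> (\<lambda>i. g i ^ k) \<in> H"
  by (induction k) (auto intro: one mult)

text \<open>Lets every statement of the locale be reused for the subgroup fixing the variables in
  \<open>S\<close>, as the reduction to cyclic groups and the expansion over subsets both
  do.\<close>

lemma stabilizer: "diag_group {h \<in> H. \<forall>i\<in>S. h i = 1}"
  by standard (auto simp: fin one mult inv nz)

definition im :: "'n \<Rightarrow> complex set" where
  "im i = (\<lambda>g. g i) ` H"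

lemma fin_im: "finite (im i)" and im_1: "1 \<in> im i"
  using fin one by (auto simp: im_def intro!: image_eqI[of _ _ "\<lambda>_. 1"])

lemma card_im_pos: "card (im i) > 0"
  using fin_im im_1 by (auto simp: card_gt_0_iff)

lemma im_shift:
  assumes "k \<in> H"
  shows "bij_betw (\<lambda>z. k i * z) (im i) (im i)"
proof (rule bij_betwI[of _ _ _ "\<lambda>z. inverse (k i) * z"])
  show "(*) (k i) \<in> im i \<rightarrow> im i"
    using mult[OF assms] by (auto simp: im_def intro!: image_eqI)
  show "(*) (inverse (k i)) \<in> im i \<rightarrow> im i"
    using mult[OF inv[OF assms]] by (auto simp: im_def intro!: image_eqI)
qed (use nz[OF assms] in auto)

text \<open>Multiplication by an element \<open>z\<close> permutes the finite set
  \<open>im i\<close>, hence preserves the product of its elements; so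
  \<open>z ^ card (im i) = 1\<close>, and the cardinalities agree.\<close>

lemma im_roots1: "im i = roots1 (card (im i))"
proof (rule card_subset_eq)
  show "finite (roots1 (card (im i)))" by (intro finite_roots1 card_im_pos)
  show "card (im i) = card (roots1 (card (im i)))" by (simp add: card_roots1 card_im_pos)
  show "im i \<subseteq> roots1 (card (im i))"
  proof
    fix z assume "z \<in> im i"
    then obtain k where k: "k \<in> H" "z = k i" by (auto simp: im_def)
    have "(\<Prod>u\<in>im i. u) = (\<Prod>u\<in>im i. z * u)"
      using prod.reindex_bij_betw[OF im_shift[OF k(1)], of "\<lambda>u. u" i] k by simp
    also have "\<dots> = z ^ card (im i) * (\<Prod>u\<in>im i. u)"
      by (simp add: prod.distrib)
    finally have "z ^ card (im i) = 1"
      using fin_im nz by (auto simp: im_def)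
    then show "z \<in> roots1 (card (im i))" by (simp add: roots1_def)
  qed
qed

lemma norm_eq_1: "g \<in> H \<Longrightarrow> norm (g i) = 1"
  by (rule norm_roots1[OF card_im_pos[of i]]) (subst im_roots1[symmetric], simp add: im_def)

text \<open>All fibres of \<open>g \<mapsto> g i\<close> have the same size; summing over all
  translates \<open>z * g i\<close> shows this without naming the fibres.\<close>

lemma sum_im:
  fixes F :: "complex \<Rightarrow> complex"
  shows "of_nat (card (im i)) * (\<Sum>g\<in>H. F (g i)) = of_nat (card H) * (\<Sum>z\<in>im i. F z)"
proof -
  have "(\<Sum>z\<in>im i. \<Sum>g\<in>H. F (z * g i)) = (\<Sum>z\<in>im i. \<Sum>g\<in>H. F (g i))"
  proof (rule sum.cong[OF refl])
    fix z assume "z \<in> im i"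
    then obtain k where "k \<in> H" "z = k i" by (auto simp: im_def)
    then show "(\<Sum>g\<in>H. F (z * g i)) = (\<Sum>g\<in>H. F (g i))"
      using sum_shift[of k "\<lambda>g. F (g i)"] by simp
  qed
  moreover have "(\<Sum>z\<in>im i. \<Sum>g\<in>H. F (z * g i)) = (\<Sum>g\<in>H. \<Sum>z\<in>im i. F z)"
    using sum.reindex_bij_betw[OF im_shift, of _ F i]
    by (subst sum.swap) (simp add: mult.commute)
  ultimately show ?thesis by simp
qed

lemma sum_im_roots1:
  fixes F :: "complex \<Rightarrow> complex"
  assumes "b = card (im i)"
  shows "of_nat b * (\<Sum>g\<in>H. F (g i)) = of_nat (card H) * (\<Sum>z\<in>roots1 b. F z)"
  using sum_im[of i F] im_roots1[of i] assms by simp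

text \<open>Lagrange's theorem, as \<open>sum_im\<close> for the indicator function of 1.\<close>

lemma card_im_stabilizer: "card (im i) * card {g \<in> H. g i = 1} = card H"
proof -
  have "(\<Sum>g\<in>H. if g i = 1 then 1 else 0) = (of_nat (card {g \<in> H. g i = 1}) :: complex)"
    using fin by (simp add: sum.If_cases Int_def)
  moreover have "(\<Sum>z\<in>im i. if z = 1 then 1 else 0) = (1 :: complex)"
    using fin_im im_1 by simp
  ultimately have "of_nat (card (im i) * card {g \<in> H. g i = 1}) = (of_nat (card H) :: complex)"
    using sum_im[of i "\<lambda>z. if z = 1 then 1 else 0"] by simp
  then show ?thesis unfolding of_nat_eq_iff .
qed

lemma sum_ell: "(\<Sum>g\<in>H. ell (g i)) = 0"
proof -
  have "(\<Sum>g\<in>H. ell (g i)) = (\<Sum>g\<in>H. ell (inverse (g i)))"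
    by (rule sum_inverse[symmetric])
  also have "\<dots> = - (\<Sum>g\<in>H. ell (g i))"
    unfolding sum_negf[symmetric] using nz by (intro sum.cong) (auto simp: ell_inverse)
  finally show ?thesis by simp
qed

text \<open>
  The distribution relations of \<open>saw\<close> and \<open>ell\<close> along the stabilizer of \<open>i\<close> replace the \<open>j\<close>-th entry by a
  power of it that depends only on the \<open>i\<close>-th entry.  This reduces the claim to a cyclic group.
\<close>

lemma dedekind_reciprocity:
  "of_nat (card {g \<in> H. g i = 1 \<and> g j = 1}) * (\<Sum>h\<in>H. ell (h i) * ell (h j)) =
    - (of_nat (card H) * (\<Sum>g\<in>H. saw (g i) * saw (g j)))"
proof -
  define N where "N = {g \<in> H. g i = 1}"
  interpret N: diag_group N
    using stabilizer[of "{i}"] by (simp add: N_def)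
  define b where "b = card (N.im j)"
  have b: "b > 0" by (simp add: b_def N.card_im_pos)
  have NH: "n \<in> H" "n i = 1" if "n \<in> N" for n using that by (auto simp: N_def)
  \<comment> \<open>Translation by \<open>n \<in> N\<close> leaves the \<open>i\<close>-th entry
    alone and multiplies the \<open>j\<close>-th by \<open>n j\<close>.\<close>
  have shiftN: "of_nat (card N) * (\<Sum>h\<in>H. F (h i) * E (h j)) = (\<Sum>h\<in>H. F (h i) * (\<Sum>n\<in>N. E (h j * n j)))"
    for F E :: "complex \<Rightarrow> complex"
  proof -
    have "of_nat (card N) * (\<Sum>h\<in>H. F (h i) * E (h j)) = (\<Sum>n\<in>N. \<Sum>h\<in>H. F (h i) * E (h j))" by simp
    also have "\<dots> = (\<Sum>n\<in>N. \<Sum>h\<in>H. F (h i) * E (h j * n j))"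
    proof (rule sum.cong[OF refl])
      fix n assume "n \<in> N"
      then show "(\<Sum>h\<in>H. F (h i) * E (h j)) = (\<Sum>h\<in>H. F (h i) * E (h j * n j))"
        using sum_shift[of n "\<lambda>h. F (h i) * E (h j)"] NH[of n] by (simp add: mult.commute)
    qed
    also have "\<dots> = (\<Sum>h\<in>H. F (h i) * (\<Sum>n\<in>N. E (h j * n j)))"
      by (subst sum.swap) (simp add: sum_distrib_left)
    finally show ?thesis .
  qed
  have ellN: "(\<Sum>n\<in>N. ell (z * n j)) = of_nat (card N) * ell (z ^ b)" for z
    using N.sum_im_roots1[OF b_def, of "\<lambda>u. ell (z * u)"] ell_distribution[OF b, of z] b by simp
  have sawN: "of_nat b * (\<Sum>n\<in>N. saw (z * n j)) = of_nat (card N) * saw (z ^ b)" if "norm z = 1" for z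
    using N.sum_im_roots1[OF b_def, of "\<lambda>u. saw (z * u)"] saw_distribution[OF b that] by simp
  have "of_nat (card N) * (\<Sum>h\<in>H. ell (h i) * ell (h j)) = of_nat (card N) * (\<Sum>h\<in>H. ell (h i) * ell (h j ^ b))"
    using shiftN[of ell ell] unfolding ellN by (simp add: sum_distrib_left mult.left_commute)
  then have A: "(\<Sum>h\<in>H. ell (h i) * ell (h j)) = (\<Sum>h\<in>H. ell (h i) * ell (h j ^ b))"
    using N.card_pos by simp
  have "of_nat (card N) * (of_nat b * (\<Sum>h\<in>H. saw (h i) * saw (h j))) =
      of_nat b * (of_nat (card N) * (\<Sum>h\<in>H. saw (h i) * saw (h j)))"
    by simp
  also have "\<dots> = (\<Sum>h\<in>H. saw (h i) * (of_nat b * (\<Sum>n\<in>N. saw (h j * n j))))"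
    unfolding shiftN by (simp add: sum_distrib_left mult.left_commute)
  also have "\<dots> = of_nat (card N) * (\<Sum>h\<in>H. saw (h i) * saw (h j ^ b))"
  proof -
    have "(\<Sum>h\<in>H. saw (h i) * (of_nat b * (\<Sum>n\<in>N. saw (h j * n j)))) =
        (\<Sum>h\<in>H. saw (h i) * (of_nat (card N) * saw (h j ^ b)))"
      by (intro sum.cong refl) (simp only: sawN norm_eq_1)
    then show ?thesis by (simp add: sum_distrib_left mult.left_commute)
  qed
  finally have B: "(\<Sum>h\<in>H. saw (h i) * saw (h j ^ b)) = of_nat b * (\<Sum>h\<in>H. saw (h i) * saw (h j))"
    using N.card_pos by simp
  define c where "c = card (im i)"
  have c: "c > 0" by (simp add: c_def card_im_pos)
  \<comment> \<open>Any element over \<open>z\<close> may be chosen: two of them differ by an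
    element of \<open>N\<close>, whose \<open>j\<close>-th entry is a \<open>b\<close>-th root of
    unity and is killed by the power \<open>b\<close>.\<close>
  define \<sigma> where "\<sigma> z = (SOME h. h \<in> H \<and> h i = z) j ^ b" for z
  have \<sigma>: "\<sigma> (h i) = h j ^ b" if "h \<in> H" for h
  proof -
    define k where "k = (SOME k. k \<in> H \<and> k i = h i)"
    have k: "k \<in> H" "k i = h i"
      using someI[of "\<lambda>k. k \<in> H \<and> k i = h i" h] that by (auto simp: k_def)
    have "(\<lambda>l. k l * inverse (h l)) \<in> N"
      using mult[OF k(1) inv[OF that]] k nz[OF that] by (simp add: N_def)
    then have "k j * inverse (h j) \<in> N.im j" by (auto simp: N.im_def)
    then have "(k j * inverse (h j)) ^ b = 1"
      using N.im_roots1[of j] unfolding b_def roots1_def by blast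
    then show ?thesis using nz[OF that] by (simp add: \<sigma>_def k_def power_mult_distrib field_simps)
  qed
  have roots: "roots1 c = im i" using im_roots1[of i] by (simp add: c_def)
  have recip: "(\<Sum>z\<in>roots1 c. ell z * ell (\<sigma> z)) = - of_nat c * (\<Sum>z\<in>roots1 c. saw z * saw (\<sigma> z))"
  proof (rule dedekind_reciprocity_hom[OF c])
    fix z u assume "z \<in> roots1 c" "u \<in> roots1 c"
    then obtain h k where hk: "h \<in> H" "k \<in> H" "z = h i" "u = k i" unfolding roots im_def by auto
    then show "\<sigma> (z * u) = \<sigma> z * \<sigma> u"
      using \<sigma>[OF mult[OF hk(1,2)]] by (simp add: \<sigma> power_mult_distrib)
  next
    fix z assume "z \<in> roots1 c"
    then obtain h where h: "h \<in> H" "z = h i" "z ^ c = 1" unfolding roots im_def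
      using \<open>z \<in> roots1 c\<close> by (auto simp: roots1_def)
    have "(h j ^ b) ^ c = (h j ^ c) ^ b" by (simp flip: power_mult add: mult.commute)
    also have "\<dots> = \<sigma> (h i ^ c)" using \<sigma>[OF power_closed[OF h(1), of c]] by simp
    also have "\<dots> = 1" using h \<sigma>[OF one] by simp
    finally show "\<sigma> z \<in> roots1 c" using h by (simp add: \<sigma> roots1_def)
  qed
  have "of_nat c * (\<Sum>h\<in>H. ell (h i) * ell (h j)) = of_nat (card H) * (\<Sum>z\<in>roots1 c. ell z * ell (\<sigma> z))"
    unfolding A using sum_im_roots1[OF c_def, of "\<lambda>z. ell z * ell (\<sigma> z)"] by (simp add: \<sigma>)
  also have "\<dots> = - of_nat c * (of_nat c * (\<Sum>h\<in>H. saw (h i) * saw (h j ^ b)))"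
    unfolding recip using sum_im_roots1[OF c_def, of "\<lambda>z. saw z * saw (\<sigma> z)"] by (simp add: \<sigma>)
  finally have C: "(\<Sum>h\<in>H. ell (h i) * ell (h j)) = - of_nat c * of_nat b * (\<Sum>h\<in>H. saw (h i) * saw (h j))"
  proof -
    assume *: "of_nat c * (\<Sum>h\<in>H. ell (h i) * ell (h j)) =
        - of_nat c * (of_nat c * (\<Sum>h\<in>H. saw (h i) * saw (h j ^ b)))"
    have "of_nat c * (\<Sum>h\<in>H. ell (h i) * ell (h j)) =
        of_nat c * (- of_nat c * of_nat b * (\<Sum>h\<in>H. saw (h i) * saw (h j)))"
      unfolding * B by simp
    then show ?thesis using c by (simp only: mult_cancel_left) simp
  qed
  \<comment> \<open>The order of \<open>H\<close> splits as \<open>c * b\<close> times the order of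
    the common stabilizer, which accounts for the factor \<open>c * b\<close> in
    \<open>C\<close>.\<close>
  have "card H = c * card N" using card_im_stabilizer[of i] by (simp add: c_def N_def)
  moreover have "card N = b * card {g \<in> H. g i = 1 \<and> g j = 1}"
    using N.card_im_stabilizer[of j] by (simp add: b_def N_def conj_assoc)
  ultimately show ?thesis unfolding C by (simp add: mult_ac)
qed

text \<open>In the product of the two \<open>lval\<close> the mixed terms vanish under the sum over
  \<open>h\<close> by \<open>sum_ell\<close>; the sawtooth and cotangent parts cancel by
  \<open>dedekind_reciprocity\<close>.\<close>

lemma sum_lval_lval: "(\<Sum>g\<in>H. \<Sum>h\<in>H. lval (g i) (h i) * lval (g j) (h j)) = 0"
proof -
  have "(\<Sum>h\<in>H. lval (g i) (h i) * lval (g j) (h j)) = of_nat (card H) * (saw (g i) * saw (g j)) +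
      (if g i = 1 \<and> g j = 1 then \<Sum>h\<in>H. ell (h i) * ell (h j) else 0)" for g
    by (cases "g i = 1"; cases "g j = 1")
       (simp_all add: lval_def saw_def sum_ell flip: sum_distrib_left sum_distrib_right)
  then have "(\<Sum>g\<in>H. \<Sum>h\<in>H. lval (g i) (h i) * lval (g j) (h j)) =
     of_nat (card H) * (\<Sum>g\<in>H. saw (g i) * saw (g j)) +
     of_nat (card {g \<in> H. g i = 1 \<and> g j = 1}) * (\<Sum>h\<in>H. ell (h i) * ell (h j))"
    using fin by (simp add: sum.distrib sum_distrib_left sum.If_cases Int_def)
  then show ?thesis unfolding dedekind_reciprocity by simp
qed

text \<open>Over the \<open>b\<close>-th roots of unity the entries different from 1 give
  \<open>(1 - 2 * w i) * (b^2 - 1) / 12\<close>, and the entry 1 supplies exactly the missing unit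
  of \<open>b^2\<close>. One factor \<open>b\<close> is absorbed by the average over
  \<open>h\<close>, the other by the proportion of \<open>g\<close> with
  \<open>g i = 1\<close>.\<close>

lemma sum_qval: "(\<Sum>g\<in>H. \<Sum>h\<in>H. qval (w i) (g i) (h i)) = (of_nat (card H))\<^sup>2 * (1 - 2 * w i) / 12"
proof -
  define b where "b = card (im i)"
  have b: "b > 0" by (simp add: b_def card_im_pos)
  define E where "E z = (if z \<noteq> 1 then (2 * w i - 1) * (z / (1 - z)\<^sup>2) else (1 - 2 * w i) / 12)" for z
  have "(\<Sum>z\<in>roots1 b. E z) = (\<Sum>z\<in>roots1 b. (2 * w i - 1) * (if z = 1 then 0 else z / (1 - z)\<^sup>2) +
      (if z = 1 then (1 - 2 * w i) / 12 else 0))"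
    by (rule sum.cong) (auto simp: E_def)
  also have "\<dots> = (2 * w i - 1) * (- ((of_nat b)\<^sup>2 - 1) / 12) + (1 - 2 * w i) / 12"
    unfolding sum.distrib sum_distrib_left[symmetric] sum_roots1_csc[OF b]
    using finite_roots1[OF b] by (simp add: roots1_closed)
  also have "\<dots> = (1 - 2 * w i) * (of_nat b)\<^sup>2 / 12"
    by (simp add: field_simps)
  finally have "of_nat b * (\<Sum>h\<in>H. E (h i)) = of_nat (card H) * ((1 - 2 * w i) * (of_nat b)\<^sup>2 / 12)"
    using sum_im_roots1[OF b_def, of E] by simp
  then have *: "(\<Sum>h\<in>H. E (h i)) = of_nat (card H) * of_nat b * (1 - 2 * w i) / 12"
    using b by (simp add: power2_eq_square)
  have "(\<Sum>g\<in>H. \<Sum>h\<in>H. qval (w i) (g i) (h i)) = (\<Sum>g\<in>H. if g i = 1 then \<Sum>h\<in>H. E (h i) else 0)"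
    by (intro sum.cong) (auto simp: qval_def E_def)
  also have "\<dots> = of_nat (card {g \<in> H. g i = 1}) * (\<Sum>h\<in>H. E (h i))"
    using fin by (simp add: sum.If_cases Int_def)
  also have "\<dots> = of_nat (card H) * (of_nat (card (im i) * card {g \<in> H. g i = 1})) * (1 - 2 * w i) / 12"
    unfolding * b_def by simp
  finally show ?thesis unfolding card_im_stabilizer by (simp add: power2_eq_square)
qed

lemma sum_lval_qval:
  fixes w :: "'n \<Rightarrow> complex"
  assumes "finite A"
  shows "(\<Sum>g\<in>H. \<Sum>h\<in>H. (\<Sum>i\<in>A. lval (g i) (h i))\<^sup>2 + (\<Sum>i\<in>A. qval (w i) (g i) (h i))) =
    (of_nat (card H))\<^sup>2 * ((\<Sum>i\<in>A. 1 - 2 * w i) / 12)"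
proof -
  have "(\<Sum>g\<in>H. \<Sum>h\<in>H. (\<Sum>i\<in>A. lval (g i) (h i))\<^sup>2) =
      (\<Sum>i\<in>A. \<Sum>j\<in>A. \<Sum>g\<in>H. \<Sum>h\<in>H. lval (g i) (h i) * lval (g j) (h j))"
    unfolding power2_eq_square sum_product
    by (simp only: sum.swap[of _ A H])
  then have "(\<Sum>g\<in>H. \<Sum>h\<in>H. (\<Sum>i\<in>A. lval (g i) (h i))\<^sup>2) = 0" by (simp add: sum_lval_lval)
  moreover have "(\<Sum>g\<in>H. \<Sum>h\<in>H. \<Sum>i\<in>A. qval (w i) (g i) (h i)) =
      (\<Sum>i\<in>A. \<Sum>g\<in>H. \<Sum>h\<in>H. qval (w i) (g i) (h i))"
    by (simp only: sum.swap[of _ A H])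
  ultimately show ?thesis
    by (simp add: sum.distrib sum_qval sum_distrib_left sum_divide_distrib)
qed

text \<open>
  Since \<open>cval w g h\<close> is \<open>- 1\<close> plus \<open>1 / w\<close> times the indicator of \<open>g = h = 1\<close>, the product expands into a
  sum over subsets \<open>S\<close> of \<open>A\<close> supported on the stabilizer of \<open>S\<close>, where \<open>sum_lval_qval\<close> gives the same
  average for all \<open>S\<close>.
\<close>

lemma sum_cval:
  fixes w :: "'n \<Rightarrow> complex"
  assumes A: "finite A" and w: "\<And>i. i \<in> A \<Longrightarrow> w i \<noteq> 0"
  shows "(\<Sum>g\<in>H. \<Sum>h\<in>H. (\<Prod>i\<in>A. cval (w i) (g i) (h i)) *
      ((\<Sum>i\<in>A. lval (g i) (h i))\<^sup>2 + (\<Sum>i\<in>A. qval (w i) (g i) (h i)))) =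
    (\<Sum>i\<in>A. 1 - 2 * w i) / 12 * (\<Sum>g\<in>H. \<Sum>h\<in>H. \<Prod>i\<in>A. cval (w i) (g i) (h i))"
proof -
  define st where "st S = {g \<in> H. \<forall>i\<in>S. g i = 1}" for S
  define K where "K S = (\<Prod>i\<in>S. 1 / w i) * (- 1) ^ card (A - S)" for S
  have cv: "(\<Prod>i\<in>A. cval (w i) (g i) (h i)) = (\<Sum>S\<in>Pow A. if g \<in> st S \<and> h \<in> st S then K S else 0)"
    if gh: "g \<in> H" "h \<in> H" for g h
  proof -
    have "(\<Prod>i\<in>A. cval (w i) (g i) (h i)) = (\<Prod>i\<in>A. (if g i = 1 \<and> h i = 1 then 1 / w i else 0) + (- 1))"
      using w by (intro prod.cong) (auto simp: cval_def diff_divide_distrib)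
    also have "\<dots> = (\<Sum>S\<in>Pow A. (\<Prod>i\<in>S. if g i = 1 \<and> h i = 1 then 1 / w i else 0) * (\<Prod>i\<in>A - S. - 1))"
      by (rule prod_add[OF A])
    also have "\<dots> = (\<Sum>S\<in>Pow A. if g \<in> st S \<and> h \<in> st S then K S else 0)"
    proof (rule sum.cong[OF refl])
      fix S assume "S \<in> Pow A"
      then have "finite S" using A finite_subset by auto
      then show "(\<Prod>i\<in>S. if g i = 1 \<and> h i = 1 then 1 / w i else 0) * (\<Prod>i\<in>A - S. - 1) =
          (if g \<in> st S \<and> h \<in> st S then K S else 0)"
        using gh by (auto simp: st_def K_def)
    qed
    finally show ?thesis .
  qed
  \<comment> \<open>Kept general in \<open>Q\<close>: it is used for the quadratic expression and
    for the constant 1.\<close>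
  have main: "(\<Sum>g\<in>H. \<Sum>h\<in>H. (\<Prod>i\<in>A. cval (w i) (g i) (h i)) * Q g h) =
      (\<Sum>S\<in>Pow A. K S * (\<Sum>g\<in>st S. \<Sum>h\<in>st S. Q g h))" for Q
  proof -
    have "(\<Sum>g\<in>H. \<Sum>h\<in>H. (\<Prod>i\<in>A. cval (w i) (g i) (h i)) * Q g h) =
        (\<Sum>g\<in>H. \<Sum>h\<in>H. \<Sum>S\<in>Pow A. if g \<in> st S \<and> h \<in> st S then K S * Q g h else 0)"
      by (intro sum.cong refl) (auto simp: cv sum_distrib_right intro!: sum.cong)
    also have "\<dots> = (\<Sum>S\<in>Pow A. \<Sum>g\<in>H. \<Sum>h\<in>H. if g \<in> st S \<and> h \<in> st S then K S * Q g h else 0)"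
      by (simp only: sum.swap[of _ "Pow A" H])
    also have "\<dots> = (\<Sum>S\<in>Pow A. K S * (\<Sum>g\<in>st S. \<Sum>h\<in>st S. Q g h))"
    proof (rule sum.cong[OF refl])
      fix S
      have st: "st S \<subseteq> H" by (auto simp: st_def)
      have "(\<Sum>g\<in>H. \<Sum>h\<in>H. if g \<in> st S \<and> h \<in> st S then K S * Q g h else 0) =
          (\<Sum>g\<in>H. if g \<in> st S then \<Sum>h\<in>H. if h \<in> st S then K S * Q g h else 0 else 0)"
        by (intro sum.cong refl) auto
      also have "\<dots> = (\<Sum>g\<in>st S. \<Sum>h\<in>st S. K S * Q g h)"
        using fin st by (simp add: sum.inter_restrict[symmetric] Int_absorb1)
      finally show "(\<Sum>g\<in>H. \<Sum>h\<in>H. if g \<in> st S \<and> h \<in> st S then K S * Q g h else 0) =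
          K S * (\<Sum>g\<in>st S. \<Sum>h\<in>st S. Q g h)"
        by (simp add: sum_distrib_left)
    qed
    finally show ?thesis .
  qed
  have "(\<Sum>g\<in>st S. \<Sum>h\<in>st S. (\<Sum>i\<in>A. lval (g i) (h i))\<^sup>2 + (\<Sum>i\<in>A. qval (w i) (g i) (h i))) =
      (\<Sum>i\<in>A. 1 - 2 * w i) / 12 * (\<Sum>g\<in>st S. \<Sum>h\<in>st S. 1)" for S
  proof -
    interpret S: diag_group "st S" unfolding st_def by (rule stabilizer)
    show ?thesis using S.sum_lval_qval[OF A, of w] by (simp add: power2_eq_square)
  qed
  moreover define c where "c = (\<Sum>i\<in>A. 1 - 2 * w i) / 12"
  ultimately have eqS: "(\<Sum>S\<in>Pow A. K S * (\<Sum>g\<in>st S. \<Sum>h\<in>st S. (\<Sum>i\<in>A. lval (g i) (h i))\<^sup>2 + (\<Sum>i\<in>A. qval (w i) (g i) (h i)))) =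
      (\<Sum>S\<in>Pow A. K S * (c * (\<Sum>g\<in>st S. \<Sum>h\<in>st S. 1)))"
    by (simp only:)
  have "(\<Sum>g\<in>H. \<Sum>h\<in>H. (\<Prod>i\<in>A. cval (w i) (g i) (h i)) *
      ((\<Sum>i\<in>A. lval (g i) (h i))\<^sup>2 + (\<Sum>i\<in>A. qval (w i) (g i) (h i)))) =
      (\<Sum>S\<in>Pow A. K S * (c * (\<Sum>g\<in>st S. \<Sum>h\<in>st S. 1)))"
    unfolding main by (rule eqS)
  also have "\<dots> = c * (\<Sum>S\<in>Pow A. K S * (\<Sum>g\<in>st S. \<Sum>h\<in>st S. 1))"
    by (simp add: sum_distrib_left mult.left_commute)
  also have "\<dots> = c * (\<Sum>g\<in>H. \<Sum>h\<in>H. (\<Prod>i\<in>A. cval (w i) (g i) (h i)) * 1)"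
    by (simp only: main)
  finally show ?thesis by (simp add: c_def)
qed

end

section \<open>Polynomials\<close>

abbreviation lk :: "('a \<Rightarrow>\<^sub>0 'b::zero) \<Rightarrow> 'a \<Rightarrow> 'b" where
  "lk \<equiv> Poly_Mapping.lookup"

lemma finite_bounded_monomials: "finite {k :: 'n::finite monomial. \<forall>i. lk k i \<le> b i}"
proof (rule finite_imageD)
  have "lk ` {k :: 'n monomial. \<forall>i. lk k i \<le> b i} \<subseteq> (\<Pi>\<^sub>E i\<in>UNIV. {..b i})" by auto
  then show "finite (lk ` {k :: 'n monomial. \<forall>i. lk k i \<le> b i})"
    by (rule finite_subset) (intro finite_PiE; simp)
qed (auto intro: inj_onI poly_mapping_eqI)

lemma finite_decompositions: "finite {(k, l). k + l = (m :: 'n::finite monomial)}"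
proof (rule finite_subset)
  let ?K = "{k :: 'n monomial. \<forall>i. lk k i \<le> lk m i}"
  show "{(k, l). k + l = m} \<subseteq> ?K \<times> ?K" by (auto simp: lookup_add)
qed (intro finite_SigmaI finite_bounded_monomials)

lemma lookup_times:
  fixes p q :: "'n::finite cpoly"
  shows "lk (p * q) m = (\<Sum>(k, l) | k + l = m. lk p k * lk q l)"
proof -
  have "lk (p * q) m = (\<Sum>(k, l). lk p k * lk q l when m = k + l)"
    unfolding times_poly_mapping.rep_eq by (rule prod_fun_unfold_prod) simp_all
  also have "\<dots> = (\<Sum>(k, l) | k + l = m. lk p k * lk q l when m = k + l)"
    by (rule Sum_any.expand_superset[OF finite_decompositions]) (auto simp: when_def split: if_splits)
  also have "\<dots> = (\<Sum>(k, l) | k + l = m. lk p k * lk q l)"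
    by (rule sum.cong) auto
  finally show ?thesis .
qed

lemma lookup_single_times:
  fixes p :: "'n::finite cpoly"
  shows "lk (Poly_Mapping.single s c * p) (s + m) = c * lk p m"
proof -
  have "lk (Poly_Mapping.single s c * p) (s + m) =
      (\<Sum>x\<in>{(k, l). k + l = s + m}. if x = (s, m) then c * lk p m else 0)"
    unfolding lookup_times by (rule sum.cong) (auto simp: lookup_single when_def split: if_splits)
  also have "\<dots> = c * lk p m"
    using finite_decompositions[of "s + m"] by (subst sum.delta) auto
  finally show ?thesis .
qed

lemma keys_times: "m \<in> Poly_Mapping.keys (p * q) \<Longrightarrow>
    \<exists>k\<in>Poly_Mapping.keys p. \<exists>l\<in>Poly_Mapping.keys q. m = k + l"
  using keys_mult[of p q] by blast

lemma lookup_const_times: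
  fixes p :: "'n::finite cpoly"
  shows "lk (Poly_Mapping.single 0 c * p) m = c * lk p m"
  using lookup_single_times[of 0 c p m] by simp

lemma poly_sum_monomials:
  fixes p :: "'n::finite cpoly"
  shows "p = (\<Sum>k\<in>Poly_Mapping.keys p. Poly_Mapping.single k (lk p k))"
  by (rule poly_mapping_eqI)
     (simp add: lookup_sum lookup_single when_def in_keys_iff)

lemma poly_induct [case_names single add]:
  fixes p :: "'n::finite cpoly"
  assumes "\<And>k c. k \<in> Poly_Mapping.keys p \<Longrightarrow> P (Poly_Mapping.single k c)"
    and "\<And>p q. P p \<Longrightarrow> P q \<Longrightarrow> P (p + q)" and "P 0"
  shows "P p"
proof -
  have "P (\<Sum>k\<in>A. Poly_Mapping.single k (lk p k))" if "finite A" "A \<subseteq> Poly_Mapping.keys p" for A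
    using that by (induction A rule: finite_induct) (auto intro: assms)
  from this[of "Poly_Mapping.keys p"] show ?thesis
    using poly_sum_monomials[of p] by simp
qed

section \<open>Evaluation of polynomials and projections onto sets of monomials\<close>

definition mon_val :: "('n::finite \<Rightarrow> complex) \<Rightarrow> 'n monomial \<Rightarrow> complex" where
  "mon_val x k = (\<Prod>i\<in>UNIV. x i ^ lk k i)"

definition ev :: "('n::finite \<Rightarrow> complex) \<Rightarrow> 'n cpoly \<Rightarrow> complex" where
  "ev x p = (\<Sum>k\<in>Poly_Mapping.keys p. lk p k * mon_val x k)"

lemma mon_val_add: "mon_val x (k + l) = mon_val x k * mon_val x l"
  by (simp add: mon_val_def lookup_add power_add prod.distrib)

lemma mon_val_0 [simp]: "mon_val x 0 = 1"
  by (simp add: mon_val_def)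

lemma mon_val_single: "mon_val x (Poly_Mapping.single i n) = x i ^ n"
proof -
  have "mon_val x (Poly_Mapping.single i n) = (\<Prod>j\<in>UNIV. if j = i then x i ^ n else 1)"
    unfolding mon_val_def by (rule prod.cong) (auto simp: lookup_single when_def split: if_splits)
  then show ?thesis by simp
qed

lemma ev_superset: "finite A \<Longrightarrow> Poly_Mapping.keys p \<subseteq> A \<Longrightarrow> ev x p = (\<Sum>k\<in>A. lk p k * mon_val x k)"
  unfolding ev_def by (rule sum.mono_neutral_left) (auto simp: in_keys_iff)

lemma ev_add: "ev x (p + q) = ev x p + ev x q"
proof -
  let ?A = "Poly_Mapping.keys p \<union> Poly_Mapping.keys q"
  have "ev x (p + q) = (\<Sum>k\<in>?A. lk (p + q) k * mon_val x k)"
    using keys_add[of p q] by (intro ev_superset) auto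
  also have "\<dots> = (\<Sum>k\<in>?A. lk p k * mon_val x k) + (\<Sum>k\<in>?A. lk q k * mon_val x k)"
    by (simp add: lookup_add distrib_right sum.distrib)
  also have "\<dots> = ev x p + ev x q"
    by (subst (1 2) ev_superset[symmetric]) auto
  finally show ?thesis .
qed

lemma ev_0 [simp]: "ev x 0 = 0"
  by (simp add: ev_def)

lemma ev_single: "ev x (Poly_Mapping.single k c) = c * mon_val x k"
  by (simp add: ev_def)

lemma ev_1 [simp]: "ev x 1 = 1"
  using ev_single[of x 0 1] by simp

lemma ev_times: "ev x (p * q) = ev x p * ev x q"
proof (induction p rule: poly_induct)
  case (single k c)
  show ?case
  proof (induction q rule: poly_induct)
    case (single l d)
    then show ?case by (simp add: mult_single ev_single mon_val_add)
  qed (auto simp: distrib_left ev_add)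
qed (auto simp: distrib_right ev_add)

lemma ev_uminus: "ev x (- p) = - ev x p"
  using ev_add[of x p "- p"] by (simp add: eq_neg_iff_add_eq_0 add.commute)

lemma ev_diff: "ev x (p - q) = ev x p - ev x q"
  using ev_add[of x p "- q"] by (simp add: ev_uminus)

lemma eval_series_lookup: "eval_series (lk p) x = ev (($) x) p"
  unfolding eval_series_def ev_def mon_val_def
  by (rule Sum_any.expand_superset) (auto simp: in_keys_iff)

text \<open>A condition \<open>P\<close> on weight and character gives a graded component; the
  condition that only variables in \<open>I\<close> occur sets all other variables to zero.\<close>

definition pfilter :: "('n monomial \<Rightarrow> bool) \<Rightarrow> 'n cpoly \<Rightarrow> 'n cpoly" where
  "pfilter P p = Abs_poly_mapping (\<lambda>m. if P m then lk p m else 0)"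

lemma lookup_pfilter: "lk (pfilter P p) m = (if P m then lk p m else 0)"
proof -
  have "finite {m. (if P m then lk p m else 0) \<noteq> 0}"
    by (rule finite_subset[OF _ finite_keys[of p]]) (auto simp: in_keys_iff)
  then show ?thesis unfolding pfilter_def by (simp add: Abs_poly_mapping_inverse)
qed

lemma pfilter_add: "pfilter P (p + q) = pfilter P p + pfilter P q"
  by (rule poly_mapping_eqI) (simp add: lookup_pfilter lookup_add)

lemma pfilter_sum: "pfilter P (\<Sum>i\<in>A. p i) = (\<Sum>i\<in>A. pfilter P (p i))"
  by (rule poly_mapping_eqI) (simp add: lookup_pfilter lookup_sum)

text \<open>A factor that is homogeneous for the grading behind \<open>P\<close> and
  \<open>Q\<close> only shifts degrees, so taking components commutes with multiplication by
  it.\<close>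

lemma pfilter_times:
  fixes p q :: "'n::finite cpoly"
  assumes "\<And>k l. k \<in> Poly_Mapping.keys p \<Longrightarrow> P (k + l) \<longleftrightarrow> Q l"
  shows "pfilter P (p * q) = p * pfilter Q q"
proof (rule poly_mapping_eqI)
  fix m
  have "(\<Sum>(k, l) | k + l = m. lk p k * lk (pfilter Q q) l) =
      (\<Sum>(k, l) | k + l = m. if P m then lk p k * lk q l else 0)"
  proof (rule sum.cong[OF refl], clarify)
    fix k l assume "m = k + l"
    then show "lk p k * lk (pfilter Q q) l = (if P (k + l) then lk p k * lk q l else 0)"
      using assms[of k l] by (cases "lk p k = 0") (auto simp: lookup_pfilter in_keys_iff)
  qed
  then show "lk (pfilter P (p * q)) m = lk (p * pfilter Q q) m"
    by (auto simp: lookup_pfilter lookup_times)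
qed

text \<open>Meant for setting variables to zero, which is a ring homomorphism.\<close>

lemma pfilter_hom:
  fixes p q :: "'n::finite cpoly"
  assumes "\<And>k l. P (k + l) \<longleftrightarrow> P k \<and> P l"
  shows "pfilter P (p * q) = pfilter P p * pfilter P q"
proof (rule poly_mapping_eqI)
  fix m
  have "(\<Sum>(k, l) | k + l = m. lk (pfilter P p) k * lk (pfilter P q) l) =
      (\<Sum>(k, l) | k + l = m. if P m then lk p k * lk q l else 0)"
    using assms by (intro sum.cong) (auto simp: lookup_pfilter)
  then show "lk (pfilter P (p * q)) m = lk (pfilter P p * pfilter P q) m"
    by (auto simp: lookup_pfilter lookup_times)
qed

lemma keys_pfilter: "Poly_Mapping.keys (pfilter P p) = {m \<in> Poly_Mapping.keys p. P m}"
  by (auto simp: in_keys_iff lookup_pfilter split: if_splits)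

lemma pfilter_id: "(\<And>m. m \<in> Poly_Mapping.keys p \<Longrightarrow> P m) \<Longrightarrow> pfilter P p = p"
  by (rule poly_mapping_eqI) (auto simp: lookup_pfilter in_keys_iff)

lemma keys_add_monomial: "Poly_Mapping.keys (k + l) = Poly_Mapping.keys k \<union> Poly_Mapping.keys (l :: 'n monomial)"
  by (auto simp: in_keys_iff lookup_add)

definition X :: "'n \<Rightarrow> 'n cpoly" where
  "X i = Poly_Mapping.single (Poly_Mapping.single i 1) 1"

lemma X_power: "X i ^ n = Poly_Mapping.single (Poly_Mapping.single i n) 1"
  by (induction n) (auto simp: X_def mult_single single_add[symmetric] simp flip: single_one)

lemma ev_X: "ev x (X i) = x i"
  by (simp add: X_def ev_single mon_val_single)

section \<open>A graded Nullstellensatz\<close>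

text \<open>Gaussian elimination by induction on the equations: if some \<open>a c0 b\<close> is
  nonzero, equation \<open>b\<close> is solved for the unknown \<open>c0\<close>, which is
  eliminated from the others.\<close>

lemma homogeneous_system:
  fixes a :: "'a \<Rightarrow> 'b \<Rightarrow> complex"
  assumes "finite B" "finite T" "card B < card T"
  shows "\<exists>l. (\<exists>c\<in>T. l c \<noteq> 0) \<and> (\<forall>b\<in>B. (\<Sum>c\<in>T. l c * a c b) = 0)"
  using assms
proof (induction B arbitrary: T a rule: finite_induct)
  case empty
  then have "T \<noteq> {}" by auto
  then show ?case by (intro exI[of _ "\<lambda>_. 1"]) auto
next
  case (insert b B)
  show ?case
  proof (cases "\<forall>c\<in>T. a c b = 0")
    case True
    have "card B < card T" using insert by simp
    from insert.IH[OF insert.prems(1) this, of a] True show ?thesis by auto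
  next
    case False
    then obtain c0 where c0: "c0 \<in> T" "a c0 b \<noteq> 0" by auto
    let ?T = "T - {c0}"
    have "card B < card ?T" "finite ?T" using insert c0 by auto
    from insert.IH[OF this(2,1), of "\<lambda>c x. a c x - a c b / a c0 b * a c0 x"]
    obtain l c1 where l: "c1 \<in> ?T" "l c1 \<noteq> 0"
      "\<And>x. x \<in> B \<Longrightarrow> (\<Sum>c\<in>?T. l c * (a c x - a c b / a c0 b * a c0 x)) = 0" by blast
    define m where "m = l(c0 := - (\<Sum>c\<in>?T. l c * a c b) / a c0 b)"
    have m: "(\<Sum>c\<in>T. m c * a c x) = (\<Sum>c\<in>?T. l c * (a c x - a c b / a c0 b * a c0 x))" for x
    proof -
      have "(\<Sum>c\<in>T. m c * a c x) = m c0 * a c0 x + (\<Sum>c\<in>?T. m c * a c x)"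
        using insert c0 by (subst sum.remove) auto
      also have "(\<Sum>c\<in>?T. m c * a c x) = (\<Sum>c\<in>?T. l c * a c x)"
        by (rule sum.cong) (auto simp: m_def)
      also have "m c0 * a c0 x = - (\<Sum>c\<in>?T. l c * (a c b / a c0 b * a c0 x))"
        by (simp add: m_def divide_inverse sum_distrib_left sum_distrib_right mult_ac)
      finally show ?thesis by (simp add: right_diff_distrib sum_subtractf)
    qed
    have "(\<Sum>c\<in>T. m c * a c b) = 0" unfolding m using c0 by simp
    moreover have "(\<Sum>c\<in>T. m c * a c x) = 0" if "x \<in> B" for x
      unfolding m by (rule l(3)[OF that])
    moreover have "m c1 \<noteq> 0" "c1 \<in> T" using l by (auto simp: m_def)
    ultimately show ?thesis by blast
  qed
qed

section \<open>Ideals and the weak Nullstellensatz\<close>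

definition is_ideal :: "'r::comm_ring_1 set \<Rightarrow> bool" where
  "is_ideal J \<longleftrightarrow> 0 \<in> J \<and> (\<forall>p\<in>J. \<forall>q\<in>J. p + q \<in> J) \<and> (\<forall>p\<in>J. \<forall>r. r * p \<in> J)"

lemma is_idealD:
  assumes "is_ideal J"
  shows "0 \<in> J" "p \<in> J \<Longrightarrow> q \<in> J \<Longrightarrow> p + q \<in> J" "p \<in> J \<Longrightarrow> r * p \<in> J"
  using assms by (auto simp: is_ideal_def)

lemma is_ideal_diff: "is_ideal J \<Longrightarrow> p \<in> J \<Longrightarrow> q \<in> J \<Longrightarrow> p - q \<in> J"
  using is_idealD(2)[of J p "- q"] is_idealD(3)[of J q "-1"] by simp

lemma is_ideal_sum: "is_ideal J \<Longrightarrow> (\<And>i. i \<in> A \<Longrightarrow> p i \<in> J) \<Longrightarrow> sum p A \<in> J"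
  by (induction A rule: infinite_finite_induct) (auto simp: is_idealD)

definition adj :: "'r::comm_ring_1 set \<Rightarrow> 'r \<Rightarrow> 'r set" where
  "adj J q = {p + r * q | p r. p \<in> J}"

lemma is_ideal_adj:
  assumes J: "is_ideal J"
  shows "is_ideal (adj J q)" "J \<subseteq> adj J q" "q \<in> adj J q"
proof -
  have "0 + 0 * q \<in> adj J q" unfolding adj_def using is_idealD(1)[OF J] by blast
  moreover have "x + y \<in> adj J q" if xy: "x \<in> adj J q" "y \<in> adj J q" for x y
  proof -
    obtain p r p' r' where "x = p + r * q" "y = p' + r' * q" "p \<in> J" "p' \<in> J"
      using xy unfolding adj_def by blast
    then have "x + y = (p + p') + (r + r') * q" "p + p' \<in> J"
      by (auto simp: algebra_simps is_idealD[OF J])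
    then show ?thesis unfolding adj_def by blast
  qed
  moreover have "s * x \<in> adj J q" if x: "x \<in> adj J q" for x s
  proof -
    obtain p r where "x = p + r * q" "p \<in> J" using x unfolding adj_def by blast
    then have "s * x = s * p + (s * r) * q" "s * p \<in> J"
      by (simp add: algebra_simps) (rule is_idealD(3)[OF J \<open>p \<in> J\<close>])
    then show ?thesis unfolding adj_def by blast
  qed
  ultimately show "is_ideal (adj J q)" by (auto simp: is_ideal_def)
  have "p + 0 * q \<in> adj J q" if "p \<in> J" for p unfolding adj_def using that by blast
  then show "J \<subseteq> adj J q" by auto
  have "0 + 1 * q \<in> adj J q" unfolding adj_def using is_idealD(1)[OF J] by blast
  then show "q \<in> adj J q" by simp
qed

abbreviation Cst :: "complex \<Rightarrow> 'n cpoly" where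
  "Cst c \<equiv> Poly_Mapping.single 0 c"

definition usubst :: "'n::finite cpoly \<Rightarrow> complex poly \<Rightarrow> 'n cpoly" where
  "usubst x p = poly (map_poly Cst p) x"

lemma usubst_0 [simp]: "usubst x 0 = 0"
  by (simp add: usubst_def)

lemma usubst_pCons [simp]: "usubst x (pCons a p) = Cst a + x * usubst x p"
  by (simp add: usubst_def map_poly_pCons)

lemma usubst_add: "usubst x (p + q) = usubst x p + usubst x q"
  by (induction p q rule: poly_induct2) (auto simp: single_add algebra_simps)

lemma usubst_smult: "usubst x (Polynomial.smult a p) = Cst a * usubst x p"
  by (induction p) (auto simp: mult_single algebra_simps)

lemma usubst_mult: "usubst x (p * q) = usubst x p * usubst x q"
  by (induction p) (auto simp: usubst_add usubst_smult algebra_simps)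

lemma usubst_sum: "usubst x (\<Sum>i\<in>A. p i) = (\<Sum>i\<in>A. usubst x (p i))"
  by (induction A rule: infinite_finite_induct) (auto simp: usubst_add)

lemma usubst_prod: "usubst x (\<Prod>i\<in>A. p i) = (\<Prod>i\<in>A. usubst x (p i))"
proof (induction A rule: infinite_finite_induct)
  have "usubst x 1 = 1" by (simp add: one_pCons)
  then show "usubst x (\<Prod>i\<in>{}. p i) = (\<Prod>i\<in>{}. usubst x (p i))"
    "infinite A \<Longrightarrow> usubst x (\<Prod>i\<in>A. p i) = (\<Prod>i\<in>A. usubst x (p i))" for A by auto
qed (auto simp: usubst_mult)

text \<open>Each root \<open>r\<close> of \<open>u\<close> splits off a factor \<open>x - r\<close>,
  which is invertible modulo \<open>J\<close> with inverse \<open>g r\<close>; removing all of them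
  leaves a nonzero constant in \<open>J\<close>.\<close>

lemma unit_of_usubst_in_ideal:
  fixes u :: "complex poly"
  assumes J: "is_ideal J" and g: "\<And>c. 1 - g c * (x - Cst c) \<in> J"
    and "u \<noteq> 0" "usubst x u \<in> J"
  shows "1 \<in> J"
  using assms(3,4)
proof (induction "degree u" arbitrary: u)
  case 0
  then obtain a where a: "u = [:a:]" by (metis degree_eq_zeroE)
  have "Cst (1 / a) * Cst a \<in> J" using 0 is_idealD(3)[OF J] by (simp add: a)
  then show ?case using 0 a by (simp add: mult_single)
next
  case (Suc n)
  then have "\<not> constant (poly u)" by (simp add: constant_degree)
  then obtain r where "poly u r = 0" using fundamental_theorem_of_algebra by blast
  then obtain v where v: "u = [:- r, 1:] * v" by (meson dvdE poly_eq_0_iff_dvd)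
  have "v \<noteq> 0" "n = degree v"
    using Suc v by (auto simp: degree_mult_eq simp del: mult_pCons_left)
  moreover have "usubst x v \<in> J"
  proof -
    have u: "usubst x u = (x - Cst r) * usubst x v"
      unfolding v usubst_mult by (simp add: single_uminus)
    have "usubst x v = usubst x v * (1 - g r * (x - Cst r)) + g r * usubst x u"
      unfolding u by (simp add: algebra_simps)
    also have "\<dots> \<in> J" using Suc.prems g by (intro is_idealD[OF J]) auto
    finally show ?thesis .
  qed
  ultimately show ?case using Suc.hyps by blast
qed

text \<open>Otherwise every \<open>x - c\<close> has an inverse \<open>g c\<close> modulo
  \<open>J\<close>. As the complex numbers are uncountable, infinitely many \<open>g c\<close> have
  exponents below a common bound, so there is a linear dependency among them; clearing denominators
  yields a nonzero univariate \<open>u\<close> with \<open>usubst x u\<close> in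
  \<open>J\<close>.\<close>

lemma proper_ideal_adj_linear:
  fixes J :: "'n::finite cpoly set"
  assumes J: "is_ideal J" and "1 \<notin> J"
  shows "\<exists>c. 1 \<notin> adj J (x - Cst c)"
proof (rule ccontr)
  assume "\<not> ?thesis"
  then have "\<exists>g. 1 - g * (x - Cst c) \<in> J" for c
    unfolding adj_def by (auto simp: eq_diff_eq[symmetric])
  then obtain g where g: "\<And>c. 1 - g c * (x - Cst c) \<in> J" by metis
  define B where "B N = {k :: 'n monomial. \<forall>i. lk k i \<le> N}" for N
  have finB: "finite (B N)" for N unfolding B_def by (rule finite_bounded_monomials)
  define S where "S N = {c. Poly_Mapping.keys (g c) \<subseteq> B N}" for N
  have "c \<in> (\<Union>N. S N)" for c
  proof -
    define N where "N = Max (insert 0 ((\<lambda>(k, i). lk k i) ` (Poly_Mapping.keys (g c) \<times> UNIV)))"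
    have "c \<in> S N" unfolding S_def B_def N_def
      by (auto intro!: Max_ge image_eqI[where x = "(k, i)" for k i])
    then show ?thesis by auto
  qed
  then have "(\<Union>N. S N) = UNIV" by auto
  moreover have "uncountable (UNIV :: complex set)"
    by (rule uncountable_UNIV_complex)
  ultimately obtain N where "infinite (S N)"
    by (metis countable_UN countable_finite uncountable_def UNIV_I countableI_type)
  then obtain T where T: "T \<subseteq> S N" "finite T" "card T = Suc (card (B N))"
    by (meson infinite_arbitrarily_large)
  obtain l c0 where l: "c0 \<in> T" "l c0 \<noteq> 0" "\<And>b. b \<in> B N \<Longrightarrow> (\<Sum>c\<in>T. l c * lk (g c) b) = 0"
    using homogeneous_system[OF finB T(2), of N "\<lambda>c b. lk (g c) b"] T by auto
  have dep: "(\<Sum>c\<in>T. Cst (l c) * g c) = 0"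
  proof (rule poly_mapping_eqI)
    fix m
    have "(\<Sum>c\<in>T. l c * lk (g c) m) = 0"
    proof (cases "m \<in> B N")
      case False
      then have "lk (g c) m = 0" if "c \<in> T" for c
        using T(1) that unfolding S_def by (metis (mono_tags, lifting) in_keys_iff mem_Collect_eq subsetD)
      then show ?thesis by simp
    qed (rule l)
    then show "lk (\<Sum>c\<in>T. Cst (l c) * g c) m = lk 0 m"
      by (simp add: lookup_sum lookup_const_times)
  qed
  \<comment> \<open>The numerator of the sum of \<open>l c / (x - c)\<close>. At \<open>c0\<close>
    only the summand of \<open>c0\<close> survives, so \<open>u\<close> is not zero.\<close>
  define u where "u = (\<Sum>c\<in>T. Polynomial.smult (l c) (\<Prod>b\<in>T - {c}. [:- b, 1:]))"
  have "poly u c0 = (\<Sum>c\<in>T. if c = c0 then l c0 * (\<Prod>b\<in>T - {c0}. c0 - b) else 0)"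
    unfolding u_def poly_sum using T l
    by (intro sum.cong refl) (auto simp: poly_prod intro!: prod_zero)
  then have "poly u c0 \<noteq> 0" using T l by simp
  then have u0: "u \<noteq> 0" by auto
  have "usubst x u = (\<Sum>c\<in>T. Cst (l c) * (\<Prod>b\<in>T - {c}. x - Cst b))"
    by (simp add: u_def usubst_sum usubst_smult usubst_prod single_uminus)
  also have "\<dots> = (\<Sum>c\<in>T. Cst (l c) * (\<Prod>b\<in>T - {c}. x - Cst b) * (1 - g c * (x - Cst c)))
      + (\<Prod>b\<in>T. x - Cst b) * (\<Sum>c\<in>T. Cst (l c) * g c)"
    unfolding sum_distrib_left sum.distrib[symmetric]
  proof (rule sum.cong[OF refl])
    fix c assume "c \<in> T"
    then have e: "(\<Prod>b\<in>T. x - Cst b) = (x - Cst c) * (\<Prod>b\<in>T - {c}. x - Cst b)"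
      using T by (simp add: prod.remove)
    show "Cst (l c) * (\<Prod>b\<in>T - {c}. x - Cst b) =
        Cst (l c) * (\<Prod>b\<in>T - {c}. x - Cst b) * (1 - g c * (x - Cst c)) +
        (\<Prod>b\<in>T. x - Cst b) * (Cst (l c) * g c)"
      unfolding e by (simp add: algebra_simps)
  qed
  also have "\<dots> \<in> J"
    unfolding dep using g is_idealD[OF J] by (auto intro!: is_ideal_sum[OF J])
  finally show False using unit_of_usubst_in_ideal[OF J g u0] assms by blast
qed

text \<open>Only as much of a maximal ideal is built as is needed: one constant \<open>c i\<close>
  per variable, adjoined so that the ideal stays proper.\<close>

lemma proper_ideal_maximal_point:
  fixes J :: "'n::finite cpoly set"
  assumes J: "is_ideal J" and "1 \<notin> J" and "finite A"
  shows "\<exists>c M. is_ideal M \<and> J \<subseteq> M \<and> 1 \<notin> M \<and> (\<forall>i\<in>A. X i - Cst (c i) \<in> M)"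
  using assms(3)
proof (induction A rule: finite_induct)
  case empty
  then show ?case using assms by auto
next
  case (insert i A)
  then obtain c M where M: "is_ideal M" "J \<subseteq> M" "1 \<notin> M" "\<forall>i\<in>A. X i - Cst (c i) \<in> M" by auto
  obtain b where b: "1 \<notin> adj M (X i - Cst b)" using proper_ideal_adj_linear[OF M(1,3)] by blast
  let ?M = "adj M (X i - Cst b)" and ?c = "c(i := b)"
  have "is_ideal ?M \<and> J \<subseteq> ?M \<and> 1 \<notin> ?M \<and> (\<forall>j\<in>insert i A. X j - Cst (?c j) \<in> ?M)"
    using is_ideal_adj[OF M(1), of "X i - Cst b"] M b insert.hyps by auto
  then show ?case by blast
qed

lemma single_eq_prod_X: "Poly_Mapping.single k 1 = (\<Prod>i\<in>UNIV. X i ^ lk k i :: 'n::finite cpoly)"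
proof -
  have "(\<Prod>i\<in>A. X i ^ lk k i) = Poly_Mapping.single (\<Sum>i\<in>A. Poly_Mapping.single i (lk k i)) (1 :: complex)"
    if "finite A" for A :: "'n set"
    using that by (induction A rule: finite_induct) (auto simp: X_power mult_single)
  moreover have "(\<Sum>i\<in>UNIV. Poly_Mapping.single i (lk k i)) = k"
    by (rule poly_mapping_eqI) (simp add: lookup_sum lookup_single when_def)
  ultimately show ?thesis by simp
qed

text \<open>Modulo \<open>M\<close> every polynomial is congruent to its value at \<open>c\<close>,
  since this holds for constants and variables and is preserved by sums and products. A nonzero
  value of an element of \<open>J\<close> would put a unit into \<open>M\<close>.\<close>

theorem weak_nullstellensatz:
  fixes J :: "'n::finite cpoly set"
  assumes J: "is_ideal J" and "1 \<notin> J"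
  shows "\<exists>c. \<forall>p\<in>J. ev c p = 0"
proof -
  obtain c M where M: "is_ideal M" "J \<subseteq> M" "1 \<notin> M" "\<And>i. X i - Cst (c i) \<in> M"
    using proper_ideal_maximal_point[OF assms, of UNIV] by auto
  define R where "R = {p. p - Cst (ev c p) \<in> M}"
  have RX: "X i \<in> R" for i using M(4) by (simp add: R_def ev_X)
  have RC: "Cst a \<in> R" for a by (simp add: R_def ev_single is_idealD[OF M(1)])
  have Radd: "p + q \<in> R" if "p \<in> R" "q \<in> R" for p q
    using is_idealD(2)[OF M(1), of "p - Cst (ev c p)" "q - Cst (ev c q)"] that
    by (simp add: R_def ev_add single_add algebra_simps)
  have Rmult: "p * q \<in> R" if "p \<in> R" "q \<in> R" for p q
  proof -
    have "p * q - Cst (ev c (p * q)) = q * (p - Cst (ev c p)) + Cst (ev c p) * (q - Cst (ev c q))"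
      by (simp add: ev_times algebra_simps mult_single)
    also have "\<dots> \<in> M" using that by (auto simp: R_def intro!: is_idealD[OF M(1)])
    finally show ?thesis by (simp add: R_def)
  qed
  have R1: "1 \<in> R" using RC[of 1] by simp
  have Rpow: "p ^ n \<in> R" if "p \<in> R" for p n
    by (induction n) (auto intro: Rmult R1 that)
  have Rprod: "(\<Prod>i\<in>A. X i ^ lk k i) \<in> R" for A and k :: "'n monomial"
    by (induction A rule: infinite_finite_induct) (auto intro: Rmult R1 Rpow RX)
  have "p \<in> R" for p
  proof (induction p rule: poly_induct)
    case (single k a)
    have "Poly_Mapping.single k a = Cst a * Poly_Mapping.single k 1" by (simp add: mult_single)
    also have "\<dots> \<in> R" unfolding single_eq_prod_X by (intro Rmult RC Rprod)
    finally show ?case .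
  qed (use RC[of 0] in \<open>auto intro: Radd\<close>)
  have "ev c p = 0" if "p \<in> J" for p
  proof (rule ccontr)
    assume ne: "ev c p \<noteq> 0"
    have "Cst (ev c p) = p - (p - Cst (ev c p))" by simp
    also have "\<dots> \<in> M" using is_ideal_diff[OF M(1), of p "p - Cst (ev c p)"] that M(2) \<open>p \<in> R\<close> by (auto simp: R_def)
    finally have "Cst (1 / ev c p) * Cst (ev c p) \<in> M" by (rule is_idealD(3)[OF M(1)])
    then show False using ne M(3) by (simp add: mult_single)
  qed
  then show ?thesis by blast
qed

definition wt :: "('n::finite \<Rightarrow> rat) \<Rightarrow> 'n monomial \<Rightarrow> rat" where
  "wt w m = (\<Sum>i\<in>UNIV. w i * of_nat (lk m i))"

lemma wt_add: "wt w (k + l) = wt w k + wt w l"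
  by (simp add: wt_def lookup_add distrib_left sum.distrib)

lemma wt_single: "wt w (Poly_Mapping.single i n) = w i * of_nat n"
proof -
  have "wt w (Poly_Mapping.single i n) = (\<Sum>j\<in>UNIV. if j = i then w i * of_nat n else 0)"
    unfolding wt_def by (rule sum.cong) (auto simp: lookup_single when_def)
  then show ?thesis by simp
qed

lemma wt_0 [simp]: "wt w 0 = 0"
  by (simp add: wt_def)

lemma wt_nonneg: "(\<And>i. w i > 0) \<Longrightarrow> wt w m \<ge> 0"
  unfolding wt_def by (intro sum_nonneg mult_nonneg_nonneg) (auto intro: less_imp_le)

text \<open>
  The ideal \<open>J\<close> of the \<open>F k\<close> and \<open>X i - 1\<close> have no common zero.  The components of weight \<open>n * w i\<close> of the
  cofactor \<open>v\<close> in \<open>1 - v + X i * v \<in> J\<close> are congruent to \<open>X i ^ n\<close> modulo \<open>J\<close>, but almost all of them vanish.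
\<close>

theorem graded_nullstellensatz:
  fixes F :: "'a \<Rightarrow> 'n::finite cpoly"
  assumes K: "finite K" and w: "\<And>i. w i > 0"
    and hom: "\<And>k m. k \<in> K \<Longrightarrow> m \<in> Poly_Mapping.keys (F k) \<Longrightarrow> wt w m = d k"
    and zero: "\<And>x. (\<And>k. k \<in> K \<Longrightarrow> ev x (F k) = 0) \<Longrightarrow> x i = 0"
  shows "\<exists>N c. X i ^ N = (\<Sum>k\<in>K. c k * F k)"
proof -
  define J where "J = {(\<Sum>k\<in>K. c k * F k) | c. True}"
  have JI: "(\<Sum>k\<in>K. c k * F k) \<in> J" for c by (auto simp: J_def)
  have J: "is_ideal J"
    unfolding is_ideal_def
  proof (intro conjI ballI allI)
    show "0 \<in> J" using JI[of "\<lambda>_. 0"] by simp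
  next
    fix p q assume "p \<in> J" "q \<in> J"
    then obtain c c' where "p = (\<Sum>k\<in>K. c k * F k)" "q = (\<Sum>k\<in>K. c' k * F k)" by (auto simp: J_def)
    then show "p + q \<in> J" using JI[of "\<lambda>k. c k + c' k"] by (simp add: distrib_right sum.distrib)
  next
    fix p r assume "p \<in> J"
    then obtain c where "p = (\<Sum>k\<in>K. c k * F k)" by (auto simp: J_def)
    then show "r * p \<in> J" using JI[of "\<lambda>k. r * c k"] by (simp add: sum_distrib_left mult.assoc)
  qed
  have FJ: "F k \<in> J" if "k \<in> K" for k
  proof -
    have "(\<Sum>j\<in>K. (if j = k then 1 else 0) * F j) = (\<Sum>j\<in>K. if j = k then F k else 0)"
      by (rule sum.cong) auto
    then show ?thesis using JI[of "\<lambda>j. if j = k then 1 else 0"] that K by simp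
  qed
  define pr where "pr l = pfilter (\<lambda>m. wt w m = l)" for l
  have prJ: "pr l p \<in> J" if p: "p \<in> J" for p l
  proof -
    obtain c where "p = (\<Sum>k\<in>K. c k * F k)" using p by (auto simp: J_def)
    then have "pr l p = (\<Sum>k\<in>K. pr l (F k * c k))" by (simp add: pr_def pfilter_sum mult.commute)
    also have "\<dots> = (\<Sum>k\<in>K. F k * pr (l - d k) (c k))"
      unfolding pr_def using hom by (intro sum.cong refl pfilter_times) (auto simp: wt_add)
    finally show ?thesis using JI[of "\<lambda>k. pr (l - d k) (c k)"] by (simp add: mult.commute)
  qed
  have "1 \<in> adj J (X i - 1)"
  proof (rule ccontr)
    assume "1 \<notin> adj J (X i - 1)"
    then obtain c where c: "\<And>p. p \<in> adj J (X i - 1) \<Longrightarrow> ev c p = 0"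
      using weak_nullstellensatz is_ideal_adj[OF J] by blast
    have "c i = 1" using c[OF is_ideal_adj(3)[OF J]] by (simp add: ev_diff ev_X)
    moreover have "c i = 0"
    proof (rule zero)
      fix k assume "k \<in> K"
      show "ev c (F k) = 0"
        using c is_ideal_adj(2)[OF J] FJ[OF \<open>k \<in> K\<close>] by auto
    qed
    ultimately show False by simp
  qed
  then obtain p r where pr: "1 = p + r * (X i - 1)" "p \<in> J" by (auto simp: adj_def)
  define v where "v = - r"
  have v: "1 - v + X i * v \<in> J" using pr by (simp add: v_def algebra_simps)
  have pr_diff: "pr l (x - y) = pr l x - pr l y" for l x y
    by (rule poly_mapping_eqI) (simp add: pr_def lookup_pfilter lookup_minus)
  have prX: "pr l (X i * q) = X i * pr (l - w i) q" for l q
    unfolding pr_def by (rule pfilter_times) (auto simp: X_def wt_add wt_single)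
  have pr1: "pr l 1 = (if l = 0 then 1 else 0)" for l
    by (rule poly_mapping_eqI) (auto simp: pr_def lookup_pfilter lookup_one when_def)
  \<comment> \<open>The component of weight \<open>l\<close> of \<open>1 - v + X i * v\<close>; for
    \<open>l\<close> a multiple of \<open>w i\<close> it is the recursion behind
    \<open>main\<close>.\<close>
  have step: "pr l 1 - pr l v + X i * pr (l - w i) v \<in> J" for l
    using prJ[OF v, of l] unfolding pr_def pfilter_add unfolding pr_def[symmetric] pr_diff prX .
  have main: "X i ^ n - pr (of_nat n * w i) v \<in> J" for n
  proof (induction n)
    case 0
    have "pr (0 - w i) v = 0"
    proof (rule poly_mapping_eqI)
      fix m
      have "wt w m \<noteq> 0 - w i" using wt_nonneg[of w m, OF w] w[of i] by linarith
      then show "lk (pr (0 - w i) v) m = lk 0 m" by (simp add: pr_def lookup_pfilter)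
    qed
    then show ?case using step[of 0] by (simp add: pr1)
  next
    case (Suc n)
    have "of_nat (Suc n) * w i \<noteq> 0" using w[of i] by simp
    moreover have "of_nat (Suc n) * w i - w i = of_nat n * w i" by (simp add: algebra_simps)
    ultimately have "- pr (of_nat (Suc n) * w i) v + X i * pr (of_nat n * w i) v \<in> J"
      using step[of "of_nat (Suc n) * w i"] by (simp add: pr1)
    from is_idealD(2)[OF J this is_idealD(3)[OF J Suc, of "X i"]]
    show ?case by (simp add: algebra_simps)
  qed
  have "\<exists>n. pr (of_nat n * w i) v = 0"
  proof -
    have "inj (\<lambda>n. of_nat n * w i)" using w[of i] by (auto intro: injI)
    then have "infinite (range (\<lambda>n. of_nat n * w i))" using finite_imageD by blast
    moreover have "finite (wt w ` Poly_Mapping.keys v)" by simp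
    ultimately have "\<not> range (\<lambda>n. of_nat n * w i) \<subseteq> wt w ` Poly_Mapping.keys v"
      using finite_subset by blast
    then obtain n where n: "of_nat n * w i \<notin> wt w ` Poly_Mapping.keys v" by auto
    have "pr (of_nat n * w i) v = 0"
      using n by (intro poly_mapping_eqI) (auto simp: pr_def lookup_pfilter image_iff, metis in_keys_iff)
    then show ?thesis ..
  qed
  then obtain n where "pr (of_nat n * w i) v = 0" ..
  with main[of n] have "X i ^ n \<in> J" by simp
  then show ?thesis by (auto simp: J_def)
qed

section \<open>Powers of variables\<close>

text \<open>The ideal is generated by monomials, so membership is read off from the exponents, and
  regularity becomes a statement about single exponents.\<close>

lemma lin_ideal_X_powers:
  fixes i :: "nat \<Rightarrow> 'n::finite"
  shows "p \<in> lin_ideal (\<lambda>j. X (i j) ^ N j) k \<longleftrightarrow>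
    (\<forall>m\<in>Poly_Mapping.keys p. \<exists>j<k. N j \<le> lk m (i j))"
proof
  assume "p \<in> lin_ideal (\<lambda>j. X (i j) ^ N j) k"
  then obtain c where c: "p = (\<Sum>j<k. c j * X (i j) ^ N j)" unfolding lin_ideal_def by auto
  show "\<forall>m\<in>Poly_Mapping.keys p. \<exists>j<k. N j \<le> lk m (i j)"
  proof
    fix m assume "m \<in> Poly_Mapping.keys p"
    then have "(\<Sum>j<k. lk (c j * X (i j) ^ N j) m) \<noteq> 0"
      by (simp add: c in_keys_iff lookup_sum)
    then obtain j where j: "j < k" "lk (c j * X (i j) ^ N j) m \<noteq> 0"
      by (meson lessThan_iff sum.neutral)
    then obtain l where "m = l + Poly_Mapping.single (i j) (N j)"
      using keys_times[of m "c j" "X (i j) ^ N j"] by (auto simp: X_power in_keys_iff)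
    then show "\<exists>j<k. N j \<le> lk m (i j)" using j by (auto simp: lookup_add)
  qed
next
  assume *: "\<forall>m\<in>Poly_Mapping.keys p. \<exists>j<k. N j \<le> lk m (i j)"
  have "Poly_Mapping.single m c \<in> lin_ideal (\<lambda>j. X (i j) ^ N j) k" if m: "m \<in> Poly_Mapping.keys p" for m c
  proof -
    obtain j where j: "j < k" "N j \<le> lk m (i j)" using * m by auto
    have "m = (m - Poly_Mapping.single (i j) (N j)) + Poly_Mapping.single (i j) (N j)"
      by (rule poly_mapping_eqI) (use j in \<open>auto simp: lookup_add lookup_minus lookup_single when_def\<close>)
    then have "Poly_Mapping.single m c =
        Poly_Mapping.single (m - Poly_Mapping.single (i j) (N j)) c * X (i j) ^ N j"
      by (simp add: X_power mult_single)
    also have "\<dots> = (\<Sum>l<k. (if l = j then Poly_Mapping.single (m - Poly_Mapping.single (i j) (N j)) c else 0) * X (i l) ^ N l)"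
      using j by (simp add: if_distrib[of "\<lambda>x. x * _"] cong: if_cong)
    finally show ?thesis unfolding lin_ideal_def
      by (intro CollectI exI[of _ "\<lambda>l. if l = j then Poly_Mapping.single (m - Poly_Mapping.single (i j) (N j)) c else 0"]) simp
  qed
  then show "p \<in> lin_ideal (\<lambda>j. X (i j) ^ N j) k"
    by (subst poly_sum_monomials) (auto intro: lin_ideal_sum)
qed

text \<open>Multiplication by a power of \<open>X (i k)\<close> leaves the exponents of the
  variables \<open>i j\<close> with \<open>j < k\<close> unchanged.\<close>

lemma X_powers_regular:
  fixes i :: "nat \<Rightarrow> 'n::finite"
  assumes "inj_on i {..<M}" "k < M"
    and "X (i k) ^ N k * u \<in> lin_ideal (\<lambda>j. X (i j) ^ N j) k"
  shows "u \<in> lin_ideal (\<lambda>j. X (i j) ^ N j) k"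
  unfolding lin_ideal_X_powers
proof
  fix m assume "m \<in> Poly_Mapping.keys u"
  then have "Poly_Mapping.single (i k) (N k) + m \<in> Poly_Mapping.keys (X (i k) ^ N k * u)"
    by (simp add: X_power in_keys_iff lookup_single_times)
  then obtain j where j: "j < k" "N j \<le> lk (Poly_Mapping.single (i k) (N k) + m) (i j)"
    using assms(3) unfolding lin_ideal_X_powers by blast
  moreover have "i j \<noteq> i k" using assms(1,2) j by (auto dest: inj_onD)
  ultimately show "\<exists>j<k. N j \<le> lk m (i j)" by (auto simp: lookup_add lookup_single when_def)
qed

section \<open>Dimension counts\<close>

context vector_space
begin

lemma independent_span_disjoint:
  assumes "independent B" "finite B" "x \<in> span B1" "x \<in> span (B - B1)" "B1 \<subseteq> B"
  shows "x = 0"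
proof -
  have fin: "finite B1" "finite (B - B1)" using assms finite_subset by auto
  obtain u where u: "x = (\<Sum>v\<in>B1. scale (u v) v)" using assms(3) span_finite[OF fin(1)] by auto
  obtain u' where u': "x = (\<Sum>v\<in>B - B1. scale (u' v) v)" using assms(4) span_finite[OF fin(2)] by auto
  let ?c = "\<lambda>v. if v \<in> B1 then u v else - u' v"
  have "(\<Sum>v\<in>B. scale (?c v) v) = (\<Sum>v\<in>B - B1. scale (?c v) v) + (\<Sum>v\<in>B1. scale (?c v) v)"
    using assms by (simp add: sum.subset_diff)
  also have "(\<Sum>v\<in>B1. scale (?c v) v) = x" unfolding u by (rule sum.cong) auto
  also have "(\<Sum>v\<in>B - B1. scale (?c v) v) = - x"
    unfolding u' sum_negf[symmetric] by (rule sum.cong) auto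
  finally have sum0: "(\<Sum>v\<in>B. scale (?c v) v) = 0" by simp
  have "?c v = 0" if "v \<in> B" for v
    by (rule independentD[where u = ?c, OF assms(1,2) subset_refl sum0 that])
  then have "u v = 0" if "v \<in> B1" for v using that assms(5) by (metis subsetD)
  then show ?thesis unfolding u by simp
qed

text \<open>Stated for a subspace of a finite span, as the space of all forms has infinite
  dimension. A basis of the kernel is extended to one of \<open>S\<close>; the added vectors map
  injectively onto a basis of the image.\<close>

lemma rank_nullity:
  assumes S: "subspace S" "S \<subseteq> span A" "finite A" and T: "Vector_Spaces.linear scale scale T"
  shows "dim S = dim {x \<in> S. T x = 0} + dim (T ` S)"
proof -
  interpret T: Vector_Spaces.linear scale scale T by (rule T)
  let ?K = "{x \<in> S. T x = 0}"
  obtain B1 where B1: "B1 \<subseteq> ?K" "independent B1" "?K \<subseteq> span B1"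
    using maximal_independent_subset by blast
  obtain B where B: "B1 \<subseteq> B" "B \<subseteq> S" "independent B" "S \<subseteq> span B"
    using maximal_independent_subset_extend[of B1 S] B1 by blast
  have finB: "finite B"
    using independent_span_bound[OF S(3) B(3)] B(2) S(2) by blast
  define C where "C = B - B1"
  have CS: "span C \<subseteq> S" using B S by (intro span_minimal) (auto simp: C_def)
  have inj: "inj_on T (span C)"
    unfolding T.inj_on_iff_eq_0[OF subspace_span]
  proof (intro ballI impI)
    fix x assume x: "x \<in> span C" "T x = 0"
    then have "x \<in> span B1" using CS B1(3) by blast
    then show "x = 0"
      using independent_span_disjoint[OF B(3) finB _ _ B(1)] x by (auto simp: C_def)
  qed
  have ind: "independent (T ` C)"
    by (rule T.independent_injective_image[OF _ inj]) (rule independent_mono[OF B(3)], auto simp: C_def)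
  have "T x \<in> span (T ` C)" if x: "x \<in> S" for x
  proof -
    have "x \<in> span (B1 \<union> C)" using x B by (auto simp: C_def Un_absorb1)
    then obtain y z where yz: "x = y + z" "y \<in> span B1" "z \<in> span C" by (auto simp: span_Un)
    have "T y \<in> span (T ` B1)" using yz by (auto simp: T.span_image)
    also have "T ` B1 \<subseteq> {0}" using B1 by auto
    then have "span (T ` B1) \<subseteq> {0}" by (metis span_mono span_insert_0 span_empty)
    finally have "T x = T z" by (simp add: yz T.add)
    then show ?thesis using yz by (auto simp: T.span_image)
  qed
  then have sp: "T ` S \<subseteq> span (T ` C)" by auto
  have sub: "T ` C \<subseteq> T ` S" using B by (auto simp: C_def)
  have "dim (T ` S) = card (T ` C)"
    using basis_card_eq_dim[OF sub sp ind] by simp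
  also have "\<dots> = card C"
    by (rule card_image) (rule inj_on_subset[OF inj span_superset])
  finally have "dim (T ` S) = card C" .
  moreover have "dim ?K = card B1" using basis_card_eq_dim[OF B1(1,3,2)] by simp
  moreover have "dim S = card B" using basis_card_eq_dim[OF B(2,4,3)] by simp
  moreover have "card B = card B1 + card C"
    using B finB unfolding C_def by (metis card_Diff_subset card_mono finite_subset le_add_diff_inverse)
  ultimately show ?thesis by simp
qed

text \<open>Steinitz exchange: a basis of the span of \<open>J\<close> is completed by vectors of
  \<open>E\<close> itself. As \<open>E\<close> will consist of monomials, the quotient gets a
  monomial basis.\<close>

lemma quotient_basis:
  assumes E: "independent E" "finite E" and J: "J \<subseteq> span E"
  obtains E' where "E' \<subseteq> E" "card E' + dim J = card E"
    "\<And>v. v \<in> span E \<Longrightarrow> \<exists>q\<in>span E'. v - q \<in> span J"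
    "\<And>v. v \<in> span E' \<Longrightarrow> v \<in> span J \<Longrightarrow> v = 0"
proof -
  obtain B1 where B1: "B1 \<subseteq> J" "independent B1" "J \<subseteq> span B1" "card B1 = dim J"
    using basis_exists[of J] by blast
  have fin1: "finite B1" using independent_span_bound[OF E(2) B1(2)] B1(1) J by blast
  have spJ: "span J = span B1"
    using B1 span_mono span_minimal[OF B1(3) subspace_span] by blast
  obtain B where B: "B1 \<subseteq> B" "B \<subseteq> B1 \<union> E" "independent B" "B1 \<union> E \<subseteq> span B"
    using maximal_independent_subset_extend[of B1 "B1 \<union> E"] B1 by blast
  have finB: "finite B" using B fin1 E finite_subset by blast
  define E' where "E' = B - B1"
  show ?thesis
  proof
    show "E' \<subseteq> E" using B by (auto simp: E'_def)
    have "B \<subseteq> span E" using B B1 J span_superset by blast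
    moreover have "span E \<subseteq> span B" using B(4) by (intro span_minimal) auto
    ultimately have "card B = dim (span E)" using basis_card_eq_dim[of B "span E"] B by simp
    then have "card B = card E" using dim_span_eq_card_independent[OF E(1)] by (simp only:)
    then show "card E' + dim J = card E"
      using B finB fin1 B1(4) card_mono[OF finB B(1)] by (simp add: E'_def card_Diff_subset card_mono)
  next
    fix v assume "v \<in> span E"
    moreover have "E \<subseteq> span (B1 \<union> E')" using B by (auto simp: E'_def Un_absorb1)
    then have "span E \<subseteq> span (B1 \<union> E')" by (intro span_minimal) auto
    ultimately obtain y z where "v = y + z" "y \<in> span B1" "z \<in> span E'"
      by (auto simp: span_Un dest: subsetD)
    then show "\<exists>q\<in>span E'. v - q \<in> span J" by (intro bexI[of _ z]) (auto simp: spJ)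
  next
    fix v assume "v \<in> span E'" "v \<in> span J"
    then show "v = 0"
      using independent_span_disjoint[OF B(3) finB _ _ B(1)] by (auto simp: E'_def spJ)
  qed
qed

end

section \<open>Koszul chains as a complex vector space\<close>

type_synonym 'n forms = "'n set \<Rightarrow> 'n cpoly"

definition fscale :: "complex \<Rightarrow> 'n::finite forms \<Rightarrow> 'n forms" where
  "fscale c \<omega> = (\<lambda>S. Poly_Mapping.single 0 c * \<omega> S)"

interpretation forms: vector_space fscale
  by standard (auto simp: fscale_def fun_eq_iff algebra_simps single_add mult_single plus_fun_def)

definition fmon :: "'n set \<times> 'n monomial \<Rightarrow> 'n::finite forms" where
  "fmon b = (\<lambda>S. if S = fst b then Poly_Mapping.single (snd b) 1 else 0)"

definition supported :: "('n set \<times> 'n monomial) set \<Rightarrow> 'n::finite forms set" where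
  "supported B = {\<omega>. \<forall>S m. lk (\<omega> S) m \<noteq> 0 \<longrightarrow> (S, m) \<in> B}"

lemma sum_fun_apply: "(\<Sum>i\<in>A. f i) x = (\<Sum>i\<in>A. f i x :: 'a::comm_monoid_add)"
  by (induction A rule: infinite_finite_induct) auto

lemma lookup_fmon_sum:
  assumes "finite B"
  shows "lk ((\<Sum>b\<in>B. fscale (u b) (fmon b)) S) m = (if (S, m) \<in> B then u (S, m) else 0)"
proof -
  have "lk ((\<Sum>b\<in>B. fscale (u b) (fmon b)) S) m = (\<Sum>b\<in>B. if b = (S, m) then u b else 0)"
    unfolding sum_fun_apply lookup_sum
    by (rule sum.cong) (auto simp: fscale_def fmon_def lookup_const_times lookup_single when_def)
  then show ?thesis using assms by simp
qed

lemma inj_fmon: "inj fmon"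
proof (rule injI)
  fix a b :: "('n::finite) set \<times> 'n monomial" assume "fmon a = fmon b"
  then have "lk (fmon a (fst a)) (snd a) = lk (fmon b (fst a)) (snd a)" by simp
  then show "a = b"
    by (auto simp: fmon_def lookup_single when_def prod_eq_iff split: if_splits)
qed

lemma fmon_basis:
  assumes B: "finite B"
  shows "forms.independent (fmon ` B)" "forms.span (fmon ` B) = supported B"
proof -
  have sum_image: "(\<Sum>v\<in>fmon ` B. fscale (u v) v) = (\<Sum>b\<in>B. fscale (u (fmon b)) (fmon b))" for u
    by (subst sum.reindex) (auto intro: inj_on_subset[OF inj_fmon])
  have fin: "finite (fmon ` B)" using B by simp
  show "forms.independent (fmon ` B)"
  proof (rule forms.independent_if_scalars_zero[OF fin])
    fix u x assume "(\<Sum>v\<in>fmon ` B. fscale (u v) v) = 0" "x \<in> fmon ` B"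
    then obtain b where b: "b \<in> B" "x = fmon b" by auto
    have "lk ((\<Sum>b\<in>B. fscale (u (fmon b)) (fmon b)) (fst b)) (snd b) = 0"
      using \<open>(\<Sum>v\<in>fmon ` B. fscale (u v) v) = 0\<close> unfolding sum_image by simp
    then show "u x = 0" unfolding lookup_fmon_sum[OF B] using b by simp
  qed
  show "forms.span (fmon ` B) = supported B"
  proof (intro equalityI subsetI)
    fix \<omega> assume "\<omega> \<in> forms.span (fmon ` B)"
    then obtain u where "\<omega> = (\<Sum>b\<in>B. fscale (u (fmon b)) (fmon b))"
      unfolding forms.span_finite[OF fin] sum_image by auto
    then show "\<omega> \<in> supported B"
      by (auto simp: supported_def lookup_fmon_sum[OF B] split: if_splits)
  next
    fix \<omega> assume \<omega>: "\<omega> \<in> supported B"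
    have "\<omega> = (\<Sum>b\<in>B. fscale (lk (\<omega> (fst b)) (snd b)) (fmon b))"
    proof (intro ext poly_mapping_eqI)
      fix S m
      show "lk (\<omega> S) m = lk ((\<Sum>b\<in>B. fscale (lk (\<omega> (fst b)) (snd b)) (fmon b)) S) m"
        using \<omega> by (auto simp: lookup_fmon_sum[OF B] supported_def)
    qed
    also have "\<dots> \<in> forms.span (fmon ` B)"
      by (intro forms.span_sum forms.span_scale forms.span_base) auto
    finally show "\<omega> \<in> forms.span (fmon ` B)" .
  qed
qed

lemma dim_supported: "finite B \<Longrightarrow> forms.dim (supported B) = card B"
  using forms.dim_span_eq_card_independent[OF fmon_basis(1)[of B]] fmon_basis(2)[of B]
  by (simp add: card_image inj_on_subset[OF inj_fmon])

section \<open>The graded Koszul complex of the Jacobian ideal\<close>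

text \<open>\<open>I\<close> stands for the variables fixed by \<open>g\<close> and
  \<open>F i\<close> for the \<open>i\<close>-th partial derivative of \<open>f\<^sup>g\<close>: it
  has weight \<open>1 - w i\<close> and character \<open>inverse (h i)\<close>, and the
  \<open>F i\<close> vanish together only at the origin of the coordinate subspace of
  \<open>I\<close>.\<close>

locale graded_jacobian =
  fixes I :: "'n::finite set" and w :: "'n \<Rightarrow> rat" and H :: "('n \<Rightarrow> complex) set" and F :: "'n \<Rightarrow> 'n cpoly"
  assumes w: "w i > 0" and H: "diag_group H"
    and F_keys: "i \<in> I \<Longrightarrow> m \<in> Poly_Mapping.keys (F i) \<Longrightarrow> Poly_Mapping.keys m \<subseteq> I"
    and F_wt: "i \<in> I \<Longrightarrow> m \<in> Poly_Mapping.keys (F i) \<Longrightarrow> wt w m = 1 - w i"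
    and F_inv: "i \<in> I \<Longrightarrow> m \<in> Poly_Mapping.keys (F i) \<Longrightarrow> h \<in> H \<Longrightarrow> mon_val h m * h i = 1"
    and F_zero: "(\<And>i. i \<in> I \<Longrightarrow> ev x (F i) = 0) \<Longrightarrow> (\<And>j. j \<notin> I \<Longrightarrow> x j = 0) \<Longrightarrow> x i = 0"
begin

definition Jac :: "'n cpoly set" where
  "Jac = {(\<Sum>i\<in>I. c i * F i) | c. True}"

text \<open>\<open>graded_nullstellensatz\<close> works with all variables, so the
  \<open>F k\<close> are completed by the variables outside \<open>I\<close>; setting these to zero
  afterwards leaves a combination of the \<open>F k\<close> alone.\<close>

lemma X_power_in_Jac: "\<exists>N. X i ^ N \<in> Jac" if i: "i \<in> I"
proof -
  define F' where "F' k = (if k \<in> I then F k else X k)" for k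
  have "\<exists>N c. X i ^ N = (\<Sum>k\<in>UNIV. c k * F' k)"
  proof (rule graded_nullstellensatz[of UNIV w F' "\<lambda>k. if k \<in> I then 1 - w k else w k"])
    fix k m assume "m \<in> Poly_Mapping.keys (F' k)"
    then show "wt w m = (if k \<in> I then 1 - w k else w k)"
      by (auto simp: F'_def X_def wt_single F_wt split: if_splits)
  next
    fix x :: "'n \<Rightarrow> complex" assume x: "\<And>k. k \<in> UNIV \<Longrightarrow> ev x (F' k) = 0"
    show "x i = 0"
    proof (rule F_zero)
      fix k assume "k \<in> I" then show "ev x (F k) = 0" using x[of k] by (simp add: F'_def)
    next
      fix k assume "k \<notin> I" then show "x k = 0" using x[of k] by (simp add: F'_def ev_X)
    qed
  qed (auto simp: w)
  then obtain N c where c: "X i ^ N = (\<Sum>k\<in>UNIV. c k * F' k)" by blast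
  let ?P = "\<lambda>m. Poly_Mapping.keys m \<subseteq> I"
  have "X i ^ N = pfilter ?P (X i ^ N)"
    using i by (intro pfilter_id[symmetric]) (auto simp: X_power split: if_splits)
  also have "\<dots> = (\<Sum>k\<in>UNIV. pfilter ?P (c k) * pfilter ?P (F' k))"
    unfolding c pfilter_sum by (intro sum.cong refl pfilter_hom) (auto simp: keys_add_monomial)
  also have "\<dots> = (\<Sum>k\<in>I. pfilter ?P (c k) * pfilter ?P (F' k))"
  proof (rule sum.mono_neutral_right)
    have "pfilter ?P (X k) = 0" if "k \<notin> I" for k
      using that by (intro poly_mapping_eqI) (auto simp: lookup_pfilter X_def lookup_single when_def)
    then show "\<forall>k\<in>UNIV - I. pfilter ?P (c k) * pfilter ?P (F' k) = 0" by (simp add: F'_def)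
  qed auto
  also have "\<dots> = (\<Sum>k\<in>I. pfilter ?P (c k) * F k)"
    using F_keys by (intro sum.cong refl) (simp add: F'_def pfilter_id)
  finally show ?thesis unfolding Jac_def
    by (intro exI[of _ N] CollectI exI[of _ "\<lambda>k. pfilter ?P (c k)"]) simp
qed

definition expo :: "'n \<Rightarrow> nat" where
  "expo i = (SOME N. X i ^ N \<in> Jac)"

lemma expo: "i \<in> I \<Longrightarrow> X i ^ expo i \<in> Jac"
  unfolding expo_def by (rule someI_ex) (rule X_power_in_Jac)

definition idx :: "'n \<Rightarrow> nat" where
  "idx = (SOME f. inj f)"

lemma inj_idx: "inj idx"
proof -
  have "\<exists>f :: 'n \<Rightarrow> nat. inj f"
    using finite_imp_inj_to_nat_seg[of "UNIV :: 'n set"] by auto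
  then show ?thesis unfolding idx_def by (rule someI_ex)
qed

sublocale koszul I idx F
  by standard (auto intro: inj_on_subset[OF inj_idx])

text \<open>The pure powers \<open>X i ^ expo i\<close>, in any order \<open>\<iota>\<close> of
  \<open>I\<close>, are the regular sequence inside \<open>Jac\<close> that \<open>exact\<close>
  asks for.\<close>

lemma exact_chains:
  assumes "z \<in> chains j" "0 < j" "\<And>S. d z S = 0"
  shows "\<exists>y\<in>chains (Suc j). z = d y"
proof -
  obtain \<iota> where "bij_betw \<iota> {0..<card I} I"
    using ex_bij_betw_nat_finite[of I] by auto
  then have \<iota>: "bij_betw \<iota> {..<card I} I" by (simp add: atLeast0LessThan)
  show ?thesis
  proof (rule exact[of "\<lambda>k. X (\<iota> k) ^ expo (\<iota> k)", OF _ _ assms])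
    fix k u assume k: "k < card I" and u: "X (\<iota> k) ^ expo (\<iota> k) * u \<in> lin_ideal (\<lambda>k. X (\<iota> k) ^ expo (\<iota> k)) k"
    show "u \<in> lin_ideal (\<lambda>k. X (\<iota> k) ^ expo (\<iota> k)) k"
      by (rule X_powers_regular[where N = "\<lambda>k. expo (\<iota> k)", OF bij_betw_imp_inj_on[OF \<iota>] k u])
  next
    fix k assume "k < card I"
    then have "\<iota> k \<in> I" using \<iota> by (auto simp: bij_betw_def)
    then show "\<exists>c. X (\<iota> k) ^ expo (\<iota> k) = (\<Sum>i\<in>I. c i * F i)"
      using expo by (auto simp: Jac_def)
  qed
qed

text \<open>The weight of \<open>x^m dx_I\<close> times the basis vector of \<open>S\<close>. Each
  \<open>i \<in> S\<close> adds the weight \<open>1 - w i\<close> of \<open>F i\<close>, so that the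
  Koszul differential preserves the total weight; likewise \<open>chi\<close> includes the character
  \<open>inverse (h i)\<close> of \<open>F i\<close>.\<close>

definition wtf :: "'n set \<Rightarrow> 'n monomial \<Rightarrow> rat" where
  "wtf S m = (\<Sum>i\<in>I. w i * (of_nat (lk m i) + 1)) + (\<Sum>i\<in>S. 1 - w i)"

definition chi :: "('n \<Rightarrow> complex) \<Rightarrow> 'n set \<Rightarrow> 'n monomial \<Rightarrow> complex" where
  "chi h S m = (\<Prod>i\<in>I. h i ^ (lk m i + 1)) * (\<Prod>i\<in>S. inverse (h i))"

definition good :: "rat \<Rightarrow> 'n set \<Rightarrow> 'n monomial \<Rightarrow> bool" where
  "good l S m \<longleftrightarrow> Poly_Mapping.keys m \<subseteq> I \<and> wtf S m = l \<and> (\<forall>h\<in>H. chi h S m = 1)"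

text \<open>Homogeneity of the differential: multiplication by a monomial of \<open>F i\<close>
  makes up for the removal of \<open>i\<close> from the index set, in weight and in
  character.\<close>

lemma good_shift:
  assumes "i \<in> I - S" "k \<in> Poly_Mapping.keys (F i)"
  shows "good l S (k + m) \<longleftrightarrow> good l (insert i S) m"
proof -
  have i: "i \<in> I" "i \<notin> S" using assms by auto
  have kI: "Poly_Mapping.keys k \<subseteq> I" by (rule F_keys[OF i(1) assms(2)])
  have k0: "lk k j = 0" if "j \<notin> I" for j using kI that by (metis in_keys_iff subsetD)
  have "wtf S (k + m) = (\<Sum>i\<in>I. w i * of_nat (lk k i)) + wtf S m"
    by (simp add: wtf_def lookup_add algebra_simps sum.distrib)
  also have "(\<Sum>i\<in>I. w i * of_nat (lk k i)) = wt w k"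
    unfolding wt_def by (intro sum.mono_neutral_left) (auto simp: k0)
  also have "wt w k + wtf S m = wtf (insert i S) m"
    using F_wt[OF i(1) assms(2)] i by (simp add: wtf_def)
  finally have 1: "wtf S (k + m) = wtf (insert i S) m" .
  have "chi h S (k + m) = chi h (insert i S) m" if h: "h \<in> H" for h
  proof -
    have "chi h S (k + m) = (\<Prod>i\<in>I. h i ^ lk k i) * chi h S m"
      by (simp add: chi_def lookup_add power_add prod.distrib mult_ac)
    also have "(\<Prod>i\<in>I. h i ^ lk k i) = mon_val h k"
      unfolding mon_val_def by (intro prod.mono_neutral_left) (auto simp: k0)
    also have "mon_val h k = inverse (h i)"
      using F_inv[OF i(1) assms(2) h] by (metis inverse_unique mult.commute)
    also have "inverse (h i) * chi h S m = chi h (insert i S) m"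
      using i by (simp add: chi_def mult_ac)
    finally show ?thesis .
  qed
  then show ?thesis using 1 kI by (auto simp: good_def keys_add_monomial)
qed

definition proj :: "rat \<Rightarrow> 'n forms \<Rightarrow> 'n forms" where
  "proj l \<omega> = (\<lambda>S. pfilter (good l S) (\<omega> S))"

lemma pfilter_sg: "pfilter P (sg i S * p) = sg i S * pfilter P p"
proof (rule pfilter_times)
  have "sg i S \<in> {1, - 1}"
    unfolding sg_def by (cases "even (card {j \<in> S. idx j < idx i})") auto
  then show "P (k + l) \<longleftrightarrow> P l" if "k \<in> Poly_Mapping.keys (sg i S)" for k l
    using that by auto
qed

lemma proj_d: "proj l (d \<omega>) = d (proj l \<omega>)"
proof
  fix S
  show "proj l (d \<omega>) S = d (proj l \<omega>) S"
  proof (cases "S \<subseteq> I")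
    case True
    have "pfilter (good l S) (sg i S * F i * \<omega> (insert i S)) =
        sg i S * F i * pfilter (good l (insert i S)) (\<omega> (insert i S))" if "i \<in> I - S" for i
      unfolding mult.assoc pfilter_sg using good_shift[OF that] by (subst pfilter_times) auto
    then show ?thesis using True by (simp add: proj_def d_def pfilter_sum)
  qed (simp add: proj_def d_def poly_mapping_eq_iff lookup_pfilter fun_eq_iff)
qed

definition B :: "nat \<Rightarrow> rat \<Rightarrow> ('n set \<times> 'n monomial) set" where
  "B j l = {(S, m). S \<subseteq> I \<and> card S = j \<and> good l S m}"

lemma finite_good: "finite {m. good l S m}"
proof (rule finite_subset)
  define b where "b i = nat \<lceil>(l - (\<Sum>i\<in>S. 1 - w i)) / w i\<rceil>" for i
  show "{m. good l S m} \<subseteq> {m. \<forall>i. lk m i \<le> b i}"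
  proof clarify
    fix m i assume m: "good l S m"
    show "lk m i \<le> b i"
    proof (cases "i \<in> I")
      case True
      have "w i * of_nat (lk m i) \<le> w i * (of_nat (lk m i) + 1)" using w[of i] by simp
      also have "\<dots> \<le> (\<Sum>i\<in>I. w i * (of_nat (lk m i) + 1))"
        using True w by (intro member_le_sum) (auto intro!: mult_nonneg_nonneg less_imp_le)
      also have "\<dots> = l - (\<Sum>i\<in>S. 1 - w i)" using m by (simp add: good_def wtf_def)
      finally have "of_nat (lk m i) \<le> (l - (\<Sum>i\<in>S. 1 - w i)) / w i"
        using w[of i] by (simp add: field_simps)
      then show ?thesis unfolding b_def by (simp add: le_nat_iff) linarith
    next
      case False
      then have "lk m i = 0" using m by (auto simp: good_def in_keys_iff)
      then show ?thesis by simp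
    qed
  qed
qed (rule finite_bounded_monomials)

lemma finite_B: "finite (B j l)"
proof (rule finite_subset)
  show "B j l \<subseteq> (\<Union>S. {S} \<times> {m. good l S m})" by (auto simp: B_def)
qed (use finite_good in auto)

lemma supported_B: "\<omega> \<in> supported (B j l) \<longleftrightarrow> \<omega> \<in> chains j \<and> proj l \<omega> = \<omega>"
proof
  assume *: "\<omega> \<in> supported (B j l)"
  have "S \<subseteq> I \<and> card S = j" if S: "\<omega> S \<noteq> 0" for S
  proof -
    obtain m where "lk (\<omega> S) m \<noteq> 0" using S by (metis lookup_zero poly_mapping_eqI)
    then show ?thesis using * by (auto simp: supported_def B_def)
  qed
  moreover have "proj l \<omega> = \<omega>"
    unfolding proj_def using *
    by (intro ext pfilter_id) (auto simp: supported_def B_def in_keys_iff)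
  ultimately show "\<omega> \<in> chains j \<and> proj l \<omega> = \<omega>" by (auto simp: chains_def)
next
  assume *: "\<omega> \<in> chains j \<and> proj l \<omega> = \<omega>"
  show "\<omega> \<in> supported (B j l)"
    unfolding supported_def B_def
  proof (intro CollectI allI impI, clarify)
    fix S m assume m: "lk (\<omega> S) m \<noteq> 0"
    then have "\<omega> S \<noteq> 0" by auto
    moreover have "lk (proj l \<omega> S) m \<noteq> 0" using m * by simp
    ultimately show "S \<subseteq> I \<and> card S = j \<and> good l S m"
      using * by (auto simp: chains_def proj_def lookup_pfilter split: if_splits)
  qed
qed

lemma proj_chains: "\<omega> \<in> chains j \<Longrightarrow> proj l \<omega> \<in> supported (B j l)"
proof -
  assume "\<omega> \<in> chains j"
  moreover have "\<omega> S \<noteq> 0" if "proj l \<omega> S \<noteq> 0" for S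
    using that by (auto simp: proj_def poly_mapping_eq_iff lookup_pfilter fun_eq_iff split: if_splits)
  ultimately have "proj l \<omega> \<in> chains j" by (auto simp: chains_def)
  moreover have "proj l (proj l \<omega>) = proj l \<omega>"
    by (intro ext poly_mapping_eqI) (simp add: proj_def lookup_pfilter)
  ultimately show ?thesis by (simp add: supported_B)
qed

lemma d_supported: "\<omega> \<in> supported (B (Suc j) l) \<Longrightarrow> d \<omega> \<in> supported (B j l)"
  using d_chains[of \<omega> j] by (auto simp: supported_B proj_d)

text \<open>The graded component of a preimage from \<open>exact_chains\<close> is again a preimage,
  as \<open>proj\<close> commutes with \<open>d\<close>.\<close>

lemma exact_graded:
  assumes "z \<in> supported (B j l)" "0 < j" "d z = 0"
  shows "z \<in> d ` supported (B (Suc j) l)"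
proof -
  obtain y where y: "y \<in> chains (Suc j)" "z = d y"
    using exact_chains[of z j] assms by (auto simp: supported_B zero_fun_def)
  have "z = proj l z" using assms by (simp add: supported_B)
  also have "\<dots> = d (proj l y)" by (simp add: y proj_d)
  finally show ?thesis using proj_chains[OF y(1)] by blast
qed

lemma linear_d: "Vector_Spaces.linear fscale fscale d"
proof -
  have "d (a + b) = d a + d b" for a b
  proof
    show "d (a + b) S = (d a + d b) S" for S using d_add[of a b S] by (simp only: plus_fun_def)
  qed
  moreover have "d (fscale c a) = fscale c (d a)" for c a
    unfolding fscale_def by (rule ext) (rule d_mult)
  ultimately show ?thesis
    unfolding Vector_Spaces.linear_iff by (intro conjI allI forms.vector_space_axioms)
qed

definition rk :: "nat \<Rightarrow> rat \<Rightarrow> nat" where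
  "rk j l = forms.dim (d ` supported (B j l))"

text \<open>Rank and nullity of \<open>d\<close> in degree \<open>j\<close>, where exactness
  identifies the kernel with the image from degree \<open>Suc j\<close>.\<close>

lemma card_B: "0 < j \<Longrightarrow> card (B j l) = rk (Suc j) l + rk j l"
proof -
  assume j: "0 < j"
  have ker: "{x \<in> supported (B j l). d x = 0} = d ` supported (B (Suc j) l)"
    using exact_graded[OF _ j] by (auto simp: d_supported d_d fun_eq_iff)
  have "forms.dim (supported (B j l)) = forms.dim {x \<in> supported (B j l). d x = 0} + rk j l"
    unfolding rk_def
    by (rule forms.rank_nullity[of _ "fmon ` B j l", OF _ _ _ linear_d])
       (auto simp: finite_B fmon_basis(2)[symmetric])
  then show ?thesis unfolding dim_supported[OF finite_B] ker by (simp add: rk_def)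
qed

lemma rk_top: "card I < j \<Longrightarrow> rk j l = 0"
proof -
  assume "card I < j"
  then have "B j l = {}" by (auto simp: B_def) (metis card_mono finite leD)
  then have "supported (B j l) \<subseteq> {0}"
    by (auto simp: supported_def fun_eq_iff poly_mapping_eq_iff)
  then have "d ` supported (B j l) \<subseteq> {0}" by (auto simp: d_def fun_eq_iff)
  then show ?thesis unfolding rk_def
    using forms.dim_le_card[of "d ` supported (B j l)" "{}"] by simp
qed

definition euler :: "rat \<Rightarrow> int" where
  "euler l = (\<Sum>j\<le>card I. (-1) ^ j * int (card (B j l)))"

text \<open>By \<open>card_B\<close> all ranks cancel in the alternating sum except that of the map
  into degree 0, whose cokernel is the graded piece of the quotient by \<open>Jac\<close>.\<close>

lemma euler: "euler l = int (card (B 0 l)) - int (rk 1 l)"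
proof -
  have "(\<Sum>j\<le>n. (-1) ^ j * int (card (B j l))) = int (card (B 0 l)) - int (rk 1 l) + (-1) ^ n * int (rk (Suc n) l)" for n
    by (induction n) (auto simp: card_B algebra_simps)
  from this[of "card I"] show ?thesis by (simp add: euler_def rk_top)
qed

text \<open>In degree 0 the boundaries are the elements of \<open>Jac\<close>. The cofactors of
  \<open>p\<close> need not be homogeneous, but their graded components represent \<open>p\<close>
  as well.\<close>

lemma Jac_graded:
  assumes "Poly_Mapping.keys p \<subseteq> {m. good l {} m}"
  shows "p \<in> Jac \<longleftrightarrow> (\<lambda>S. if S = {} then p else 0) \<in> d ` supported (B 1 l)"
proof
  assume "p \<in> Jac"
  then obtain c where c: "p = (\<Sum>i\<in>I. c i * F i)" by (auto simp: Jac_def)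
  define y where "y S = (if \<exists>i\<in>I. S = {i} then c (the_elem S) else 0)" for S
  have "y \<in> chains 1" by (auto simp: chains_def y_def)
  moreover have "d y = (\<lambda>S. if S = {} then p else 0)"
  proof
    fix S
    show "d y S = (if S = {} then p else 0)"
    proof (cases "S = {}")
      case True
      then show ?thesis by (auto simp: d_def c y_def sg_def mult.commute intro!: sum.cong)
    next
      case False
      then have "y (insert i S) = 0" if "i \<notin> S" for i
        using that by (auto simp: y_def)
      then show ?thesis using False by (simp add: d_def)
    qed
  qed
  moreover have "proj l (\<lambda>S. if S = {} then p else 0) = (\<lambda>S. if S = {} then p else 0)"
    using assms by (auto simp: proj_def fun_eq_iff poly_mapping_eq_iff lookup_pfilter in_keys_iff)
  ultimately have "(\<lambda>S. if S = {} then p else 0) = d (proj l y)" by (metis proj_d)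
  then show "(\<lambda>S. if S = {} then p else 0) \<in> d ` supported (B 1 l)"
    using proj_chains[OF \<open>y \<in> chains 1\<close>] by blast
next
  assume "(\<lambda>S. if S = {} then p else 0) \<in> d ` supported (B 1 l)"
  then obtain y where y: "(\<lambda>S. if S = {} then p else 0) = d y" by blast
  have "d y {} = (\<Sum>i\<in>I. (sg i {} * y {i}) * F i)" by (simp add: d_def mult_ac)
  then have "p = (\<Sum>i\<in>I. (sg i {} * y {i}) * F i)" using fun_cong[OF y, of "{}"] by simp
  then show "p \<in> Jac" unfolding Jac_def
    by (intro CollectI exI[of _ "\<lambda>i. sg i {} * y {i}"]) simp
qed

lemma Jac_ideal:
  "p \<in> Jac \<Longrightarrow> r * p \<in> Jac" "p \<in> Jac \<Longrightarrow> q \<in> Jac \<Longrightarrow> p + q \<in> Jac" "p \<in> Jac \<Longrightarrow> q \<in> Jac \<Longrightarrow> p - q \<in> Jac" "0 \<in> Jac"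
proof -
  have *: "(\<Sum>i\<in>I. c i * F i) \<in> Jac" for c by (auto simp: Jac_def)
  show "p \<in> Jac \<Longrightarrow> r * p \<in> Jac"
  proof -
    assume "p \<in> Jac"
    then obtain c where "p = (\<Sum>i\<in>I. c i * F i)" by (auto simp: Jac_def)
    then show ?thesis using *[of "\<lambda>i. r * c i"] by (simp add: sum_distrib_left mult.assoc)
  qed
  show "p \<in> Jac \<Longrightarrow> q \<in> Jac \<Longrightarrow> p + q \<in> Jac" "p \<in> Jac \<Longrightarrow> q \<in> Jac \<Longrightarrow> p - q \<in> Jac"
  proof -
    assume "p \<in> Jac" "q \<in> Jac"
    then obtain c c' where "p = (\<Sum>i\<in>I. c i * F i)" "q = (\<Sum>i\<in>I. c' i * F i)" by (auto simp: Jac_def)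
    then show "p + q \<in> Jac" "p - q \<in> Jac" using *[of "\<lambda>i. c i + c' i"] *[of "\<lambda>i. c i - c' i"]
      by (simp_all add: distrib_right left_diff_distrib sum.distrib sum_subtractf)
  qed
  show "0 \<in> Jac" using *[of "\<lambda>_. 0"] by simp
qed

text \<open>The monomials of \<open>M\<close> are a basis of the graded piece of the quotient by
  \<open>Jac\<close>; their number is \<open>euler l\<close>, as \<open>rk 1 l\<close> is the
  dimension of the boundaries in degree 0.\<close>

theorem graded_basis:
  obtains M where "M \<subseteq> {m. good l {} m}" "finite M" "int (card M) = euler l"
    "\<And>p. Poly_Mapping.keys p \<subseteq> {m. good l {} m} \<Longrightarrow> \<exists>q. Poly_Mapping.keys q \<subseteq> M \<and> p - q \<in> Jac"
    "\<And>q. Poly_Mapping.keys q \<subseteq> M \<Longrightarrow> q \<in> Jac \<Longrightarrow> q = 0"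
proof -
  let ?J = "d ` supported (B 1 l)"
  let ?o = "\<lambda>p S. if S = {} then p else 0 :: 'n cpoly"
  have B0: "B 0 l = Pair {} ` {m. good l {} m}" by (auto simp: B_def)
  have JE: "?J \<subseteq> forms.span (fmon ` B 0 l)"
    unfolding fmon_basis(2)[OF finite_B] using d_supported[of _ 0 l] by auto
  have spanJ: "forms.span ?J = ?J"
  proof (rule forms.span_subspace[OF subset_refl forms.span_superset])
    have "forms.subspace (supported (B 1 l))"
      using forms.subspace_span[of "fmon ` B 1 l"] by (simp only: fmon_basis(2)[OF finite_B])
    then show "forms.subspace ?J"
      by (rule module_hom.subspace_image[OF iffD2[OF module_hom_iff_linear linear_d]])
  qed
  obtain E where E0: "E \<subseteq> fmon ` B 0 l" "card E + forms.dim ?J = card (fmon ` B 0 l)"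
    "\<And>v. v \<in> forms.span (fmon ` B 0 l) \<Longrightarrow> \<exists>q\<in>forms.span E. v - q \<in> forms.span ?J"
    "\<And>v. v \<in> forms.span E \<Longrightarrow> v \<in> forms.span ?J \<Longrightarrow> v = 0"
    by (rule forms.quotient_basis[OF fmon_basis(1)[OF finite_B] finite_imageI[OF finite_B] JE]) (rule that; blast)
  note E = E0[unfolded fmon_basis(2)[OF finite_B] spanJ rk_def[symmetric]]
  define M where "M = {m. fmon ({}, m) \<in> E}"
  have M: "M \<subseteq> {m. good l {} m}"
    using E(1) injD[OF inj_fmon] by (fastforce simp: M_def B0)
  have finM: "finite M" using finite_subset[OF M finite_good] .
  have EM: "E = fmon ` (Pair {} ` M)"
    using E(1) unfolding M_def B0 by blast
  have spE: "forms.span E = supported (Pair {} ` M)"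
    unfolding EM by (rule fmon_basis(2)) (use finM in simp)
  have cardE: "card E = card M"
    unfolding EM image_image
    by (rule card_image) (auto intro!: inj_onI dest: injD[OF inj_fmon])
  have o_supp: "?o p \<in> supported (Pair {} ` A) \<longleftrightarrow> Poly_Mapping.keys p \<subseteq> A" for p A
    by (auto simp: supported_def in_keys_iff subset_iff)
  have o_diff: "?o p - ?o q = ?o (p - q)" for p q by (auto simp: fun_eq_iff)
  show ?thesis
  proof
    show "M \<subseteq> {m. good l {} m}" "finite M" by fact+
    have "card (fmon ` B 0 l) = card (B 0 l)"
      by (rule card_image) (auto intro: inj_on_subset[OF inj_fmon])
    then show "int (card M) = euler l" using E(2) by (simp add: euler cardE)
  next
    fix p :: "'n cpoly" assume p: "Poly_Mapping.keys p \<subseteq> {m. good l {} m}"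
    then have "?o p \<in> supported (B 0 l)" unfolding B0 o_supp .
    then obtain v where v: "v \<in> supported (Pair {} ` M)" "?o p - v \<in> ?J"
      using E(3) unfolding spE by blast
    have "v = ?o (v {})"
      using v(1) by (intro ext poly_mapping_eqI) (auto simp: supported_def)
    then obtain q where q: "v = ?o q" by blast
    have keys: "Poly_Mapping.keys q \<subseteq> M" using v(1) unfolding q o_supp .
    have "Poly_Mapping.keys (p - q) \<subseteq> {m. good l {} m}"
      using keys_diff[of p q] p keys M by auto
    then have "p - q \<in> Jac" using v(2) unfolding q o_diff by (simp add: Jac_graded)
    with keys show "\<exists>q. Poly_Mapping.keys q \<subseteq> M \<and> p - q \<in> Jac" by blast
  next
    fix q assume q: "Poly_Mapping.keys q \<subseteq> M" "q \<in> Jac"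
    then have A: "?o q \<in> ?J" using M Jac_graded[of q l] by auto
    have B: "?o q \<in> forms.span E" unfolding spE o_supp by (rule q)
    from fun_cong[OF E(4)[OF B A], of "{}"] show "q = 0" by simp
  qed
qed

text \<open>A monomial divisible by some \<open>X i ^ expo i\<close> lies in \<open>Jac\<close> and
  cannot belong to a basis, so basis monomials stay in a finite box and only their weights
  occur.\<close>

lemma finite_euler: "finite {l. euler l \<noteq> 0}"
proof (rule finite_subset)
  let ?A = "{m. \<forall>i. lk m i \<le> (if i \<in> I then expo i else 0)}"
  show "{l. euler l \<noteq> 0} \<subseteq> wtf {} ` ?A"
  proof
    fix l assume "l \<in> {l. euler l \<noteq> 0}"
    moreover obtain M where M: "M \<subseteq> {m. good l {} m}" "int (card M) = euler l"
      "\<And>q. Poly_Mapping.keys q \<subseteq> M \<Longrightarrow> q \<in> Jac \<Longrightarrow> q = 0"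
      using graded_basis[of l] by metis
    ultimately have "M \<noteq> {}" by auto
    then obtain m where m: "m \<in> M" by blast
    have "\<not> expo i \<le> lk m i" if i: "i \<in> I" for i
    proof
      assume "expo i \<le> lk m i"
      then have "m = (m - Poly_Mapping.single i (expo i)) + Poly_Mapping.single i (expo i)"
        by (intro poly_mapping_eqI) (auto simp: lookup_add lookup_minus lookup_single when_def)
      then have "Poly_Mapping.single m 1 = Poly_Mapping.single (m - Poly_Mapping.single i (expo i)) 1 * X i ^ expo i"
        by (simp add: X_power mult_single)
      also have "\<dots> \<in> Jac" by (intro Jac_ideal expo i)
      finally have "Poly_Mapping.single m (1 :: complex) = 0" using m by (intro M(3)) auto
      then have "lk (Poly_Mapping.single m (1 :: complex)) m = 0" by simp
      then show False by simp
    qed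
    moreover have "Poly_Mapping.keys m \<subseteq> I" using m M(1) by (auto simp: good_def)
    then have "lk m i = 0" if "i \<notin> I" for i
      using that by (metis in_keys_iff subsetD)
    ultimately have "m \<in> ?A" by (auto simp: not_le less_imp_le)
    moreover have "l = wtf {} m" using m M(1) by (auto simp: good_def)
    ultimately show "l \<in> wtf {} ` ?A" by blast
  qed
qed (intro finite_imageI finite_bounded_monomials)

text \<open>Chains are regrouped by index set, because for a fixed \<open>S\<close> the generating
  function over the monomials is computed from geometric series.\<close>

lemma euler_eq: "euler l = (\<Sum>S\<in>Pow I. (-1) ^ card S * int (card {m. good l S m}))"
proof -
  have "card (B j l) = (\<Sum>S\<in>{S \<in> Pow I. card S = j}. card {m. good l S m})" for j
  proof -
    have "B j l = Sigma {S \<in> Pow I. card S = j} (\<lambda>S. {m. good l S m})" by (auto simp: B_def)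
    then show ?thesis using finite_good by simp
  qed
  then have "euler l = (\<Sum>j\<le>card I. \<Sum>S\<in>{S \<in> Pow I. card S = j}. (-1) ^ card S * int (card {m. good l S m}))"
    by (simp add: euler_def sum_distrib_left)
  also have "\<dots> = (\<Sum>S\<in>Pow I. (-1) ^ card S * int (card {m. good l S m}))"
    by (rule sum.group) (auto intro: card_mono)
  finally show ?thesis .
qed

end

section \<open>Second order expansions at zero\<close>

text \<open>One-sided from the left, because the product formula for the generating function is
  available for \<open>z < 0\<close>. The coefficient \<open>c\<close> is half a second
  derivative.\<close>

definition jet :: "(real \<Rightarrow> complex) \<Rightarrow> complex \<Rightarrow> complex \<Rightarrow> complex \<Rightarrow> bool" where
  "jet F a b c \<longleftrightarrow> ((\<lambda>z. (F z - (a + b * of_real z + c * (of_real z)\<^sup>2)) / (of_real z)\<^sup>2) \<longlongrightarrow> 0) (at_left 0)"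

lemma jet_poly: "jet (\<lambda>z. a + b * of_real z + c * (of_real z)\<^sup>2) a b c"
  by (simp add: jet_def)

lemma jet_const: "jet (\<lambda>_. a) a 0 0"
  using jet_poly[of a 0 0] by simp

lemma eventually_left_nz: "eventually (\<lambda>z::real. z \<noteq> 0) (at_left 0)"
  by (simp add: eventually_at_filter)

lemma jet_cong:
  assumes "eventually (\<lambda>z. F z = G z) (at_left 0)" "jet F a b c"
  shows "jet G a b c"
  using assms(2) unfolding jet_def
  by (rule Lim_transform_eventually) (use assms(1) in eventually_elim, simp)

lemma jet_eqI: "jet F a b c \<Longrightarrow> a = a' \<Longrightarrow> b = b' \<Longrightarrow> c = c' \<Longrightarrow> jet F a' b' c'"
  by simp

lemma jet_add:
  assumes "jet F a b c" "jet G a' b' c'"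
  shows "jet (\<lambda>z. F z + G z) (a + a') (b + b') (c + c')"
proof -
  have "((\<lambda>z. (F z - (a + b * of_real z + c * (of_real z)\<^sup>2)) / (of_real z)\<^sup>2 +
      (G z - (a' + b' * of_real z + c' * (of_real z)\<^sup>2)) / (of_real z)\<^sup>2) \<longlongrightarrow> 0 + 0) (at_left 0)"
    using assms unfolding jet_def by (rule tendsto_add)
  also have "(\<lambda>z. (F z - (a + b * of_real z + c * (of_real z)\<^sup>2)) / (of_real z)\<^sup>2 +
      (G z - (a' + b' * of_real z + c' * (of_real z)\<^sup>2)) / (of_real z)\<^sup>2) =
      (\<lambda>z. (F z + G z - (a + a' + (b + b') * of_real z + (c + c') * (of_real z)\<^sup>2)) / (of_real z)\<^sup>2)"
    unfolding add_divide_distrib[symmetric]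
    by (intro ext arg_cong2[where f = "(/)"] refl) (simp add: algebra_simps)
  finally show ?thesis unfolding jet_def by simp
qed

lemma jet_tendsto:
  assumes "jet F a b c"
  shows "(F \<longlongrightarrow> a) (at_left 0)"
proof -
  have "((\<lambda>z. (F z - (a + b * of_real z + c * (of_real z)\<^sup>2)) / (of_real z)\<^sup>2 * (of_real z)\<^sup>2
     + (a + b * of_real z + c * (of_real z)\<^sup>2)) \<longlongrightarrow> 0 * (of_real 0)\<^sup>2 + (a + b * of_real 0 + c * (of_real 0)\<^sup>2)) (at_left 0)"
    using assms unfolding jet_def by (intro tendsto_intros)
  then show ?thesis
    by (simp, elim Lim_transform_eventually) (use eventually_left_nz in eventually_elim, simp)
qed

lemma jet_mult:
  assumes F: "jet F a b c" and G: "jet G a' b' c'"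
  shows "jet (\<lambda>z. F z * G z) (a * a') (a * b' + b * a') (a * c' + b * b' + c * a')"
proof -
  define e where "e z = (F z - (a + b * of_real z + c * (of_real z)\<^sup>2)) / (of_real z)\<^sup>2" for z
  define d where "d z = (G z - (a' + b' * of_real z + c' * (of_real z)\<^sup>2)) / (of_real z)\<^sup>2" for z
  have "((\<lambda>z. e z * G z + (a + b * of_real z + c * (of_real z)\<^sup>2) * d z + of_real z * (b * c' + c * b') + (of_real z)\<^sup>2 * (c * c'))
     \<longlongrightarrow> 0 * a' + (a + b * of_real 0 + c * (of_real 0)\<^sup>2) * 0 + of_real 0 * (b * c' + c * b') + (of_real 0)\<^sup>2 * (c * c')) (at_left 0)"
    using F G jet_tendsto[OF G] unfolding jet_def e_def[symmetric] d_def[symmetric]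
    by (intro tendsto_intros)
  then have "((\<lambda>z. e z * G z + (a + b * of_real z + c * (of_real z)\<^sup>2) * d z + of_real z * (b * c' + c * b') + (of_real z)\<^sup>2 * (c * c'))
     \<longlongrightarrow> 0) (at_left 0)" by simp
  then show ?thesis unfolding jet_def
  proof (rule Lim_transform_eventually)
    show "\<forall>\<^sub>F z in at_left 0. e z * G z + (a + b * of_real z + c * (of_real z)\<^sup>2) * d z + of_real z * (b * c' + c * b') + (of_real z)\<^sup>2 * (c * c') =
        (F z * G z - (a * a' + (a * b' + b * a') * of_real z + (a * c' + b * b' + c * a') * (of_real z)\<^sup>2)) / (of_real z)\<^sup>2"
      using eventually_left_nz
    proof eventually_elim
      case (elim z)
      have "F z = a + b * of_real z + c * (of_real z)\<^sup>2 + e z * (of_real z)\<^sup>2"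
        "G z = a' + b' * of_real z + c' * (of_real z)\<^sup>2 + d z * (of_real z)\<^sup>2"
        using elim by (simp_all add: e_def d_def)
      then show ?case using elim
        by (simp add: eq_divide_eq) (simp add: algebra_simps power2_eq_square)
    qed
  qed
qed

lemma jet_cmult: "jet F a b c \<Longrightarrow> jet (\<lambda>z. k * F z) (k * a) (k * b) (k * c)"
  using jet_mult[OF jet_const[of k]] by simp

lemma jet_sum:
  assumes "finite A" "\<And>i. i \<in> A \<Longrightarrow> jet (F i) (a i) (b i) (c i)"
  shows "jet (\<lambda>z. \<Sum>i\<in>A. F i z) (\<Sum>i\<in>A. a i) (\<Sum>i\<in>A. b i) (\<Sum>i\<in>A. c i)"
  using assms by (induction A rule: finite_induct) (auto intro: jet_add jet_const)

text \<open>\<open>?R\<close> is the truncated inverse of the expansion of \<open>G\<close>. The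
  error of \<open>?R\<close> against \<open>inverse (G z)\<close> is that of
  \<open>?R z * G z\<close> against 1, up to the bounded factor
  \<open>- inverse (G z)\<close>.\<close>

lemma jet_inverse:
  assumes G: "jet G a b c" and a: "a \<noteq> 0"
  shows "jet (\<lambda>z. inverse (G z)) (1 / a) (- b / a\<^sup>2) (b\<^sup>2 / a ^ 3 - c / a\<^sup>2)"
proof -
  let ?R = "\<lambda>z. 1 / a + (- b / a\<^sup>2) * of_real z + (b\<^sup>2 / a ^ 3 - c / a\<^sup>2) * (of_real z)\<^sup>2"
  have RG: "jet (\<lambda>z. ?R z * G z) (1 / a * a) (1 / a * b + (- b / a\<^sup>2) * a)
      (1 / a * c + (- b / a\<^sup>2) * b + (b\<^sup>2 / a ^ 3 - c / a\<^sup>2) * a)"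
    by (rule jet_mult[OF jet_poly G])
  have "jet (\<lambda>z. ?R z * G z) 1 0 0"
    by (rule jet_eqI[OF RG]) (use a in \<open>simp_all add: field_simps power2_eq_square power3_eq_cube\<close>)
  then have "((\<lambda>z. (?R z * G z - 1) / (of_real z)\<^sup>2) \<longlongrightarrow> 0) (at_left 0)"
    by (simp add: jet_def)
  moreover have Ga: "(G \<longlongrightarrow> a) (at_left 0)" by (rule jet_tendsto[OF G])
  ultimately have "((\<lambda>z. - ((?R z * G z - 1) / (of_real z)\<^sup>2) * inverse (G z)) \<longlongrightarrow> - 0 * inverse a) (at_left 0)"
    using a by (intro tendsto_intros)
  then have *: "((\<lambda>z. - ((?R z * G z - 1) / (of_real z)\<^sup>2) * inverse (G z)) \<longlongrightarrow> 0) (at_left 0)" by simp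
  have "eventually (\<lambda>z. G z \<noteq> 0) (at_left 0)"
    using tendsto_imp_eventually_ne[OF Ga a] .
  with eventually_left_nz have "\<forall>\<^sub>F z in at_left 0. - ((?R z * G z - 1) / (of_real z)\<^sup>2) * inverse (G z) =
     (inverse (G z) - ?R z) / (of_real z)\<^sup>2"
  proof eventually_elim
    case (elim z)
    define R where "R = ?R z"
    have "- (R * G z - 1) * inverse (G z) = inverse (G z) - R"
      using elim by (simp add: algebra_simps)
    moreover have "- ((R * G z - 1) / (of_real z)\<^sup>2) * inverse (G z) =
        - (R * G z - 1) * inverse (G z) / (of_real z)\<^sup>2"
      by (simp only: minus_divide_left times_divide_eq_left)
    ultimately show ?case unfolding R_def[symmetric] by (simp only:)
  qed
  from Lim_transform_eventually[OF * this] show ?thesis by (simp add: jet_def)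
qed

lemma jet_diff:
  assumes "jet F a b c" "jet G a' b' c'"
  shows "jet (\<lambda>z. F z - G z) (a - a') (b - b') (c - c')"
  using jet_add[OF assms(1) jet_cmult[OF assms(2), of "-1"]] by simp

lemma jet_divide:
  assumes "jet F a b c" "jet G a' b' c'" "a' \<noteq> 0"
  shows "jet (\<lambda>z. F z / G z) (a * (1 / a')) (a * (- b' / a'\<^sup>2) + b * (1 / a'))
    (a * (b'\<^sup>2 / a' ^ 3 - c' / a'\<^sup>2) + b * (- b' / a'\<^sup>2) + c * (1 / a'))"
  unfolding divide_inverse[of "F _"] by (rule jet_mult[OF assms(1) jet_inverse[OF assms(2,3)]])

lemma jet_unique:
  assumes F: "jet F a b c" and G: "jet F a' b' c'"
  shows "a = a'" "b = b'" "c = c'"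
proof -
  have nb: "at_left (0::real) \<noteq> bot" by simp
  show a: "a = a'" using tendsto_unique[OF nb jet_tendsto[OF F] jet_tendsto[OF G]] .
  have lim: "((\<lambda>z. (F z - (a + b * of_real z + c * (of_real z)\<^sup>2)) / (of_real z)\<^sup>2 -
      (F z - (a' + b' * of_real z + c' * (of_real z)\<^sup>2)) / (of_real z)\<^sup>2) \<longlongrightarrow> 0 - 0) (at_left 0)"
    using F G unfolding jet_def by (rule tendsto_diff)
  have "((\<lambda>z. ((F z - (a + b * of_real z + c * (of_real z)\<^sup>2)) / (of_real z)\<^sup>2 -
      (F z - (a' + b' * of_real z + c' * (of_real z)\<^sup>2)) / (of_real z)\<^sup>2) * of_real z - (c' - c) * of_real z) \<longlongrightarrow>
      (0 - 0) * of_real 0 - (c' - c) * of_real 0) (at_left 0)"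
    by (intro tendsto_intros lim)
  then have "((\<lambda>z. b' - b) \<longlongrightarrow> 0) (at_left (0::real))"
    by (simp, elim Lim_transform_eventually)
       (use eventually_left_nz in eventually_elim, simp add: a field_simps power2_eq_square)
  then show b: "b = b'" using tendsto_unique[OF nb tendsto_const[of "b' - b"]] by fastforce
  have "((\<lambda>z. c' - c) \<longlongrightarrow> 0) (at_left (0::real))"
    using lim
    by (simp, elim Lim_transform_eventually)
       (use eventually_left_nz in eventually_elim, simp add: a b field_simps)
  then show "c = c'" using tendsto_unique[OF nb tendsto_const[of "c' - c"]] by fastforce
qed

lemma jet_of_real:
  assumes "((\<lambda>z. (f z - (a + b * z + c * z\<^sup>2)) / z\<^sup>2) \<longlongrightarrow> 0) (at_left 0)"
  shows "jet (\<lambda>z. of_real (f z)) (of_real a) (of_real b) (of_real c)"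
  using tendsto_of_real[OF assms, where 'a = complex] by (simp add: jet_def)

lemma exp_remainder:
  fixes a :: real
  shows "((\<lambda>z. (exp (a * z) - (1 + a * z + a * a / 2 * z\<^sup>2)) / z\<^sup>2) \<longlongrightarrow> 0) (at_left 0)"
    "((\<lambda>z. ((exp (a * z) - 1) / z - (a + a * a / 2 * z + a * a * a / 6 * z\<^sup>2)) / z\<^sup>2) \<longlongrightarrow> 0) (at_left 0)"
  by real_asymp+

lemma jet_exp: "jet (\<lambda>z. of_real (exp (a * z))) 1 (of_real a) ((of_real a)\<^sup>2 / 2)"
  using jet_of_real[OF exp_remainder(1)[of a]] by (simp add: power2_eq_square)

lemma jet_expm1: "jet (\<lambda>z. of_real ((exp (a * z) - 1) / z)) (of_real a) ((of_real a)\<^sup>2 / 2) ((of_real a) ^ 3 / 6)"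
  by (rule jet_eqI[OF jet_of_real[OF exp_remainder(2)[of a]]]) (simp_all add: power2_eq_square power3_eq_cube)

definition factor :: "real \<Rightarrow> complex \<Rightarrow> real \<Rightarrow> complex" where
  "factor w h z = (h * of_real (exp (w * z)) - of_real (exp z)) / (1 - h * of_real (exp (w * z)))"

text \<open>The factor of one variable together with its share of the age shift and of the centring:
  \<open>Arg2pi g / (2 * pi)\<close> is its summand in the age, \<open>- 1 / 2\<close> its part of
  \<open>- n / 2\<close>.\<close>

definition cfactor :: "real \<Rightarrow> complex \<Rightarrow> complex \<Rightarrow> real \<Rightarrow> complex" where
  "cfactor w g h z = (if g \<noteq> 1 then - of_real (exp ((Arg2pi g / (2 * pi) - 1 / 2) * z))
     else of_real (exp (- 1 / 2 * z)) * factor w h z)"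

lemma jet_cfactor:
  assumes w: "w > 0"
  shows "jet (cfactor w g h) (cval w g h) (cval w g h * lval g h)
    (cval w g h * ((lval g h)\<^sup>2 + qval w g h) / 2)"
proof -
  consider "g \<noteq> 1" | "g = 1" "h \<noteq> 1" | "g = 1" "h = 1" by blast
  then show ?thesis
  proof cases
    case 1
    then have "saw g = of_real (Arg2pi g / (2 * pi) - 1 / 2)" by (simp add: saw_def)
    then show ?thesis
      using 1 jet_cmult[OF jet_exp[of "Arg2pi g / (2 * pi) - 1 / 2"], of "-1"]
      by (simp add: cfactor_def[abs_def] cval_def lval_def qval_def)
  next
    case 2
    define W where "W = complex_of_real w"
    have E: "jet (\<lambda>z. complex_of_real (exp z)) 1 1 (1 / 2)" using jet_exp[of 1] by simp
    have hE: "jet (\<lambda>z. h * of_real (exp (w * z))) (h * 1) (h * W) (h * (W\<^sup>2 / 2))"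
      unfolding W_def by (rule jet_cmult[OF jet_exp])
    have h: "1 - h * 1 \<noteq> 0" using 2 by auto
    \<comment> \<open>In terms of \<open>u\<close> all denominators are powers of \<open>u\<close>,
      and the coefficients can be compared as rational functions.\<close>
    define u where "u = 1 - h"
    have hu: "h = 1 - u" "u \<noteq> 0" using h by (auto simp: u_def)
    note J = jet_mult[OF jet_exp[of "- 1 / 2"] jet_divide[OF jet_diff[OF hE E] jet_diff[OF jet_const[of 1] hE] h]]
    have c: "cfactor w g h = (\<lambda>z. of_real (exp (- 1 / 2 * z)) *
        ((h * of_real (exp (w * z)) - of_real (exp z)) / (1 - h * of_real (exp (w * z)))))"
      using 2 by (intro ext) (simp only: cfactor_def factor_def if_False not_True_eq_False simp_thms)
    have v: "cval w g h = - 1" "lval g h = 1 / u - 1 / 2" "qval w g h = (2 * W - 1) * ((1 - u) / u\<^sup>2)"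
      using 2 by (simp_all add: cval_def lval_def ell_def saw_def qval_def u_def W_def)
    show ?thesis
      unfolding c v
      by (rule jet_eqI[OF J]; unfold hu(1)) (use hu(2) in \<open>simp_all add: field_simps power2_eq_square power3_eq_cube\<close>)
  next
    case 3
    define W where "W = complex_of_real w"
    have W: "W \<noteq> 0" "0 - W \<noteq> 0" using w by (auto simp: W_def)
    \<comment> \<open>Here numerator and denominator of \<open>factor\<close> both vanish at 0, so
      both are divided by \<open>z\<close>; this is why the expansion of the exponential is needed
      up to order 3.\<close>
    let ?E = "\<lambda>\<alpha> z. complex_of_real ((exp (\<alpha> * z) - 1) / z)"
    have E: "jet (?E 1) 1 (1 / 2) (1 / 6)" using jet_expm1[of 1] by simp
    have wE: "jet (?E w) W (W\<^sup>2 / 2) (W ^ 3 / 6)" unfolding W_def by (rule jet_expm1)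
    note J = jet_mult[OF jet_exp[of "- 1 / 2"] jet_divide[OF jet_diff[OF wE E] jet_diff[OF jet_const[of 0] wE] W(2)]]
    have ev: "\<forall>\<^sub>F z in at_left 0. of_real (exp (- 1 / 2 * z)) * ((?E w z - ?E 1 z) / (0 - ?E w z)) = cfactor w g h z"
      using eventually_left_nz
    proof eventually_elim
      case (elim z)
      have *: "((a - 1) / y - (b - 1) / y) / (0 - (a - 1) / y) = (a - b) / (1 - a)"
        if "a \<noteq> 1" "y \<noteq> 0" for a b y :: complex
        using that by (simp add: field_simps)
      have "complex_of_real (exp (w * z)) \<noteq> 1" using elim w by simp
      from *[OF this, of "of_real z" "of_real (exp z)"] show ?case
        using 3 elim by (simp add: cfactor_def factor_def)
    qed
    have v: "cval w g h = (1 - W) / W" "lval g h = 0" "qval w g h = (1 - 2 * W) / 12"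
      using 3 by (simp_all add: cval_def lval_def ell_def saw_def qval_def W_def)
    show ?thesis
      unfolding v
      by (rule jet_eqI[OF jet_cong[OF ev J]])
         (use W in \<open>simp_all add: field_simps power2_eq_square power3_eq_cube\<close>)
  qed
qed

text \<open>\<open>l i\<close> and \<open>e i\<close> play the role of first and second logarithmic
  derivatives at 0, hence are additive. Coefficients that are multiples of \<open>c i\<close> avoid
  logarithms and cover \<open>c i = 0\<close>, which occurs for weight 1.\<close>

lemma jet_prod:
  assumes "finite A" "\<And>i. i \<in> A \<Longrightarrow> jet (F i) (c i) (c i * l i) (c i * ((l i)\<^sup>2 + e i) / 2)"
  shows "jet (\<lambda>z. \<Prod>i\<in>A. F i z) (\<Prod>i\<in>A. c i) ((\<Prod>i\<in>A. c i) * (\<Sum>i\<in>A. l i))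
    ((\<Prod>i\<in>A. c i) * ((\<Sum>i\<in>A. l i)\<^sup>2 + (\<Sum>i\<in>A. e i)) / 2)"
  using assms
proof (induction A rule: finite_induct)
  case empty
  show ?case using jet_const[of 1] by simp
next
  case (insert i A)
  have 1: "jet (F i) (c i) (c i * l i) (c i * ((l i)\<^sup>2 + e i) / 2)" using insert.prems by simp
  have 2: "jet (\<lambda>z. \<Prod>i\<in>A. F i z) (\<Prod>i\<in>A. c i) ((\<Prod>i\<in>A. c i) * (\<Sum>i\<in>A. l i))
    ((\<Prod>i\<in>A. c i) * ((\<Sum>i\<in>A. l i)\<^sup>2 + (\<Sum>i\<in>A. e i)) / 2)" using insert by simp
  have "jet (\<lambda>z. \<Prod>i\<in>insert i A. F i z) (c i * (\<Prod>i\<in>A. c i))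
     (c i * (\<Prod>i\<in>A. c i) * (l i + (\<Sum>i\<in>A. l i)))
     (c i * (\<Prod>i\<in>A. c i) * ((l i + (\<Sum>i\<in>A. l i))\<^sup>2 + (e i + (\<Sum>i\<in>A. e i))) / 2)"
    using insert.hyps
    by (simp, intro jet_eqI[OF jet_mult[OF 1 2]]) (simp_all add: field_simps power2_eq_square)
  then show ?case using insert.hyps by simp
qed

section \<open>The equivariant Poincare series\<close>

text \<open>A finite set of exponent functions lies in a box, over which the sum factors into
  partial sums of geometric series.\<close>

lemma summable_on_prod_PiE:
  fixes r :: "'i \<Rightarrow> real"
  assumes I: "finite I" and r: "\<And>i. i \<in> I \<Longrightarrow> 0 \<le> r i \<and> r i < 1"
  shows "(\<lambda>k. \<Prod>i\<in>I. r i ^ (k i + 1)) summable_on (\<Pi>\<^sub>E i\<in>I. (UNIV :: nat set))"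
proof (rule nonneg_bdd_above_summable_on)
  show "(\<Prod>i\<in>I. r i ^ (k i + 1)) \<ge> 0" for k
    using r by (intro prod_nonneg) auto
  show "bdd_above (sum (\<lambda>k. \<Prod>i\<in>I. r i ^ (k i + 1)) ` {F. F \<subseteq> (\<Pi>\<^sub>E i\<in>I. UNIV) \<and> finite F})"
  proof (rule bdd_aboveI2)
    fix F :: "('i \<Rightarrow> nat) set" assume "F \<in> {F. F \<subseteq> (\<Pi>\<^sub>E i\<in>I. UNIV) \<and> finite F}"
    then have F: "F \<subseteq> (\<Pi>\<^sub>E i\<in>I. UNIV)" "finite F" by auto
    define B where "B i = (\<lambda>k. k i) ` F" for i
    have finB: "finite (B i)" for i using F by (simp add: B_def)
    have sub: "F \<subseteq> (\<Pi>\<^sub>E i\<in>I. B i)"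
    proof
      fix k assume "k \<in> F"
      then show "k \<in> (\<Pi>\<^sub>E i\<in>I. B i)" using F(1) unfolding PiE_def B_def by blast
    qed
    have "(\<Sum>k\<in>F. \<Prod>i\<in>I. r i ^ (k i + 1)) \<le> (\<Sum>k\<in>(\<Pi>\<^sub>E i\<in>I. B i). \<Prod>i\<in>I. r i ^ (k i + 1))"
      using I finB sub r by (intro sum_mono2 finite_PiE prod_nonneg) auto
    also have "\<dots> = (\<Prod>i\<in>I. \<Sum>k\<in>B i. r i ^ (k + 1))"
      using I finB by (subst prod_sum_PiE) auto
    also have "\<dots> \<le> (\<Prod>i\<in>I. suminf (\<lambda>k. r i ^ (k + 1)))"
    proof (rule prod_mono, intro conjI)
      fix i assume i: "i \<in> I"
      show "0 \<le> (\<Sum>k\<in>B i. r i ^ (k + 1))" using r[OF i] by (intro sum_nonneg) auto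
      have "summable (\<lambda>k. r i ^ (k + 1))"
        using r[OF i] by (auto intro!: summable_mult summable_geometric)
      then show "(\<Sum>k\<in>B i. r i ^ (k + 1)) \<le> suminf (\<lambda>k. r i ^ (k + 1))"
        using r[OF i] finB by (intro sum_le_suminf) auto
    qed
    finally show "(\<Sum>k\<in>F. \<Prod>i\<in>I. r i ^ (k i + 1)) \<le> (\<Prod>i\<in>I. suminf (\<lambda>k. r i ^ (k + 1)))" .
  qed
qed

text \<open>A product of geometric series, expanded by absolute convergence; the shift by 1 in the
  exponents accounts for \<open>dx_I\<close>.\<close>

lemma has_sum_monomials:
  fixes a :: "'n::finite \<Rightarrow> complex"
  assumes a: "\<And>i. i \<in> I \<Longrightarrow> norm (a i) < 1"
  shows "((\<lambda>m. \<Prod>i\<in>I. a i ^ (lk m i + 1)) has_sum (\<Prod>i\<in>I. a i / (1 - a i))) {m. Poly_Mapping.keys m \<subseteq> I}"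
proof -
  have fin: "finite I" by simp
  have geo: "((\<lambda>k. a i ^ (k + 1)) has_sum (a i / (1 - a i))) UNIV"
    and geo_abs: "(\<lambda>k. norm (a i ^ (k + 1))) summable_on UNIV" if i: "i \<in> I" for i
  proof -
    have s: "summable (\<lambda>k. norm (a i ^ (k + 1)))"
      using a[OF i] by (auto simp: norm_power norm_mult intro!: summable_mult summable_geometric)
    have "(\<lambda>k. a i * a i ^ k) sums (a i * (1 / (1 - a i)))"
      using a[OF i] by (intro sums_mult geometric_sums)
    then have "(\<lambda>k. a i ^ (k + 1)) sums (a i / (1 - a i))" by simp
    with s show "((\<lambda>k. a i ^ (k + 1)) has_sum (a i / (1 - a i))) UNIV"
      by (rule norm_summable_imp_has_sum)
    show "(\<lambda>k. norm (a i ^ (k + 1))) summable_on UNIV"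
      using s by (subst summable_on_UNIV_nonneg_real_iff) auto
  qed
  let ?P = "\<Pi>\<^sub>E i\<in>I. (UNIV :: nat set)"
  have "(\<lambda>k. \<Prod>i\<in>I. norm (a i) ^ (k i + 1)) summable_on ?P"
    using a by (intro summable_on_prod_PiE) auto
  then have "(\<lambda>k. norm (\<Prod>i\<in>I. a i ^ (k i + 1))) summable_on ?P"
    by (simp add: prod_norm[symmetric] norm_power norm_mult)
  then have "(\<lambda>k. \<Prod>i\<in>I. a i ^ (k i + 1)) summable_on ?P"
    by (rule abs_summable_summable)
  then have "((\<lambda>k. \<Prod>i\<in>I. a i ^ (k i + 1)) has_sum (\<Sum>\<^sub>\<infinity>k\<in>?P. \<Prod>i\<in>I. a i ^ (k i + 1))) ?P"
    by (rule has_sum_infsum)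
  also have "(\<Sum>\<^sub>\<infinity>k\<in>?P. \<Prod>i\<in>I. a i ^ (k i + 1)) = (\<Prod>i\<in>I. a i / (1 - a i))"
    using geo by (subst infsum_prod_PiE_abs[OF fin geo_abs]) (auto intro!: prod.cong infsumI)
  finally have "((\<lambda>k. \<Prod>i\<in>I. a i ^ (k i + 1)) has_sum (\<Prod>i\<in>I. a i / (1 - a i))) ?P" .
  note sum_PiE = this
  have bij: "bij_betw (\<lambda>m. restrict (lk m) I) {m. Poly_Mapping.keys m \<subseteq> I} ?P"
  proof (rule bij_betwI[of _ _ _ "\<lambda>k. Abs_poly_mapping (\<lambda>i. if i \<in> I then k i else 0)"])
    show "(\<lambda>k. Abs_poly_mapping (\<lambda>i. if i \<in> I then k i else 0)) \<in> ?P \<rightarrow> {m. Poly_Mapping.keys m \<subseteq> I}"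
      by (auto simp: in_keys_iff split: if_splits)
  next
    fix m assume "m \<in> {m :: 'n monomial. Poly_Mapping.keys m \<subseteq> I}"
    then show "Abs_poly_mapping (\<lambda>i. if i \<in> I then restrict (lk m) I i else 0) = m"
      by (intro poly_mapping_eqI) (auto simp: in_keys_iff)
  qed (auto simp: fun_eq_iff PiE_def extensional_def)
  have "((\<lambda>m. \<Prod>i\<in>I. a i ^ (restrict (lk m) I i + 1)) has_sum (\<Prod>i\<in>I. a i / (1 - a i)))
      {m. Poly_Mapping.keys m \<subseteq> I}"
    using has_sum_reindex_bij_betw[OF bij, of "\<lambda>k. \<Prod>i\<in>I. a i ^ (k i + 1)"] sum_PiE by blast
  moreover have "(\<Prod>i\<in>I. a i ^ (restrict (lk m) I i + 1)) = (\<Prod>i\<in>I. a i ^ (lk m i + 1))" for m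
    by (rule prod.cong) auto
  ultimately show ?thesis by simp
qed

lemma has_sum_finite_sum:
  fixes f :: "'a \<Rightarrow> 'b \<Rightarrow> 'c::topological_comm_monoid_add"
  assumes "finite S" "\<And>s. s \<in> S \<Longrightarrow> (f s has_sum a s) A"
  shows "((\<lambda>x. \<Sum>s\<in>S. f s x) has_sum (\<Sum>s\<in>S. a s)) A"
  using assms by (induction S rule: finite_induct) (auto intro: has_sum_add)

text \<open>Shifting the sum by an element \<open>k\<close> with \<open>\<psi> k \<noteq> 1\<close>
  multiplies it by \<open>\<psi> k\<close>.\<close>

lemma (in diag_group) sum_character:
  assumes hom: "\<And>g h. g \<in> H \<Longrightarrow> h \<in> H \<Longrightarrow> \<psi> (\<lambda>i. g i * h i) = \<psi> g * (\<psi> h :: complex)"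
  shows "(\<Sum>h\<in>H. \<psi> h) = (if \<forall>h\<in>H. \<psi> h = 1 then of_nat (card H) else 0)"
proof (cases "\<forall>h\<in>H. \<psi> h = 1")
  case False
  then obtain k where k: "k \<in> H" "\<psi> k \<noteq> 1" by auto
  have "(\<Sum>h\<in>H. \<psi> h) = \<psi> k * (\<Sum>h\<in>H. \<psi> h)"
    using sum_shift[OF k(1), of \<psi>] hom[OF k(1)] by (simp add: sum_distrib_left)
  then have "(\<Sum>h\<in>H. \<psi> h) = 0" using k by simp
  then show ?thesis by (simp only: False if_False)
qed simp

context graded_jacobian
begin

text \<open>Molien's formula for the Euler characteristic: the average over \<open>H\<close> selects
  the trivial character, geometric series count monomials by weight, and the alternating sum over
  \<open>S\<close> turns into a product of the \<open>1 - b h i\<close>. For \<open>z < 0\<close>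
  the series converge.\<close>

theorem poincare_series:
  assumes z: "z < 0"
  shows "(\<Sum>l | euler l \<noteq> 0. of_int (euler l) * of_real (exp (of_rat l * z))) =
    (\<Sum>h\<in>H. \<Prod>i\<in>I. factor (of_rat (w i)) (h i) z) / of_nat (card H)"
proof -
  interpret H: diag_group H by (rule H)
  define E where "E l = complex_of_real (exp (of_rat l * z))" for l
  have E_add: "E (l + l') = E l * E l'" for l l'
    by (simp add: E_def of_rat_add distrib_right exp_add)
  have E0: "E 0 = 1" by (simp add: E_def)
  have E_sum: "E (sum l A) = (\<Prod>i\<in>A. E (l i))" for l :: "'n \<Rightarrow> rat" and A
    by (induction A rule: infinite_finite_induct) (auto simp: E_add E0)
  have E_mult: "E (l * of_nat k) = E l ^ k" for l k
  proof -
    have "E (l * of_nat k) = of_real (exp (of_nat k * (of_rat l * z)))"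
      by (simp add: E_def of_rat_mult mult_ac)
    then show ?thesis by (simp only: exp_of_nat_mult E_def of_real_power)
  qed
  \<comment> \<open>\<open>a h i\<close> records weight and character of the variable
    \<open>i\<close>, and \<open>b h i\<close> those of its basis vector in the Koszul
    complex.\<close>
  define a where "a h i = h i * E (w i)" for h i
  define b where "b h i = inverse (h i) * E (1 - w i)" for h i
  have norm_a: "norm (a h i) < 1" if "h \<in> H" for h i
    using H.norm_eq_1[OF that, of i] w[of i] z
    by (simp add: a_def norm_mult E_def mult_pos_neg)
  have ab: "(\<Prod>i\<in>I. a h i ^ (lk m i + 1)) * (\<Prod>i\<in>S. b h i) = chi h S m * E (wtf S m)" for h S m
  proof -
    have "E (wtf S m) = (\<Prod>i\<in>I. E (w i) ^ (lk m i + 1)) * (\<Prod>i\<in>S. E (1 - w i))"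
      unfolding wtf_def E_add E_sum using E_mult[of "w _" "lk m _ + 1"] by (simp add: add.commute)
    then show ?thesis
      by (simp add: a_def b_def chi_def power_mult_distrib prod.distrib mult_ac)
  qed
  define V where "V S = (\<Sum>h\<in>H. (\<Prod>i\<in>I. a h i / (1 - a h i)) * (\<Prod>i\<in>S. b h i)) / of_nat (card H)" for S
  have sum1: "((\<lambda>m. if \<forall>h\<in>H. chi h S m = 1 then E (wtf S m) else 0) has_sum V S) {m. Poly_Mapping.keys m \<subseteq> I}" for S
  proof -
    have "((\<lambda>m. \<Sum>h\<in>H. (\<Prod>i\<in>I. a h i ^ (lk m i + 1)) * (\<Prod>i\<in>S. b h i)) has_sum
        (\<Sum>h\<in>H. (\<Prod>i\<in>I. a h i / (1 - a h i)) * (\<Prod>i\<in>S. b h i))) {m. Poly_Mapping.keys m \<subseteq> I}"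
      by (intro has_sum_finite_sum has_sum_cmult_left has_sum_monomials norm_a H.fin)
    then have "((\<lambda>m. (\<Sum>h\<in>H. (\<Prod>i\<in>I. a h i ^ (lk m i + 1)) * (\<Prod>i\<in>S. b h i)) * (1 / of_nat (card H))) has_sum
        (\<Sum>h\<in>H. (\<Prod>i\<in>I. a h i / (1 - a h i)) * (\<Prod>i\<in>S. b h i)) * (1 / of_nat (card H))) {m. Poly_Mapping.keys m \<subseteq> I}"
      by (rule has_sum_cmult_left)
    moreover have "(\<Sum>h\<in>H. (\<Prod>i\<in>I. a h i ^ (lk m i + 1)) * (\<Prod>i\<in>S. b h i)) * (1 / of_nat (card H)) =
        (if \<forall>h\<in>H. chi h S m = 1 then E (wtf S m) else 0)" for m
    proof -
      have "(\<Sum>h\<in>H. chi h S m) = (if \<forall>h\<in>H. chi h S m = 1 then of_nat (card H) else 0)"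
        by (rule H.sum_character)
           (simp add: chi_def power_mult_distrib prod.distrib mult_ac)
      then show ?thesis
        unfolding ab using H.card_pos by (simp flip: sum_distrib_right)
    qed
    ultimately show ?thesis by (simp add: V_def)
  qed
  \<comment> \<open>The monomials are regrouped by weight \<open>l\<close>, finitely many for
    each.\<close>
  have sum2: "((\<lambda>l. of_nat (card {m. good l S m}) * E l) has_sum V S) UNIV" for S
  proof -
    let ?M = "{m. Poly_Mapping.keys m \<subseteq> I \<and> (\<forall>h\<in>H. chi h S m = 1)}"
    let ?f = "\<lambda>(l :: rat, m :: 'n monomial). E l"
    have "((\<lambda>m. E (wtf S m)) has_sum V S) ?M"
      using sum1[of S] by (subst has_sum_cong_neutral[where T = "{m. Poly_Mapping.keys m \<subseteq> I}"
        and g = "\<lambda>m. if \<forall>h\<in>H. chi h S m = 1 then E (wtf S m) else 0"]) auto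
    then have "((?f \<circ> (\<lambda>m. (wtf S m, m))) has_sum V S) ?M" by (simp add: o_def)
    then have "(?f has_sum V S) ((\<lambda>m. (wtf S m, m)) ` ?M)"
      by (subst has_sum_reindex) (auto intro: inj_onI)
    also have "(\<lambda>m. (wtf S m, m)) ` ?M = Sigma UNIV (\<lambda>l. {m. good l S m})"
      by (auto simp: good_def)
    finally show ?thesis
      by (rule has_sum_SigmaD) (auto intro!: has_sum_finiteI finite_good)
  qed
  let ?L = "{l. euler l \<noteq> 0}"
  have "((\<lambda>l. \<Sum>S\<in>Pow I. (- 1) ^ card S * (of_nat (card {m. good l S m}) * E l)) has_sum
      (\<Sum>S\<in>Pow I. (- 1) ^ card S * V S)) UNIV"
    by (intro has_sum_finite_sum has_sum_cmult_right sum2) auto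
  moreover have "(\<Sum>S\<in>Pow I. (- 1) ^ card S * (of_nat (card {m. good l S m}) * E l)) = of_int (euler l) * E l" for l
    unfolding euler_eq of_int_sum sum_distrib_right by (intro sum.cong refl) simp
  ultimately have "((\<lambda>l. of_int (euler l) * E l) has_sum (\<Sum>S\<in>Pow I. (- 1) ^ card S * V S)) UNIV"
    by simp
  moreover have "((\<lambda>l. of_int (euler l) * E l) has_sum (\<Sum>l\<in>?L. of_int (euler l) * E l)) UNIV"
    using has_sum_finite[OF finite_euler, of "\<lambda>l. of_int (euler l) * E l"]
    by (subst has_sum_cong_neutral[where T = ?L and g = "\<lambda>l. of_int (euler l) * E l"]) auto
  ultimately have "(\<Sum>l\<in>?L. of_int (euler l) * E l) = (\<Sum>S\<in>Pow I. (- 1) ^ card S * V S)"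
    by (rule has_sum_unique[rotated])
  also have "\<dots> = (\<Sum>h\<in>H. (\<Prod>i\<in>I. a h i / (1 - a h i)) * (\<Sum>S\<in>Pow I. (- 1) ^ card S * (\<Prod>i\<in>S. b h i))) / of_nat (card H)"
    unfolding V_def sum_divide_distrib sum_distrib_left
    by (subst sum.swap) (simp add: mult_ac)
  also have "(\<Sum>h\<in>H. (\<Prod>i\<in>I. a h i / (1 - a h i)) * (\<Sum>S\<in>Pow I. (- 1) ^ card S * (\<Prod>i\<in>S. b h i))) =
      (\<Sum>h\<in>H. \<Prod>i\<in>I. factor (of_rat (w i)) (h i) z)"
  proof (rule sum.cong[OF refl])
    fix h assume h: "h \<in> H"
    have "(\<Sum>S\<in>Pow I. (- 1) ^ card S * (\<Prod>i\<in>S. b h i)) = (\<Prod>i\<in>I. 1 - b h i)"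
      using prod_diff_conv_sum[of I "\<lambda>_. 1" "b h"] by simp
    then have "(\<Prod>i\<in>I. a h i / (1 - a h i)) * (\<Sum>S\<in>Pow I. (- 1) ^ card S * (\<Prod>i\<in>S. b h i)) =
        (\<Prod>i\<in>I. a h i / (1 - a h i)) * (\<Prod>i\<in>I. 1 - b h i)"
      by (simp only:)
    also have "\<dots> = (\<Prod>i\<in>I. a h i / (1 - a h i) * (1 - b h i))"
      by (rule prod.distrib[symmetric])
    also have "\<dots> = (\<Prod>i\<in>I. factor (of_rat (w i)) (h i) z)"
    proof (rule prod.cong[OF refl])
      fix i
      \<comment> \<open>This product is free of \<open>h\<close> and of the weight, because a
        variable and the corresponding \<open>F i\<close> together have weight 1 and trivial
        character.\<close>
      have "a h i * b h i = E (w i) * E (1 - w i)"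
        using H.nz[OF h, of i] by (simp add: a_def b_def)
      also have "\<dots> = E (w i + (1 - w i))" by (simp only: E_add)
      finally have "a h i * b h i = E (w i + (1 - w i))" .
      then have ab: "a h i * b h i = of_real (exp z)" by (simp add: E_def)
      have "a h i / (1 - a h i) * (1 - b h i) = (a h i - a h i * b h i) / (1 - a h i)"
        by (simp add: right_diff_distrib diff_divide_distrib)
      also have "\<dots> = factor (of_rat (w i)) (h i) z"
        unfolding ab by (simp add: factor_def a_def E_def)
      finally show "a h i / (1 - a h i) * (1 - b h i) = factor (of_rat (w i)) (h i) z" .
    qed
    finally show "(\<Prod>i\<in>I. a h i / (1 - a h i)) * (\<Sum>S\<in>Pow I. (- 1) ^ card S * (\<Prod>i\<in>S. b h i)) =
        (\<Prod>i\<in>I. factor (of_rat (w i)) (h i) z)" .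
  qed
  finally show ?thesis by (simp add: E_def)
qed

end

section \<open>Quotients and dimensions of modules\<close>

lemma complex_field_simps [simp]:
  "carrier complex_field = UNIV" "a \<otimes>\<^bsub>complex_field\<^esub> b = a * b" "a \<oplus>\<^bsub>complex_field\<^esub> b = a + b"
  "\<one>\<^bsub>complex_field\<^esub> = 1" "\<zero>\<^bsub>complex_field\<^esub> = 0"
  by (simp_all add: complex_field_def)

lemma cring_complex_field: "cring complex_field"
proof (rule cringI)
  show "abelian_group complex_field"
    by (rule abelian_groupI) (auto intro: exI[of _ "- x" for x])
  show "comm_monoid complex_field"
    by (rule comm_monoidI) auto
qed (auto simp: algebra_simps)

lemma field_complex_field: "field complex_field"
proof (rule cring.cring_fieldI[OF cring_complex_field])
  have "\<exists>y. y * x = 1 \<and> x * y = 1" if "x \<noteq> 0" for x :: complex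
    using that by (intro exI[of _ "inverse x"]) auto
  then show "Units complex_field = carrier complex_field - {\<zero>\<^bsub>complex_field\<^esub>}"
    by (auto simp: Units_def)
qed

text \<open>The module axioms are transported along a surjection, which spares checking them on
  cosets and on direct sums.\<close>

lemma module_image:
  assumes M: "module R M" and surj: "f ` carrier M = carrier N"
    and add: "\<And>x y. x \<in> carrier M \<Longrightarrow> y \<in> carrier M \<Longrightarrow> f (x \<oplus>\<^bsub>M\<^esub> y) = f x \<oplus>\<^bsub>N\<^esub> f y"
    and smult: "\<And>c x. c \<in> carrier R \<Longrightarrow> x \<in> carrier M \<Longrightarrow> f (c \<odot>\<^bsub>M\<^esub> x) = c \<odot>\<^bsub>N\<^esub> f x"
    and zero: "f \<zero>\<^bsub>M\<^esub> = \<zero>\<^bsub>N\<^esub>"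
  shows "module R N"
proof -
  interpret M: module R M by (rule M)
  have ex: "\<exists>x\<in>carrier M. y = f x" if "y \<in> carrier N" for y using that surj by auto
  have cl: "f x \<in> carrier N" if "x \<in> carrier M" for x using that surj by auto
  show ?thesis
  proof (rule module_criteria)
    show "cring R" by (rule M.R.is_cring)
    show "\<zero>\<^bsub>N\<^esub> \<in> carrier N" using cl[OF M.zero_closed] zero by simp
    show "\<forall>v w. v \<in> carrier N \<and> w \<in> carrier N \<longrightarrow> v \<oplus>\<^bsub>N\<^esub> w \<in> carrier N"
      by (metis ex cl add M.add.m_closed)
    show "\<forall>v\<in>carrier N. \<exists>neg_v\<in>carrier N. v \<oplus>\<^bsub>N\<^esub> neg_v = \<zero>\<^bsub>N\<^esub>"
    proof
      fix v assume "v \<in> carrier N"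
      then obtain x where x: "x \<in> carrier M" "v = f x" using ex by blast
      have "v \<oplus>\<^bsub>N\<^esub> f (\<ominus>\<^bsub>M\<^esub> x) = \<zero>\<^bsub>N\<^esub>"
        using x add[of x "\<ominus>\<^bsub>M\<^esub> x"] zero by (simp add: M.r_neg)
      then show "\<exists>neg_v\<in>carrier N. v \<oplus>\<^bsub>N\<^esub> neg_v = \<zero>\<^bsub>N\<^esub>" using x cl by blast
    qed
    show "\<forall>c v. c \<in> carrier R \<and> v \<in> carrier N \<longrightarrow> c \<odot>\<^bsub>N\<^esub> v \<in> carrier N"
      by (metis ex cl smult M.smult_closed)
    show "\<forall>v w. v \<in> carrier N \<and> w \<in> carrier N \<longrightarrow> v \<oplus>\<^bsub>N\<^esub> w = w \<oplus>\<^bsub>N\<^esub> v"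
      by (metis ex add M.a_comm)
    show "\<forall>v w x. v \<in> carrier N \<and> w \<in> carrier N \<and> x \<in> carrier N \<longrightarrow>
        v \<oplus>\<^bsub>N\<^esub> w \<oplus>\<^bsub>N\<^esub> x = v \<oplus>\<^bsub>N\<^esub> (w \<oplus>\<^bsub>N\<^esub> x)"
    proof (intro allI impI, elim conjE)
      fix v w x assume "v \<in> carrier N" "w \<in> carrier N" "x \<in> carrier N"
      then obtain a b c where *: "a \<in> carrier M" "v = f a" "b \<in> carrier M" "w = f b" "c \<in> carrier M" "x = f c"
        using ex by metis
      then show "v \<oplus>\<^bsub>N\<^esub> w \<oplus>\<^bsub>N\<^esub> x = v \<oplus>\<^bsub>N\<^esub> (w \<oplus>\<^bsub>N\<^esub> x)"
        by (simp add: add[symmetric] M.a_assoc)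
    qed
    show "\<forall>v\<in>carrier N. v \<oplus>\<^bsub>N\<^esub> \<zero>\<^bsub>N\<^esub> = v"
      by (metis ex add zero M.r_zero M.zero_closed)
    show "\<forall>a b v. a \<in> carrier R \<and> b \<in> carrier R \<and> v \<in> carrier N \<longrightarrow> (a \<otimes>\<^bsub>R\<^esub> b) \<odot>\<^bsub>N\<^esub> v = a \<odot>\<^bsub>N\<^esub> (b \<odot>\<^bsub>N\<^esub> v)"
    proof (intro allI impI, elim conjE)
      fix a b v assume "a \<in> carrier R" "b \<in> carrier R" "v \<in> carrier N"
      then obtain x where "x \<in> carrier M" "v = f x" using ex by metis
      then show "(a \<otimes>\<^bsub>R\<^esub> b) \<odot>\<^bsub>N\<^esub> v = a \<odot>\<^bsub>N\<^esub> (b \<odot>\<^bsub>N\<^esub> v)"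
        using \<open>a \<in> carrier R\<close> \<open>b \<in> carrier R\<close> by (simp add: smult[symmetric] M.smult_assoc1)
    qed
    show "\<forall>v\<in>carrier N. \<one>\<^bsub>R\<^esub> \<odot>\<^bsub>N\<^esub> v = v"
      by (metis ex smult M.smult_one M.R.one_closed)
    show "\<forall>a b v. a \<in> carrier R \<and> b \<in> carrier R \<and> v \<in> carrier N \<longrightarrow>
        (a \<oplus>\<^bsub>R\<^esub> b) \<odot>\<^bsub>N\<^esub> v = a \<odot>\<^bsub>N\<^esub> v \<oplus>\<^bsub>N\<^esub> b \<odot>\<^bsub>N\<^esub> v"
    proof (intro allI impI, elim conjE)
      fix a b v assume ab: "a \<in> carrier R" "b \<in> carrier R" "v \<in> carrier N"
      then obtain x where "x \<in> carrier M" "v = f x" using ex by metis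
      then show "(a \<oplus>\<^bsub>R\<^esub> b) \<odot>\<^bsub>N\<^esub> v = a \<odot>\<^bsub>N\<^esub> v \<oplus>\<^bsub>N\<^esub> b \<odot>\<^bsub>N\<^esub> v"
        using ab by (simp add: smult[symmetric] add[symmetric] M.smult_l_distr)
    qed
    show "\<forall>a v w. a \<in> carrier R \<and> v \<in> carrier N \<and> w \<in> carrier N \<longrightarrow>
        a \<odot>\<^bsub>N\<^esub> (v \<oplus>\<^bsub>N\<^esub> w) = a \<odot>\<^bsub>N\<^esub> v \<oplus>\<^bsub>N\<^esub> a \<odot>\<^bsub>N\<^esub> w"
    proof (intro allI impI, elim conjE)
      fix a v w assume a: "a \<in> carrier R" and "v \<in> carrier N" "w \<in> carrier N"
      then obtain x y where *: "x \<in> carrier M" "v = f x" "y \<in> carrier M" "w = f y" using ex by metis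
      have "a \<odot>\<^bsub>N\<^esub> (v \<oplus>\<^bsub>N\<^esub> w) = f (a \<odot>\<^bsub>M\<^esub> (x \<oplus>\<^bsub>M\<^esub> y))"
        using a * by (simp add: smult add)
      also have "\<dots> = a \<odot>\<^bsub>N\<^esub> v \<oplus>\<^bsub>N\<^esub> a \<odot>\<^bsub>N\<^esub> w"
        using a * by (simp add: smult add M.smult_r_distr)
      finally show "a \<odot>\<^bsub>N\<^esub> (v \<oplus>\<^bsub>N\<^esub> w) = a \<odot>\<^bsub>N\<^esub> v \<oplus>\<^bsub>N\<^esub> a \<odot>\<^bsub>N\<^esub> w" .
    qed
  qed
qed

text \<open>\<open>T\<close> gives linear coordinates indexed by \<open>A\<close>. The module axioms
  for \<open>W\<close> come from the space of coordinate functions, a basis from the images of the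
  unit functions \<open>e s\<close>.\<close>

lemma dim_parametrized:
  fixes T :: "('t \<Rightarrow> complex) \<Rightarrow> 'v" and W :: "(complex, 'v) module"
  assumes A: "finite A"
    and add: "\<And>x y. T (\<lambda>t. x t + y t) = T x \<oplus>\<^bsub>W\<^esub> T y"
    and smult: "\<And>c x. T (\<lambda>t. c * x t) = c \<odot>\<^bsub>W\<^esub> T x"
    and zero: "T (\<lambda>t. 0) = \<zero>\<^bsub>W\<^esub>"
    and carrier: "carrier W = {T x | x. \<forall>t. t \<notin> A \<longrightarrow> x t = 0}"
    and inj: "\<And>x. (\<And>t. t \<notin> A \<Longrightarrow> x t = 0) \<Longrightarrow> T x = \<zero>\<^bsub>W\<^esub> \<Longrightarrow> x = (\<lambda>t. 0)"
  shows "vectorspace.dim complex_field W = card A"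
proof -
  define P where "P = {x :: 't \<Rightarrow> complex. \<forall>t. t \<notin> A \<longrightarrow> x t = 0}"
  define F :: "(complex, 't \<Rightarrow> complex) module" where "F = \<lparr>carrier = P, mult = undefined, one = undefined, zero = (\<lambda>t. 0),
      add = (\<lambda>x y t. x t + y t), smult = (\<lambda>c x t. c * x t)\<rparr>"
  have F: "module complex_field F"
  proof (rule module_criteria[OF cring_complex_field])
    show "\<forall>v\<in>carrier F. \<exists>v'\<in>carrier F. v \<oplus>\<^bsub>F\<^esub> v' = \<zero>\<^bsub>F\<^esub>"
    proof
      fix v assume "v \<in> carrier F"
      then show "\<exists>v'\<in>carrier F. v \<oplus>\<^bsub>F\<^esub> v' = \<zero>\<^bsub>F\<^esub>"
        by (intro bexI[of _ "\<lambda>t. - v t"]) (auto simp: F_def P_def)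
    qed
  qed (auto simp: F_def P_def algebra_simps)
  have W: "module complex_field W"
    by (rule module_image[OF F, of T]) (auto simp: F_def P_def add smult zero carrier)
  interpret W: module complex_field W by (rule W)
  have vs: "vectorspace complex_field W"
    unfolding vectorspace_def using W field_complex_field by simp
  interpret V: vectorspace complex_field W by (rule vs)
  have TP: "T x \<in> carrier W" if "\<And>t. t \<notin> A \<Longrightarrow> x t = 0" for x using that by (auto simp: carrier)
  define e where "e s = (\<lambda>t. if t = s then 1 else 0 :: complex)" for s :: 't
  have eW: "T (e s) \<in> carrier W" if "s \<in> A" for s using that by (intro TP) (auto simp: e_def)
  have diff: "x = y" if "\<And>t. t \<notin> A \<Longrightarrow> x t = 0" "\<And>t. t \<notin> A \<Longrightarrow> y t = 0" "T x = T y" for x y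
  proof -
    have "T (\<lambda>t. x t + (- 1) * y t) = T (\<lambda>t. y t + (- 1) * y t)"
      using that(3) by (simp only: add smult)
    also have "\<dots> = \<zero>\<^bsub>W\<^esub>" by (simp add: zero)
    finally have "(\<lambda>t. x t + (- 1) * y t) = (\<lambda>t. 0)" using that by (intro inj) auto
    then show ?thesis by (simp add: fun_eq_iff)
  qed
  have inj_Te: "inj_on (\<lambda>s. T (e s)) A"
  proof (rule inj_onI)
    fix s s' assume s: "s \<in> A" "s' \<in> A" "T (e s) = T (e s')"
    then have "e s = e s'" by (intro diff) (auto simp: e_def)
    then show "s = s'" by (auto simp: e_def fun_eq_iff split: if_splits)
  qed
  have lc: "W.lincomb c ((\<lambda>s. T (e s)) ` B) = T (\<lambda>t. if t \<in> B then c (T (e t)) else 0)"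
    if "finite B" "B \<subseteq> A" for B c
    using that
  proof (induction B rule: finite_induct)
    case empty
    then show ?case by (simp add: W.lincomb_def zero)
  next
    case (insert s B)
    have notin: "T (e s) \<notin> (\<lambda>s. T (e s)) ` B"
      using inj_Te insert by (auto dest!: inj_onD)
    have "W.lincomb c ((\<lambda>s. T (e s)) ` insert s B) = c (T (e s)) \<odot>\<^bsub>W\<^esub> T (e s) \<oplus>\<^bsub>W\<^esub> W.lincomb c ((\<lambda>s. T (e s)) ` B)"
      unfolding W.lincomb_def image_insert
      using insert notin eW by (subst W.finsum_insert) auto
    also have "\<dots> = T (\<lambda>t. c (T (e s)) * e s t + (if t \<in> B then c (T (e t)) else 0))"
      using insert by (simp add: add smult)
    also have "(\<lambda>t. c (T (e s)) * e s t + (if t \<in> B then c (T (e t)) else 0)) =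
        (\<lambda>t. if t \<in> insert s B then c (T (e t)) else 0)"
      using insert.hyps by (auto simp: e_def fun_eq_iff)
    finally show ?case .
  qed
  let ?B = "(\<lambda>s. T (e s)) ` A"
  have BW: "?B \<subseteq> carrier W" using eW by auto
  have "V.basis ?B"
    unfolding V.basis_def
  proof (intro conjI BW)
    show "W.lin_indpt ?B"
    proof
      assume "W.lin_dep ?B"
      then obtain S c v where S: "finite S" "S \<subseteq> ?B" "W.lincomb c S = \<zero>\<^bsub>W\<^esub>" "v \<in> S" "c v \<noteq> 0"
        unfolding W.lin_dep_def by auto
      define B where "B = {s \<in> A. T (e s) \<in> S}"
      have SB: "S = (\<lambda>s. T (e s)) ` B" "finite B" "B \<subseteq> A" using S A by (auto simp: B_def)
      obtain s where s: "s \<in> B" "v = T (e s)" using S(4) SB(1) by auto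
      have "(\<lambda>t. if t \<in> B then c (T (e t)) else 0) = (\<lambda>t. 0)"
        using S(3) lc[OF SB(2,3), of c] SB by (intro inj) auto
      then have "(if s \<in> B then c (T (e s)) else 0) = 0" by (rule fun_cong)
      then show False using s S(5) by simp
    qed
    show "W.span ?B = carrier W"
    proof
      show "W.span ?B \<subseteq> carrier W" by (rule W.span_is_subset2[OF BW])
      show "carrier W \<subseteq> W.span ?B"
      proof
        fix v assume "v \<in> carrier W"
        then obtain x where x: "v = T x" "\<And>t. t \<notin> A \<Longrightarrow> x t = 0" by (auto simp: carrier)
        define c where "c v = x (the_inv_into A (\<lambda>s. T (e s)) v)" for v
        have "c (T (e t)) = x t" if "t \<in> A" for t
          using the_inv_into_f_f[OF inj_Te that] by (simp add: c_def)
        then have "(\<lambda>t. if t \<in> A then c (T (e t)) else 0) = x" using x(2) by (auto simp: fun_eq_iff)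
        then have "v = W.lincomb c ?B" using lc[OF A subset_refl, of c] x(1) by simp
        then show "v \<in> W.span ?B" unfolding W.span_def using A by auto
      qed
    qed
  qed
  then have "V.dim = card ?B" using A by (intro V.dim_basis) auto
  then show ?thesis using card_image[OF inj_Te] by simp
qed

section \<open>Germs modulo the Jacobian ideal\<close>

abbreviation dg :: "'n::finite monomial \<Rightarrow> nat" where
  "dg m \<equiv> (\<Sum>i\<in>UNIV. lk m i)"

lemma germs_dominated:
  assumes a: "a \<in> germs I" and b: "\<And>m. norm (b m) \<le> K * norm (a m)"
  shows "b \<in> germs I"
proof -
  obtain r where r: "r > 0" "(\<lambda>m. norm (a m) * r ^ dg m) summable_on UNIV"
    using a by (auto simp: germs_def)
  have "(\<lambda>m. K * (norm (a m) * r ^ dg m)) summable_on UNIV"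
    by (rule summable_on_cmult_right[OF r(2)])
  then have "(\<lambda>m. norm (b m) * r ^ dg m) summable_on UNIV"
    by (rule summable_on_comparison_test)
       (use b r(1) in \<open>auto simp: mult.assoc[symmetric] intro!: mult_right_mono\<close>)
  moreover have "b m = 0" if "a m = 0" for m using b[of m] that by simp
  then have "Poly_Mapping.keys m \<subseteq> I" if "b m \<noteq> 0" for m using a that unfolding germs_def by blast
  ultimately show ?thesis using r(1) by (auto simp: germs_def)
qed

lemma germs_smult: "a \<in> germs I \<Longrightarrow> (\<lambda>m. c * a m) \<in> germs I"
  by (rule germs_dominated[where K = "norm c"]) (auto simp: norm_mult)

lemma germs_add:
  assumes "a \<in> germs I" "b \<in> germs I"
  shows "(\<lambda>m. a m + b m) \<in> germs I"
proof -
  obtain r s where r: "r > 0" "(\<lambda>m. norm (a m) * r ^ dg m) summable_on UNIV"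
    and s: "s > 0" "(\<lambda>m. norm (b m) * s ^ dg m) summable_on UNIV"
    using assms by (auto simp: germs_def)
  define t where "t = min r s"
  have t: "0 < t" "t \<le> r" "t \<le> s" using r(1) s(1) by (auto simp: t_def)
  have "(\<lambda>m. norm (a m) * r ^ dg m + norm (b m) * s ^ dg m) summable_on UNIV"
    by (rule summable_on_add[OF r(2) s(2)])
  then have "(\<lambda>m. norm (a m + b m) * t ^ dg m) summable_on UNIV"
  proof (rule summable_on_comparison_test)
    fix m
    have "norm (a m + b m) * t ^ dg m \<le> (norm (a m) + norm (b m)) * t ^ dg m"
      using t by (intro mult_right_mono norm_triangle_ineq) auto
    also have "\<dots> \<le> norm (a m) * r ^ dg m + norm (b m) * s ^ dg m"
      using t unfolding distrib_right by (intro add_mono mult_left_mono power_mono) auto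
    finally show "norm (a m + b m) * t ^ dg m \<le> norm (a m) * r ^ dg m + norm (b m) * s ^ dg m" .
  qed (use t in auto)
  moreover have "Poly_Mapping.keys m \<subseteq> I" if "a m + b m \<noteq> 0" for m
  proof -
    have "a m \<noteq> 0 \<or> b m \<noteq> 0" using that by auto
    then show ?thesis using assms unfolding germs_def by blast
  qed
  ultimately show ?thesis using t(1) by (auto simp: germs_def)
qed

lemma germs_poly:
  assumes "\<And>m. m \<in> Poly_Mapping.keys p \<Longrightarrow> Poly_Mapping.keys m \<subseteq> I"
  shows "lk p \<in> germs (I :: 'n::finite set)"
proof -
  have "(\<lambda>m. norm (lk p m) * 1 ^ dg m) summable_on Poly_Mapping.keys p" by simp
  also have "?this \<longleftrightarrow> (\<lambda>m. norm (lk p m) * 1 ^ dg m) summable_on UNIV"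
    by (rule summable_on_cong_neutral) (auto simp: in_keys_iff)
  finally show ?thesis
    using assms by (auto simp: germs_def in_keys_iff intro!: exI[of _ 1])
qed

lemma germs_0: "(\<lambda>m. 0) \<in> germs (I :: 'n::finite set)"
proof -
  have "(\<lambda>m. 0) = lk (0 :: 'n cpoly)" by (simp add: fun_eq_iff)
  then show ?thesis using germs_poly[of 0 I] by simp
qed

lemma germs_sum: "(\<And>s. s \<in> A \<Longrightarrow> h s \<in> germs I) \<Longrightarrow> (\<lambda>m. \<Sum>s\<in>A. h s m) \<in> germs I"
  by (induction A rule: infinite_finite_induct) (auto intro: germs_0 germs_add)

lemma germs_shift:
  fixes s :: "'n::finite monomial"
  assumes h: "h \<in> germs I" and s: "Poly_Mapping.keys s \<subseteq> I"
  shows "(\<lambda>m. if m \<in> range (\<lambda>l. s + l) then h (m - s) else 0) \<in> germs I"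
proof -
  obtain r where r: "r > 0" "(\<lambda>m. norm (h m) * r ^ dg m) summable_on UNIV"
    using h by (auto simp: germs_def)
  define g where "g m = (if m \<in> range (\<lambda>l. s + l) then h (m - s) else 0)" for m
  have g: "g (s + l) = h l" for l by (simp add: g_def)
  have "(\<lambda>m. norm (h m) * r ^ dg m * r ^ dg s) summable_on UNIV"
    by (rule summable_on_cmult_left[OF r(2)])
  also have "(\<lambda>m. norm (h m) * r ^ dg m * r ^ dg s) = (\<lambda>m. norm (g m) * r ^ dg m) \<circ> (\<lambda>l. s + l)"
    by (simp add: fun_eq_iff g lookup_add sum.distrib power_add mult_ac)
  finally have comp: "((\<lambda>m. norm (g m) * r ^ dg m) \<circ> (\<lambda>l. s + l)) summable_on UNIV" .
  have "inj (\<lambda>l. s + l)" by (auto intro: injI)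
  then have "(\<lambda>m. norm (g m) * r ^ dg m) summable_on range (\<lambda>l. s + l)"
    using comp by (simp only: summable_on_reindex)
  also have "?this \<longleftrightarrow> (\<lambda>m. norm (g m) * r ^ dg m) summable_on UNIV"
    by (rule summable_on_cong_neutral) (auto simp: g_def)
  finally have "(\<lambda>m. norm (g m) * r ^ dg m) summable_on UNIV" .
  moreover have "Poly_Mapping.keys m \<subseteq> I" if gm: "g m \<noteq> 0" for m
  proof -
    obtain l where l: "m = s + l" using gm by (auto simp: g_def split: if_splits)
    then have "h l \<noteq> 0" using gm g by simp
    then have "Poly_Mapping.keys l \<subseteq> I" using h unfolding germs_def by blast
    then show ?thesis using s by (simp add: l keys_add_monomial)
  qed
  ultimately have "g \<in> germs I" using r(1) by (auto simp: germs_def)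
  then show ?thesis by (simp add: g_def[abs_def])
qed

text \<open>Multiplication by a polynomial is a finite sum of shifted and scaled series, so
  convergence involves no product of two infinite series. This suffices, as the partial derivatives
  are polynomials.\<close>

lemma germ_mult_poly_eq:
  fixes p :: "'n::finite cpoly"
  shows "germ_mult (lk p) h m =
    (\<Sum>s\<in>Poly_Mapping.keys p. lk p s * (if m \<in> range (\<lambda>l. s + l) then h (m - s) else 0))"
proof -
  let ?D = "{(k, l). k + l = m}" and ?A = "{s \<in> Poly_Mapping.keys p. m \<in> range (\<lambda>l. s + l)}"
  have "germ_mult (lk p) h m = (\<Sum>(k, l)\<in>?D. lk p k * h l)" by (simp add: germ_mult_def)
  also have "\<dots> = (\<Sum>(k, l)\<in>{(k, l)\<in>?D. k \<in> Poly_Mapping.keys p}. lk p k * h l)"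
    by (rule sum.mono_neutral_right[OF finite_decompositions]) (auto simp: in_keys_iff)
  also have "\<dots> = (\<Sum>s\<in>?A. lk p s * h (m - s))"
    by (rule sum.reindex_bij_witness[of _ "\<lambda>s. (s, m - s)" fst]) auto
  also have "\<dots> = (\<Sum>s\<in>Poly_Mapping.keys p. lk p s * (if m \<in> range (\<lambda>l. s + l) then h (m - s) else 0))"
    by (rule sum.mono_neutral_cong_left) auto
  finally show ?thesis .
qed

lemma germs_mult_poly:
  assumes "\<And>m. m \<in> Poly_Mapping.keys p \<Longrightarrow> Poly_Mapping.keys m \<subseteq> I" "h \<in> germs I"
  shows "germ_mult (lk p) h \<in> germs (I :: 'n::finite set)"
  unfolding germ_mult_poly_eq[abs_def] using assms
  by (intro germs_sum germs_smult germs_shift)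

lemma germ_module_module: "module complex_field (germ_module I)"
proof (rule module_criteria[OF cring_complex_field])
  show "\<forall>v\<in>carrier (germ_module I). \<exists>v'\<in>carrier (germ_module I). v \<oplus>\<^bsub>germ_module I\<^esub> v' = \<zero>\<^bsub>germ_module I\<^esub>"
  proof
    fix v assume "v \<in> carrier (germ_module I)"
    then show "\<exists>v'\<in>carrier (germ_module I). v \<oplus>\<^bsub>germ_module I\<^esub> v' = \<zero>\<^bsub>germ_module I\<^esub>"
      using germs_smult[of v I "-1"]
      by (intro bexI[of _ "\<lambda>t. (-1) * v t"]) (auto simp: germ_module_def)
  qed
qed (auto simp: germ_module_def algebra_simps germs_0 germs_add germs_smult)

locale quotient_of_germs =
  fixes I :: "'n::finite set" and J :: "'n cseries set"
  assumes J_germs: "J \<subseteq> germs I" and J_0: "(\<lambda>m. 0) \<in> J"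
    and J_add: "a \<in> J \<Longrightarrow> b \<in> J \<Longrightarrow> (\<lambda>m. a m + b m) \<in> J"
    and J_smult: "a \<in> J \<Longrightarrow> (\<lambda>m. c * a m) \<in> J"
begin

definition coset :: "'n cseries \<Rightarrow> 'n cseries set" where
  "coset a = J +>\<^bsub>germ_module I\<^esub> a"

lemma coset_eq: "coset a = {b. (\<lambda>m. b m - a m) \<in> J}"
proof -
  have "coset a = {(\<lambda>m. j m + a m) | j. j \<in> J}"
    by (auto simp: coset_def a_r_coset_def r_coset_def germ_module_def)
  also have "\<dots> = {b. (\<lambda>m. b m - a m) \<in> J}"
    by (auto intro!: exI[of _ "\<lambda>m. b m - a m" for b])
  finally show ?thesis .
qed

lemma J_diff: "a \<in> J \<Longrightarrow> b \<in> J \<Longrightarrow> (\<lambda>m. a m - b m) \<in> J"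
  using J_add[of a "\<lambda>m. (-1) * b m"] J_smult[of b "-1"] by simp

lemma J_sum: "(\<And>s. s \<in> A \<Longrightarrow> h s \<in> J) \<Longrightarrow> (\<lambda>m. \<Sum>s\<in>A. h s m) \<in> J"
  by (induction A rule: infinite_finite_induct) (auto intro: J_0 J_add)

lemma coset_eq_iff: "coset a = coset b \<longleftrightarrow> (\<lambda>m. a m - b m) \<in> J"
proof
  assume "coset a = coset b"
  moreover have "a \<in> coset a" using J_0 by (simp add: coset_eq)
  ultimately show "(\<lambda>m. a m - b m) \<in> J" by (simp add: coset_eq)
next
  assume *: "(\<lambda>m. a m - b m) \<in> J"
  show "coset a = coset b"
    unfolding coset_eq
  proof (intro Collect_cong iffI)
    fix c assume "(\<lambda>m. c m - a m) \<in> J"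
    from J_add[OF this *] show "(\<lambda>m. c m - b m) \<in> J" by simp
  next
    fix c assume "(\<lambda>m. c m - b m) \<in> J"
    from J_diff[OF this *] show "(\<lambda>m. c m - a m) \<in> J" by simp
  qed
qed

lemma coset_0: "coset (\<lambda>m. 0) = J"
  by (auto simp: coset_eq)

lemma quotient_add: "set_add (germ_module I) (coset a) (coset b) = coset (\<lambda>m. a m + b m)"
proof (intro equalityI subsetI)
  fix c assume "c \<in> set_add (germ_module I) (coset a) (coset b)"
  then obtain x y where xy: "x \<in> coset a" "y \<in> coset b" "c = (\<lambda>m. x m + y m)"
    by (auto simp: set_add_def set_mult_def germ_module_def)
  then have "(\<lambda>m. (x m - a m) + (y m - b m)) \<in> J" by (intro J_add) (auto simp: coset_eq)
  then show "c \<in> coset (\<lambda>m. a m + b m)" using xy by (simp add: coset_eq algebra_simps)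
next
  fix c assume "c \<in> coset (\<lambda>m. a m + b m)"
  then have "(\<lambda>m. c m - b m) \<in> coset a" by (simp add: coset_eq algebra_simps)
  moreover have "b \<in> coset b" using J_0 by (simp add: coset_eq)
  ultimately have "(\<lambda>m. (c m - b m) + b m) \<in> set_add (germ_module I) (coset a) (coset b)"
    unfolding set_add_def set_mult_def germ_module_def by fastforce
  then show "c \<in> set_add (germ_module I) (coset a) (coset b)" by simp
qed

text \<open>All cosets in the union coincide, so the scalar multiple in the quotient is a single
  coset.\<close>

lemma quotient_smult: "(\<Union>x\<in>coset a. coset (\<lambda>m. c * x m)) = coset (\<lambda>m. c * a m)"
proof -
  have "coset (\<lambda>m. c * x m) = coset (\<lambda>m. c * a m)" if "x \<in> coset a" for x
  proof -
    have "(\<lambda>m. c * (x m - a m)) \<in> J" using that by (intro J_smult) (simp add: coset_eq)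
    then show ?thesis by (simp add: coset_eq_iff right_diff_distrib)
  qed
  moreover have "a \<in> coset a" using J_0 by (simp add: coset_eq)
  ultimately show ?thesis by blast
qed

abbreviation Q where "Q \<equiv> quotient_module (germ_module I) J"

lemma Q_simps:
  "carrier Q = coset ` germs I" "\<zero>\<^bsub>Q\<^esub> = J"
  "coset a \<oplus>\<^bsub>Q\<^esub> coset b = coset (\<lambda>m. a m + b m)"
  "c \<odot>\<^bsub>Q\<^esub> coset a = coset (\<lambda>m. c * a m)"
proof -
  show "carrier Q = coset ` germs I"
    by (auto simp: quotient_module_def A_RCOSETS_def RCOSETS_def coset_def a_r_coset_def germ_module_def)
  have "(\<lambda>A. \<Union>a\<in>A. J +>\<^bsub>germ_module I\<^esub> (c \<odot>\<^bsub>germ_module I\<^esub> a)) (coset a) = coset (\<lambda>m. c * a m)"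
    using quotient_smult[where a = a and c = c] by (simp add: coset_def germ_module_def)
  then show "c \<odot>\<^bsub>Q\<^esub> coset a = coset (\<lambda>m. c * a m)" by (simp add: quotient_module_def)
qed (simp_all add: quotient_module_def quotient_add)

lemma Q_module: "module complex_field Q"
  by (rule module_image[OF germ_module_module, of coset])
     (auto simp: Q_simps coset_0, auto simp: germ_module_def Q_simps coset_0)

text \<open>The cosets of polynomials with monomials in \<open>A\<close> form a submodule containing
  the generators, and each of them is reached by induction on the polynomial.\<close>

lemma span_coset:
  assumes "\<And>k. k \<in> A \<Longrightarrow> Poly_Mapping.keys k \<subseteq> I"
  shows "LinearCombinations.module.span complex_field Q ((\<lambda>k. coset (lk (Poly_Mapping.single k 1))) ` A) =
    {coset (lk p) | p. Poly_Mapping.keys p \<subseteq> A}"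
proof -
  interpret Q: module complex_field Q by (rule Q_module)
  let ?S = "(\<lambda>k. coset (lk (Poly_Mapping.single k 1))) ` A"
  have poly_germ: "lk p \<in> germs I" if "Poly_Mapping.keys p \<subseteq> A" for p
    using that assms by (intro germs_poly) auto
  have SQ: "?S \<subseteq> carrier Q"
    using poly_germ by (auto simp: Q_simps)
  have lk_add: "lk (p + q) = (\<lambda>m. lk p m + lk q m)" for p q :: "'n cpoly"
    by (simp add: fun_eq_iff lookup_add)
  have lk_smult: "lk (Poly_Mapping.single 0 c * p) = (\<lambda>m. c * lk p m)" for c and p :: "'n cpoly"
    by (simp add: fun_eq_iff lookup_const_times)
  have lk_0: "lk (0 :: 'n cpoly) = (\<lambda>m. 0)" by (simp add: fun_eq_iff)
  let ?N = "{coset (lk p) | p. Poly_Mapping.keys p \<subseteq> A}"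
  have "submodule complex_field ?N Q"
  proof (rule submodule.intro)
    show "module complex_field Q" by (rule Q_module)
    show "?N \<subseteq> carrier Q" using poly_germ by (auto simp: Q_simps)
    have "\<zero>\<^bsub>Q\<^esub> = coset (lk 0)" by (simp only: Q_simps lk_0 coset_0)
    then show "\<zero>\<^bsub>Q\<^esub> \<in> ?N" by (intro CollectI exI[of _ 0]) simp
  next
    fix v u assume "v \<in> ?N" "u \<in> ?N"
    then obtain p q where pq: "v = coset (lk p)" "u = coset (lk q)" "Poly_Mapping.keys p \<subseteq> A" "Poly_Mapping.keys q \<subseteq> A"
      by auto
    have "Poly_Mapping.keys (p + q) \<subseteq> A" using keys_add[of p q] pq by auto
    moreover have "v \<oplus>\<^bsub>Q\<^esub> u = coset (lk (p + q))" by (simp only: pq Q_simps lk_add)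
    ultimately show "v \<oplus>\<^bsub>Q\<^esub> u \<in> ?N" by blast
  next
    fix c v assume "v \<in> ?N"
    then obtain p where p: "v = coset (lk p)" "Poly_Mapping.keys p \<subseteq> A" by auto
    have "Poly_Mapping.keys (Poly_Mapping.single 0 c * p) \<subseteq> A"
      using p(2) by (auto simp: in_keys_iff lookup_const_times)
    moreover have "c \<odot>\<^bsub>Q\<^esub> v = coset (lk (Poly_Mapping.single 0 c * p))" by (simp only: p(1) Q_simps lk_smult)
    ultimately show "c \<odot>\<^bsub>Q\<^esub> v \<in> ?N" by blast
  qed
  moreover have "?S \<subseteq> ?N" by auto
  ultimately have sub: "Q.span ?S \<subseteq> ?N" by (intro Q.span_is_subset)
  have "coset (lk p) \<in> Q.span ?S" if "Poly_Mapping.keys p \<subseteq> A" for p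
  proof -
    interpret sp: submodule complex_field "Q.span ?S" Q by (rule Q.span_is_submodule[OF SQ])
    have own: "?S \<subseteq> Q.span ?S" by (rule Q.in_own_span[OF SQ])
    show ?thesis
    proof (induction p rule: poly_induct)
      case (single k c)
      then have "c \<odot>\<^bsub>Q\<^esub> coset (lk (Poly_Mapping.single k 1)) \<in> Q.span ?S"
        using own that by (intro sp.smult_closed) auto
      moreover have "c \<odot>\<^bsub>Q\<^esub> coset (lk (Poly_Mapping.single k 1)) = coset (lk (Poly_Mapping.single 0 c * Poly_Mapping.single k 1))"
        by (simp only: Q_simps lk_smult)
      ultimately show ?case by (simp add: mult_single)
    next
      case (add p q)
      then have "coset (lk p) \<oplus>\<^bsub>Q\<^esub> coset (lk q) \<in> Q.span ?S" by (rule sp.m_closed)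
      then show ?case by (simp only: Q_simps lk_add)
    next
      show "coset (lk 0) \<in> Q.span ?S"
        using sp.zero_closed by (simp only: lk_0 coset_0 Q_simps)
    qed
  qed
  then show ?thesis using sub by auto
qed

end

lemma germ_mult_add: "germ_mult a (\<lambda>m. h m + k m) m = germ_mult a h m + germ_mult a k m"
  by (simp add: germ_mult_def distrib_left sum.distrib case_prod_unfold)

lemma germ_mult_smult: "germ_mult a (\<lambda>m. c * h m) m = c * germ_mult a h m"
  by (simp add: germ_mult_def sum_distrib_left case_prod_unfold mult_ac)

section \<open>The Jacobian ideal in germs, its graded pieces and their invariants\<close>

locale jacobian_quotient = graded_jacobian I w H F
  for I :: "'n::finite set" and w :: "'n \<Rightarrow> rat" and H :: "('n \<Rightarrow> complex) set" and F :: "'n \<Rightarrow> 'n cpoly" +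
  fixes f :: "'n cseries"
  assumes partial_f: "i \<in> I \<Longrightarrow> partial i f = lk (F i)"
begin

lemma jacobian_ideal_eq: "jacobian_ideal I f =
    {(\<lambda>m. \<Sum>i\<in>I. germ_mult (lk (F i)) (h i) m) | h. \<forall>i\<in>I. h i \<in> germs I}"
proof -
  have "(\<lambda>m. \<Sum>i\<in>I. germ_mult (partial i f) (h i) m) = (\<lambda>m. \<Sum>i\<in>I. germ_mult (lk (F i)) (h i) m)" for h
    by (intro ext sum.cong refl) (simp add: partial_f)
  then show ?thesis by (simp add: jacobian_ideal_def)
qed

lemma jacobian_idealI:
  "(\<And>i. i \<in> I \<Longrightarrow> h i \<in> germs I) \<Longrightarrow> (\<lambda>m. \<Sum>i\<in>I. germ_mult (lk (F i)) (h i) m) \<in> jacobian_ideal I f"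
  unfolding jacobian_ideal_eq by blast

lemma jacobian_idealE:
  assumes "a \<in> jacobian_ideal I f"
  obtains h where "\<forall>i\<in>I. h i \<in> germs I" "a = (\<lambda>m. \<Sum>i\<in>I. germ_mult (lk (F i)) (h i) m)"
  using assms unfolding jacobian_ideal_eq by blast

sublocale jq: quotient_of_germs I "jacobian_ideal I f"
proof
  show "jacobian_ideal I f \<subseteq> germs I"
  proof
    fix a assume "a \<in> jacobian_ideal I f"
    then obtain h where h: "\<forall>i\<in>I. h i \<in> germs I" "a = (\<lambda>m. \<Sum>i\<in>I. germ_mult (lk (F i)) (h i) m)"
      by (rule jacobian_idealE)
    then show "a \<in> germs I"
      using F_keys h(1) by (simp only: h(2), intro germs_sum germs_mult_poly) auto
  qed
  have "(\<lambda>m. \<Sum>i\<in>I. germ_mult (lk (F i)) (\<lambda>m. 0) m) \<in> jacobian_ideal I f"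
    by (rule jacobian_idealI) (rule germs_0)
  then show "(\<lambda>m. 0) \<in> jacobian_ideal I f"
    using germ_mult_smult[where c = 0] by (simp add: germ_mult_def)
next
  fix a b assume "a \<in> jacobian_ideal I f" "b \<in> jacobian_ideal I f"
  then obtain h k where hk: "\<forall>i\<in>I. h i \<in> germs I" "a = (\<lambda>m. \<Sum>i\<in>I. germ_mult (lk (F i)) (h i) m)"
      "\<forall>i\<in>I. k i \<in> germs I" "b = (\<lambda>m. \<Sum>i\<in>I. germ_mult (lk (F i)) (k i) m)"
    by (elim jacobian_idealE) blast
  have "(\<lambda>m. \<Sum>i\<in>I. germ_mult (lk (F i)) (\<lambda>m. h i m + k i m) m) \<in> jacobian_ideal I f"
    using hk by (intro jacobian_idealI germs_add) auto
  then show "(\<lambda>m. a m + b m) \<in> jacobian_ideal I f"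
    by (simp add: hk(2,4) germ_mult_add sum.distrib)
next
  fix a c assume "a \<in> jacobian_ideal I f"
  then obtain h where h: "\<forall>i\<in>I. h i \<in> germs I" "a = (\<lambda>m. \<Sum>i\<in>I. germ_mult (lk (F i)) (h i) m)"
    by (rule jacobian_idealE)
  have "(\<lambda>m. \<Sum>i\<in>I. germ_mult (lk (F i)) (\<lambda>m. c * h i m) m) \<in> jacobian_ideal I f"
    using h by (intro jacobian_idealI germs_smult) auto
  then show "(\<lambda>m. c * a m) \<in> jacobian_ideal I f"
    by (simp add: h(2) germ_mult_smult sum_distrib_left)
qed

text \<open>The passage from germs to polynomials. Only the monomials of a convergent cofactor
  \<open>h i\<close> that are good for \<open>{i}\<close> contribute to good monomials of the
  combination; by \<open>finite_good\<close> they are finitely many, so truncation leaves polynomial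
  cofactors.\<close>

lemma jacobian_ideal_poly:
  assumes p: "Poly_Mapping.keys p \<subseteq> {m. good l {} m}"
  shows "lk p \<in> jacobian_ideal I f \<longleftrightarrow> p \<in> Jac"
proof
  assume "p \<in> Jac"
  then obtain c where c: "p = (\<Sum>i\<in>I. F i * c i)" by (auto simp: Jac_def mult.commute)
  \<comment> \<open>The polynomial cofactors may involve variables outside \<open>I\<close>; these
    are set to zero to obtain germs in the variables of \<open>I\<close>.\<close>
  let ?P = "\<lambda>m. Poly_Mapping.keys m \<subseteq> I"
  have "p = pfilter ?P p"
    by (rule pfilter_id[symmetric]) (use p in \<open>auto simp: good_def\<close>)
  also have "\<dots> = (\<Sum>i\<in>I. F i * pfilter ?P (c i))"
    unfolding c pfilter_sum using F_keys by (intro sum.cong refl pfilter_times) (auto simp: keys_add_monomial)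
  finally have "lk p = (\<lambda>m. \<Sum>i\<in>I. germ_mult (lk (F i)) (lk (pfilter ?P (c i))) m)"
    by (simp add: fun_eq_iff lookup_sum lookup_times germ_mult_def)
  moreover have "lk (pfilter ?P (c i)) \<in> germs I" for i
    by (rule germs_poly) (auto simp: keys_pfilter)
  ultimately show "lk p \<in> jacobian_ideal I f" using jacobian_idealI by simp
next
  assume "lk p \<in> jacobian_ideal I f"
  then obtain h where h: "\<forall>i\<in>I. h i \<in> germs I" "lk p = (\<lambda>m. \<Sum>i\<in>I. germ_mult (lk (F i)) (h i) m)"
    by (rule jacobian_idealE)
  define c where "c i = Abs_poly_mapping (\<lambda>m. if good l {i} m then h i m else 0)" for i
  have lk_c: "lk (c i) m = (if good l {i} m then h i m else 0)" for i m
  proof -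
    have "finite {m. (if good l {i} m then h i m else 0) \<noteq> 0}"
      by (rule finite_subset[OF _ finite_good[of l "{i}"]]) auto
    then show ?thesis unfolding c_def by (simp add: Abs_poly_mapping_inverse)
  qed
  have "p = (\<Sum>i\<in>I. c i * F i)"
  proof (rule poly_mapping_eqI)
    fix m
    have "lk (F i * c i) m = (if good l {} m then germ_mult (lk (F i)) (h i) m else 0)" if i: "i \<in> I" for i
    proof -
      have "lk (F i) k * lk (c i) r = (if good l {} (k + r) then lk (F i) k * h i r else 0)" for k r
        using good_shift[of i "{}" k l r] i by (cases "lk (F i) k = 0") (auto simp: lk_c in_keys_iff)
      then have "lk (F i * c i) m = (\<Sum>(k, r) | k + r = m. if good l {} (k + r) then lk (F i) k * h i r else 0)"
        unfolding lookup_times by (intro sum.cong) auto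
      also have "\<dots> = (\<Sum>(k, r) | k + r = m. if good l {} m then lk (F i) k * h i r else 0)"
        by (intro sum.cong) auto
      finally show ?thesis by (simp add: germ_mult_def)
    qed
    then have "lk (\<Sum>i\<in>I. c i * F i) m = (if good l {} m then lk p m else 0)"
      by (simp add: lookup_sum mult.commute h(2))
    then show "lk p m = lk (\<Sum>i\<in>I. c i * F i) m" using p by (auto simp: in_keys_iff)
  qed
  then show "p \<in> Jac" unfolding Jac_def by blast
qed

definition act :: "('n \<Rightarrow> complex) \<Rightarrow> 'n cseries \<Rightarrow> 'n cseries" where
  "act h a = (\<lambda>m. chi h {} m * a m)"

lemma chi_empty: "chi h {} m = (\<Prod>i\<in>I. h i ^ (lk m i + 1))"
  by (simp add: chi_def)

lemma chi_shift:
  assumes "i \<in> I" "k \<in> Poly_Mapping.keys (F i)" "h \<in> H"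
  shows "chi h {} (k + l) = inverse (h i) * chi h {} l"
proof -
  have k0: "lk k j = 0" if "j \<notin> I" for j using F_keys[OF assms(1,2)] that by (metis in_keys_iff subsetD)
  have "chi h {} (k + l) = (\<Prod>i\<in>I. h i ^ lk k i) * chi h {} l"
    by (simp add: chi_empty lookup_add power_add prod.distrib mult_ac)
  also have "(\<Prod>i\<in>I. h i ^ lk k i) = mon_val h k"
    unfolding mon_val_def by (intro prod.mono_neutral_left) (auto simp: k0)
  also have "mon_val h k = inverse (h i)"
    using F_inv[OF assms] by (metis inverse_unique mult.commute)
  finally show ?thesis .
qed

lemma norm_chi: "h \<in> H \<Longrightarrow> norm (chi h {} m) = 1"
  using diag_group.norm_eq_1[OF H] by (simp add: chi_empty prod_norm[symmetric] norm_mult norm_power)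

text \<open>The character \<open>inverse (h i)\<close> of \<open>F i\<close> is moved into the
  cofactor, which stays convergent because characters have absolute value 1.\<close>

lemma act_jacobian_ideal:
  assumes h: "h \<in> H" and a: "a \<in> jacobian_ideal I f"
  shows "act h a \<in> jacobian_ideal I f"
proof -
  obtain k where k: "\<forall>i\<in>I. k i \<in> germs I" "a = (\<lambda>m. \<Sum>i\<in>I. germ_mult (lk (F i)) (k i) m)"
    using a by (rule jacobian_idealE)
  have "chi h {} m * germ_mult (lk (F i)) (k i) m = germ_mult (lk (F i)) (\<lambda>l. inverse (h i) * (chi h {} l * k i l)) m"
    if i: "i \<in> I" for i m
    unfolding germ_mult_def sum_distrib_left
  proof (rule sum.cong[OF refl], clarify)
    fix r l assume "m = r + l"
    show "chi h {} (r + l) * (lk (F i) r * k i l) = lk (F i) r * (inverse (h i) * (chi h {} l * k i l))"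
      using chi_shift[OF i _ h, of r l] by (cases "lk (F i) r = 0") (auto simp: in_keys_iff)
  qed
  then have "act h a = (\<lambda>m. \<Sum>i\<in>I. germ_mult (lk (F i)) (\<lambda>l. inverse (h i) * (chi h {} l * k i l)) m)"
    by (simp add: act_def k(2) sum_distrib_left)
  moreover have "(\<lambda>l. inverse (h i) * (chi h {} l * k i l)) \<in> germs I" if "i \<in> I" for i
    by (rule germs_smult, rule germs_dominated[OF k(1)[rule_format, OF that], where K = 1])
       (simp add: norm_mult norm_chi[OF h])
  ultimately show ?thesis using jacobian_idealI by simp
qed

lemma act_coset:
  assumes h: "h \<in> H"
  shows "act h ` jq.coset a = jq.coset (act h a)"
proof (intro equalityI subsetI)
  fix b assume "b \<in> act h ` jq.coset a"
  then obtain c where c: "b = act h c" "(\<lambda>m. c m - a m) \<in> jacobian_ideal I f" by (auto simp: jq.coset_eq)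
  from act_jacobian_ideal[OF h c(2)] show "b \<in> jq.coset (act h a)"
    by (simp add: c(1) jq.coset_eq act_def right_diff_distrib)
next
  fix b assume "b \<in> jq.coset (act h a)"
  then have b: "(\<lambda>m. b m - act h a m) \<in> jacobian_ideal I f" by (simp add: jq.coset_eq)
  let ?h = "\<lambda>i. inverse (h i)"
  have h': "?h \<in> H" by (rule diag_group.inv[OF H h])
  have inv: "chi ?h {} m * chi h {} m = 1" "chi h {} m * chi ?h {} m = 1" for m
    using diag_group.nz[OF H h]
    by (simp_all add: chi_empty prod.distrib[symmetric] power_mult_distrib[symmetric] del: power_Suc)
  have "chi ?h {} m * (b m - act h a m) = act ?h b m - a m" for m
    using inv(1)[of m] by (simp add: act_def right_diff_distrib mult.assoc[symmetric])
  then have "act ?h b \<in> jq.coset a"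
    using act_jacobian_ideal[OF h' b] by (simp add: jq.coset_eq act_def)
  moreover have "b = act h (act ?h b)" using inv(2) by (simp add: act_def fun_eq_iff mult.assoc[symmetric])
  ultimately show "b \<in> act h ` jq.coset a" by blast
qed

text \<open>Invariance concerns cosets, not representatives. The average of
  \<open>act h (lk p)\<close> over \<open>H\<close> is congruent to \<open>lk p\<close> and keeps
  exactly the monomials of trivial character, so an invariant representative exists.\<close>

lemma invariant_cosets:
  "{c \<in> {jq.coset (lk p) | p. Poly_Mapping.keys p \<subseteq> {m. Poly_Mapping.keys m \<subseteq> I \<and> wtf {} m = l}}. \<forall>h\<in>H. act h ` c = c} =
   {jq.coset (lk p) | p. Poly_Mapping.keys p \<subseteq> {m. good l {} m}}" (is "?L = ?R")
proof (intro equalityI subsetI)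
  fix c assume "c \<in> ?R"
  then obtain p where p: "c = jq.coset (lk p)" "Poly_Mapping.keys p \<subseteq> {m. good l {} m}" by auto
  have "act h (lk p) = lk p" if "h \<in> H" for h
  proof
    fix m show "act h (lk p) m = lk p m"
      using p(2) that by (cases "lk p m = 0") (auto simp: act_def good_def in_keys_iff)
  qed
  moreover have "Poly_Mapping.keys p \<subseteq> {m. Poly_Mapping.keys m \<subseteq> I \<and> wtf {} m = l}"
    using p(2) by (auto simp: good_def)
  ultimately show "c \<in> ?L" unfolding p(1) by (auto simp: act_coset)
next
  interpret H: diag_group H by (rule H)
  fix c assume "c \<in> ?L"
  then obtain p where p: "c = jq.coset (lk p)" "Poly_Mapping.keys p \<subseteq> {m. Poly_Mapping.keys m \<subseteq> I \<and> wtf {} m = l}"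
    and inv: "\<And>h. h \<in> H \<Longrightarrow> act h ` c = c" by auto
  have "(\<lambda>m. act h (lk p) m - lk p m) \<in> jacobian_ideal I f" if "h \<in> H" for h
    using inv[OF that] unfolding p(1) act_coset[OF that] jq.coset_eq_iff .
  then have "(\<lambda>m. 1 / of_nat (card H) * (\<Sum>h\<in>H. act h (lk p) m - lk p m)) \<in> jacobian_ideal I f"
    by (intro jq.J_smult jq.J_sum)
  also have "(\<lambda>m. 1 / of_nat (card H) * (\<Sum>h\<in>H. act h (lk p) m - lk p m)) =
      (\<lambda>m. lk (pfilter (good l {}) p) m - lk p m)"
  proof
    fix m
    have "(\<Sum>h\<in>H. chi h {} m) = (if \<forall>h\<in>H. chi h {} m = 1 then of_nat (card H) else 0)"
      by (rule H.sum_character) (simp add: chi_empty power_mult_distrib prod.distrib mult_ac)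
    then have "(\<Sum>h\<in>H. act h (lk p) m - lk p m) =
        (if \<forall>h\<in>H. chi h {} m = 1 then of_nat (card H) else 0) * lk p m - of_nat (card H) * lk p m"
      by (simp add: act_def sum_subtractf sum_distrib_right[symmetric])
    then show "1 / of_nat (card H) * (\<Sum>h\<in>H. act h (lk p) m - lk p m) = lk (pfilter (good l {}) p) m - lk p m"
      using H.card_pos p(2) by (cases "lk p m = 0") (auto simp: lookup_pfilter good_def in_keys_iff)
  qed
  finally have "jq.coset (lk (pfilter (good l {}) p)) = c"
    unfolding p(1) jq.coset_eq_iff .
  then show "c \<in> ?R" by (auto simp: keys_pfilter intro!: exI[of _ "pfilter (good l {}) p"])
qed

theorem invariant_basis:
  obtains M where "finite M" "int (card M) = euler l"
    "{c \<in> {jq.coset (lk p) | p. Poly_Mapping.keys p \<subseteq> {m. Poly_Mapping.keys m \<subseteq> I \<and> wtf {} m = l}}. \<forall>h\<in>H. act h ` c = c} =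
     {jq.coset (lk q) | q. Poly_Mapping.keys q \<subseteq> M}"
    "\<And>q. Poly_Mapping.keys q \<subseteq> M \<Longrightarrow> lk q \<in> jacobian_ideal I f \<Longrightarrow> q = 0"
proof -
  obtain M where M: "M \<subseteq> {m. good l {} m}" "finite M" "int (card M) = euler l"
    "\<And>p. Poly_Mapping.keys p \<subseteq> {m. good l {} m} \<Longrightarrow> \<exists>q. Poly_Mapping.keys q \<subseteq> M \<and> p - q \<in> Jac"
    "\<And>q. Poly_Mapping.keys q \<subseteq> M \<Longrightarrow> q \<in> Jac \<Longrightarrow> q = 0"
    by (rule graded_basis[of l]) blast
  show ?thesis
  proof (rule that[OF M(2,3)])
    show "{c \<in> {jq.coset (lk p) | p. Poly_Mapping.keys p \<subseteq> {m. Poly_Mapping.keys m \<subseteq> I \<and> wtf {} m = l}}. \<forall>h\<in>H. act h ` c = c} =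
     {jq.coset (lk q) | q. Poly_Mapping.keys q \<subseteq> M}"
      unfolding invariant_cosets
    proof (intro equalityI subsetI)
      fix c assume "c \<in> {jq.coset (lk p) | p. Poly_Mapping.keys p \<subseteq> {m. good l {} m}}"
      then obtain p where p: "c = jq.coset (lk p)" "Poly_Mapping.keys p \<subseteq> {m. good l {} m}" by auto
      obtain q where q: "Poly_Mapping.keys q \<subseteq> M" "p - q \<in> Jac" using M(4)[OF p(2)] by auto
      have "Poly_Mapping.keys (p - q) \<subseteq> {m. good l {} m}"
        using keys_diff[of p q] p(2) q(1) M(1) by auto
      then have "lk (p - q) \<in> jacobian_ideal I f" using q(2) by (simp add: jacobian_ideal_poly)
      moreover have "lk (p - q) = (\<lambda>m. lk p m - lk q m)" by (simp add: fun_eq_iff lookup_minus)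
      ultimately have "c = jq.coset (lk q)" by (simp add: p(1) jq.coset_eq_iff)
      then show "c \<in> {jq.coset (lk q) | q. Poly_Mapping.keys q \<subseteq> M}" using q(1) by blast
    qed (use M(1) in blast)
  next
    fix q assume "Poly_Mapping.keys q \<subseteq> M" "lk q \<in> jacobian_ideal I f"
    then show "q = 0" using M(1) jacobian_ideal_poly[of q l] by (intro M(5)) auto
  qed
qed

end

section \<open>Invariant weighted homogeneous polynomials\<close>

lemma of_real_of_rat: "of_real (of_rat r) = (of_rat r :: complex)"
  by (cases r) (simp add: of_rat_rat)

text \<open>Evaluation at all tuples of \<open>N\<close>-th roots of unity, with \<open>N\<close>
  above every exponent, isolates one coefficient by orthogonality; \<open>N - lk m i\<close> takes
  the place of the exponent \<open>- lk m i\<close>.\<close>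

lemma ev_eq_imp_eq:
  fixes p q :: "'n::finite cpoly"
  assumes eq: "\<And>x. ev x p = ev x q"
  shows "p = q"
proof -
  define r where "r = p - q"
  have r: "ev x r = 0" for x using eq by (simp add: r_def ev_diff)
  have "lk r m = 0" for m
  proof -
    define N where "N = Suc (Max (insert 0 ((\<lambda>(k, i). lk k i) ` (insert m (Poly_Mapping.keys r) \<times> UNIV))))"
    have bound: "lk k i < N" if "k \<in> insert m (Poly_Mapping.keys r)" for k i
    proof -
      have "lk k i \<le> Max (insert 0 ((\<lambda>(k, i). lk k i) ` (insert m (Poly_Mapping.keys r) \<times> UNIV)))"
        by (rule Max_ge) (use that in \<open>auto intro!: image_eqI[where x = "(k, i)"]\<close>)
      then show ?thesis by (simp add: N_def)
    qed
    have N: "N > 0" by (simp add: N_def)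
    let ?P = "\<Pi>\<^sub>E i\<in>(UNIV :: 'n set). roots1 N"
    have single_k: "(\<Sum>x\<in>?P. (\<Prod>i\<in>UNIV. x i ^ (N - lk m i)) * mon_val x k) = (if k = m then of_nat N ^ CARD('n) else 0)"
      if k: "k \<in> insert m (Poly_Mapping.keys r)" for k
    proof -
      have "(\<Sum>x\<in>?P. (\<Prod>i\<in>UNIV. x i ^ (N - lk m i)) * mon_val x k) =
          (\<Sum>x\<in>?P. \<Prod>i\<in>UNIV. x i ^ (N - lk m i + lk k i))"
        by (simp add: mon_val_def power_add prod.distrib)
      also have "\<dots> = (\<Prod>i\<in>UNIV. \<Sum>z\<in>roots1 N. z ^ (N - lk m i + lk k i))"
        by (rule prod_sum_PiE[symmetric]) (auto intro: finite_roots1[OF N])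
      also have "\<dots> = (\<Prod>i\<in>UNIV. if lk k i = lk m i then of_nat N else 0)"
      proof (rule prod.cong[OF refl])
        fix i
        have "N dvd N - lk m i + lk k i \<longleftrightarrow> lk k i = lk m i"
        proof
          assume "N dvd N - lk m i + lk k i"
          then obtain c where c: "N - lk m i + lk k i = N * c" by auto
          have "0 < N - lk m i + lk k i" "N - lk m i + lk k i < N * 2"
            using bound[of m i] bound[OF k, of i] by auto
          then have "0 < N * c" "N * c < N * 2" unfolding c by auto
          then have "c = 1" by auto
          then show "lk k i = lk m i" using c bound[of m i] by auto
        qed (use bound[of m i] in auto)
        then show "(\<Sum>z\<in>roots1 N. z ^ (N - lk m i + lk k i)) = (if lk k i = lk m i then of_nat N else 0)"
          by (simp add: sum_roots1_power[OF N])
      qed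
      also have "\<dots> = (if k = m then of_nat N ^ CARD('n) else 0)"
      proof (cases "k = m")
        case False
        then obtain i where "lk k i \<noteq> lk m i" by (metis poly_mapping_eqI)
        then show ?thesis using False by (auto intro!: prod_zero)
      qed simp
      finally show ?thesis .
    qed
    have "0 = (\<Sum>x\<in>?P. (\<Prod>i\<in>UNIV. x i ^ (N - lk m i)) * ev x r)" by (simp add: r)
    also have "\<dots> = (\<Sum>k\<in>Poly_Mapping.keys r. lk r k * (\<Sum>x\<in>?P. (\<Prod>i\<in>UNIV. x i ^ (N - lk m i)) * mon_val x k))"
      unfolding ev_def sum_distrib_left by (subst sum.swap) (simp add: mult_ac)
    also have "\<dots> = (\<Sum>k\<in>Poly_Mapping.keys r. if k = m then lk r m * of_nat N ^ CARD('n) else 0)"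
      by (intro sum.cong refl) (auto simp: single_k)
    also have "\<dots> = lk r m * of_nat N ^ CARD('n)" by (auto simp: in_keys_iff)
    finally show ?thesis using N by simp
  qed
  then have "r = 0" by (intro poly_mapping_eqI) simp
  then show ?thesis by (simp add: r_def)
qed

lemma mon_val_mult: "mon_val (\<lambda>i. y i * x i) m = mon_val y m * mon_val x m"
  by (simp add: mon_val_def power_mult_distrib prod.distrib)

text \<open>Rescaling the variables multiplies each coefficient by \<open>mon_val y m\<close>, so a
  functional equation becomes a condition on every monomial.\<close>

lemma ev_scaled_imp_coeff:
  fixes p :: "'n::finite cpoly"
  assumes eq: "\<And>x. ev (\<lambda>i. y i * x i) p = t * ev x p" and m: "m \<in> Poly_Mapping.keys p"
  shows "mon_val y m = t"
proof -
  define q where "q = Abs_poly_mapping (\<lambda>m. mon_val y m * lk p m)"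
  have q: "lk q m = mon_val y m * lk p m" for m
  proof -
    have "finite {m. mon_val y m * lk p m \<noteq> 0}"
      by (rule finite_subset[OF _ finite_keys[of p]]) (auto simp: in_keys_iff)
    then show ?thesis unfolding q_def by (simp add: Abs_poly_mapping_inverse)
  qed
  have "ev x q = ev x (Poly_Mapping.single 0 t * p)" for x
  proof -
    have "ev x q = (\<Sum>k\<in>Poly_Mapping.keys p. lk q k * mon_val x k)"
      by (rule ev_superset) (auto simp: in_keys_iff q)
    also have "\<dots> = ev (\<lambda>i. y i * x i) p"
      unfolding ev_def mon_val_mult q by (simp add: mult_ac)
    finally show ?thesis by (simp add: eq ev_times ev_single)
  qed
  then have "q = Poly_Mapping.single 0 t * p" by (rule ev_eq_imp_eq)
  then have "lk q m = t * lk p m" by (simp add: lookup_const_times)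
  then show ?thesis using m by (simp add: q in_keys_iff)
qed

lemma ev_scaled:
  fixes p :: "'n::finite cpoly"
  assumes "\<And>m. m \<in> Poly_Mapping.keys p \<Longrightarrow> mon_val y m = t"
  shows "ev (\<lambda>i. y i * x i) p = t * ev x p"
  unfolding ev_def sum_distrib_left using assms
  by (intro sum.cong refl) (simp add: mon_val_mult)

lemma powr_wt:
  fixes w :: "'n::finite \<Rightarrow> rat"
  assumes "t > 0"
  shows "mon_val (\<lambda>i. complex_of_real (t powr of_rat (w i))) m = of_real (t powr of_rat (wt w m))"
proof -
  have "(t powr of_rat (w i)) ^ lk m i = t powr of_rat (w i * of_nat (lk m i))" for i
    using assms by (simp add: of_rat_mult powr_powr[symmetric] powr_realpow)
  moreover have "of_rat (wt w m) = (\<Sum>i\<in>UNIV. of_rat (w i * of_nat (lk m i)) :: real)"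
    by (simp add: wt_def of_rat_sum)
  then have "t powr of_rat (wt w m) = (\<Prod>i\<in>UNIV. t powr of_rat (w i * of_nat (lk m i)))"
    using assms by (simp add: powr_sum)
  ultimately show ?thesis by (simp add: mon_val_def flip: of_real_power)
qed

section \<open>Partial derivatives and restriction to fixed spaces\<close>

definition pd :: "'n \<Rightarrow> 'n::finite cpoly \<Rightarrow> 'n cpoly" where
  "pd i p = Abs_poly_mapping (partial i (lk p))"

lemma lookup_pd: "lk (pd i p) = partial i (lk p)"
proof -
  have "{m. partial i (lk p) m \<noteq> 0} \<subseteq> (\<lambda>m. m - Poly_Mapping.single i 1) ` Poly_Mapping.keys p"
  proof
    fix m assume "m \<in> {m. partial i (lk p) m \<noteq> 0}"
    then have "m + Poly_Mapping.single i 1 \<in> Poly_Mapping.keys p"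
      by (auto simp: partial_def in_keys_iff)
    then show "m \<in> (\<lambda>m. m - Poly_Mapping.single i 1) ` Poly_Mapping.keys p"
      by (intro image_eqI[where x = "m + Poly_Mapping.single i 1"]) auto
  qed
  then have "finite {m. partial i (lk p) m \<noteq> 0}" by (rule finite_subset) simp
  then show ?thesis unfolding pd_def by (simp add: Abs_poly_mapping_inverse)
qed

lemma keys_pd: "m \<in> Poly_Mapping.keys (pd i p) \<Longrightarrow> m + Poly_Mapping.single i 1 \<in> Poly_Mapping.keys p"
  by (auto simp: in_keys_iff lookup_pd partial_def)

lemma ev_pfilter_vars:
  fixes p :: "'n::finite cpoly"
  assumes "\<And>j. j \<notin> I \<Longrightarrow> x j = 0"
  shows "ev x (pfilter (\<lambda>m. Poly_Mapping.keys m \<subseteq> I) p) = ev x p"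
proof -
  have "mon_val x m = 0" if m: "\<not> Poly_Mapping.keys m \<subseteq> I" for m
  proof -
    obtain i where i: "i \<in> Poly_Mapping.keys m" "i \<notin> I" using m by auto
    then have "x i ^ lk m i = 0" using assms by (simp add: in_keys_iff)
    then show ?thesis unfolding mon_val_def by (intro prod_zero) auto
  qed
  then have "(\<Sum>m\<in>Poly_Mapping.keys p. lk (pfilter (\<lambda>m. Poly_Mapping.keys m \<subseteq> I) p) m * mon_val x m) = ev x p"
    unfolding ev_def by (intro sum.cong refl) (simp add: lookup_pfilter)
  then show ?thesis by (subst ev_superset[of "Poly_Mapping.keys p"]) (auto simp: keys_pfilter)
qed

abbreviation diag_of :: "complex ^ 'n ^ 'n \<Rightarrow> 'n \<Rightarrow> complex" where
  "diag_of g \<equiv> \<lambda>i. g $ i $ i"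

locale lg_pair =
  fixes f :: "'n::finite cpoly" and w :: "'n \<Rightarrow> rat" and G :: "(complex ^ 'n ^ 'n) set"
  assumes nd: "nondegenerate_weighted_homogeneous f w"
    and sub: "subgroup G SL" and finG: "finite G"
    and diag: "g \<in> G \<Longrightarrow> is_diagonal g"
    and inv: "g \<in> G \<Longrightarrow> eval_series (lk f) (g *v x) = eval_series (lk f) x"
begin

lemma w_pos: "w i > 0"
  using nd by (simp add: nondegenerate_weighted_homogeneous_def)

definition H :: "('n \<Rightarrow> complex) set" where
  "H = diag_of ` G"

lemma diag_mult: "g \<in> G \<Longrightarrow> h \<in> G \<Longrightarrow> diag_of (g ** h) = (\<lambda>i. g $ i $ i * h $ i $ i)"
proof
  fix i assume g: "g \<in> G" and h: "h \<in> G"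
  have "(g ** h) $ i $ i = (\<Sum>k\<in>UNIV. g $ i $ k * h $ k $ i)" by (simp add: matrix_matrix_mult_def)
  also have "\<dots> = (\<Sum>k\<in>UNIV. if k = i then g $ i $ i * h $ i $ i else 0)"
    using diag[OF g] by (intro sum.cong) (auto simp: is_diagonal_def)
  finally show "(g ** h) $ i $ i = g $ i $ i * h $ i $ i" by simp
qed

lemma group_SL: "group (SL :: (complex ^ 'n ^ 'n) monoid)"
proof (rule groupI)
  fix A :: "complex ^ 'n ^ 'n" assume "A \<in> carrier SL"
  then have A: "det A = 1" by (simp add: SL_def)
  then have "invertible A" by (simp add: invertible_det_nz)
  then obtain B where B: "A ** B = mat 1" "B ** A = mat 1" by (auto simp: invertible_def)
  have "det B * det A = 1" using B(2) by (metis det_I det_mul)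
  then show "\<exists>B\<in>carrier SL. B \<otimes>\<^bsub>SL\<^esub> A = \<one>\<^bsub>SL\<^esub>" using A B by (auto simp: SL_def)
qed (auto simp: SL_def det_mul det_I matrix_mul_assoc)

lemma G_one: "mat 1 \<in> G" and G_mult: "g \<in> G \<Longrightarrow> h \<in> G \<Longrightarrow> g ** h \<in> G"
  using subgroup.one_closed[OF sub] subgroup.m_closed[OF sub] by (auto simp: SL_def)

lemma G_det: "g \<in> G \<Longrightarrow> det g = 1"
  using subgroup.subset[OF sub] by (auto simp: SL_def)

lemma G_inv: "g \<in> G \<Longrightarrow> \<exists>h\<in>G. g ** h = mat 1"
  using subgroup.m_inv_closed[OF sub, of g] group.r_inv[OF group_SL, of g] subgroup.subset[OF sub]
  by (auto simp: SL_def intro!: bexI[of _ "inv\<^bsub>SL\<^esub> g"])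

lemma H_group: "diag_group H"
proof
  show "finite H" by (simp add: H_def finG)
  show "(\<lambda>_. 1) \<in> H" unfolding H_def
    by (rule image_eqI[OF _ G_one]) (simp add: mat_def)
  show "(\<lambda>i. g i * h i) \<in> H" if "g \<in> H" "h \<in> H" for g h
  proof -
    obtain a b where ab: "a \<in> G" "g = diag_of a" "b \<in> G" "h = diag_of b" using \<open>g \<in> H\<close> \<open>h \<in> H\<close> unfolding H_def by blast
    have "(\<lambda>i. g i * h i) = diag_of (a ** b)" using diag_mult[OF ab(1,3)] by (simp add: ab(2,4))
    then show ?thesis unfolding H_def by (rule image_eqI) (rule G_mult[OF ab(1,3)])
  qed
  have *: "\<exists>h\<in>G. \<forall>i. g $ i $ i * h $ i $ i = 1" if g: "g \<in> G" for g
  proof -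
    obtain h where h: "h \<in> G" "g ** h = mat 1" using G_inv[OF g] by auto
    have "(\<lambda>i. g $ i $ i * h $ i $ i) = diag_of (mat 1 :: complex ^ 'n ^ 'n)"
      using diag_mult[OF g h(1)] h(2) by simp
    then have "g $ i $ i * h $ i $ i = 1" for i by (simp add: fun_eq_iff mat_def)
    with h show ?thesis by blast
  qed
  show "(\<lambda>i. inverse (g i)) \<in> H" if "g \<in> H" for g
  proof -
    obtain a where a: "a \<in> G" "g = diag_of a" using \<open>g \<in> H\<close> unfolding H_def by blast
    obtain h where h: "h \<in> G" "\<forall>i. a $ i $ i * h $ i $ i = 1" using *[OF a(1)] by auto
    then have "(\<lambda>i. inverse (g i)) = diag_of h"
      unfolding a(2) by (intro ext inverse_unique) auto
    then show ?thesis using h by (auto simp: H_def)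
  qed
  show "g i \<noteq> 0" if "g \<in> H" for g i
  proof -
    obtain a where a: "a \<in> G" "g = diag_of a" using \<open>g \<in> H\<close> unfolding H_def by blast
    then show ?thesis using *[OF a(1)] by (metis mult_zero_left zero_neq_one)
  qed
qed

lemma inj_diag: "inj_on diag_of G"
proof (rule inj_onI)
  fix g h assume "g \<in> G" "h \<in> G" and eq: "diag_of g = diag_of h"
  then have "g $ i $ j = h $ i $ j" for i j
    using diag[of g] diag[of h] fun_cong[OF eq, of i] by (cases "i = j") (auto simp: is_diagonal_def)
  then show "g = h" by (simp add: vec_eq_iff)
qed

text \<open>Homogeneity is applied with the scaling factor 2: \<open>2 powr r = 2\<close> forces
  \<open>r = 1\<close>.\<close>

lemma f_wt: "m \<in> Poly_Mapping.keys f \<Longrightarrow> wt w m = 1"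
proof -
  assume m: "m \<in> Poly_Mapping.keys f"
  have two: "(2 :: complex) powr of_rat r = of_real (2 powr of_rat r)" for r
    using powr_of_real[of 2 "of_rat r"] by (simp add: of_real_of_rat)
  have "ev (\<lambda>i. complex_of_real (2 powr of_rat (w i)) * x i) f = 2 * ev x f" for x
  proof -
    have "eval_series (lk f) (\<chi> i. (2 powr of_rat (w i)) * (\<chi> i. x i) $ i) = 2 * eval_series (lk f) (\<chi> i. x i)"
      using nd unfolding nondegenerate_weighted_homogeneous_def by (metis zero_neq_numeral)
    moreover have "($) (\<chi> i. y i) = y" for y :: "'n \<Rightarrow> complex" by (simp add: fun_eq_iff)
    ultimately show ?thesis by (simp add: eval_series_lookup two)
  qed
  then have "mon_val (\<lambda>i. complex_of_real (2 powr of_rat (w i))) m = 2"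
    by (rule ev_scaled_imp_coeff) (rule m)
  then have "complex_of_real (2 powr of_rat (wt w m)) = of_real 2" by (simp add: powr_wt)
  then have "2 powr of_rat (wt w m) = (2 :: real)" unfolding of_real_eq_iff .
  then have "2 powr of_rat (wt w m) = (2 :: real) powr 1" by simp
  then have "of_rat (wt w m) = (1 :: real)" by (subst (asm) powr_inj) auto
  then show ?thesis by simp
qed

lemma f_inv: "m \<in> Poly_Mapping.keys f \<Longrightarrow> h \<in> H \<Longrightarrow> mon_val h m = 1"
proof -
  assume m: "m \<in> Poly_Mapping.keys f" and "h \<in> H"
  then obtain g where g: "g \<in> G" "h = diag_of g" by (auto simp: H_def)
  have "ev (\<lambda>i. h i * x i) f = 1 * ev x f" for x
  proof -
    have "($) (g *v (\<chi> i. x i)) = (\<lambda>i. h i * x i)"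
      using matrix_vector_mult_diagonal[OF diag[OF g(1)]] g(2) by (simp add: fun_eq_iff)
    moreover have "($) (\<chi> i. x i) = x" by (simp add: fun_eq_iff)
    ultimately show ?thesis using inv[OF g(1), of "\<chi> i. x i"] by (simp add: eval_series_lookup)
  qed
  then show ?thesis by (rule ev_scaled_imp_coeff) (rule m)
qed

text \<open>The real scaling \<open>t powr w j\<close> would carry a nonzero common zero to further
  common zeros that tend to the origin as \<open>t\<close> decreases to 0, against the isolated
  singularity.\<close>

lemma pd_f_zero_only:
  assumes x: "\<And>j. ev x (pd j f) = 0"
  shows "x i = 0"
proof (rule ccontr)
  assume xi: "x i \<noteq> 0"
  define v where "v t = (\<chi> j. complex_of_real (t powr of_rat (w j)) * x j)" for t :: real
  have zero: "eval_series (partial j (lk f)) (v t) = 0" if t: "t > 0" for j t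
  proof -
    have "mon_val (\<lambda>j. complex_of_real (t powr of_rat (w j))) m = of_real (t powr of_rat (1 - w j))"
      if "m \<in> Poly_Mapping.keys (pd j f)" for m
      using f_wt[OF keys_pd[OF that]] by (simp add: powr_wt[OF t] wt_add wt_single eq_diff_eq[symmetric])
    from ev_scaled[OF this] have "ev (\<lambda>j. complex_of_real (t powr of_rat (w j)) * x j) (pd j f) = 0"
      by (simp add: x)
    moreover have "($) (v t) = (\<lambda>j. complex_of_real (t powr of_rat (w j)) * x j)"
      by (simp add: v_def fun_eq_iff)
    ultimately show ?thesis by (simp add: eval_series_lookup flip: lookup_pd)
  qed
  have "((\<lambda>t. complex_of_real (t powr of_rat (w j)) * x j) \<longlongrightarrow> complex_of_real 0 * x j) (at_right 0)" for j
  proof (intro tendsto_intros)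
    have "((\<lambda>t::real. t powr of_rat (w j)) \<longlongrightarrow> 0) (at 0 within {0<..})"
      using w_pos[of j] by (intro tendsto_zero_powrI[where b = "of_rat (w j)"] tendsto_intros)
         (auto simp: eventually_at_filter)
    then show "((\<lambda>t::real. t powr of_rat (w j)) \<longlongrightarrow> 0) (at_right 0)" .
  qed
  then have "(v \<longlongrightarrow> 0) (at_right 0)"
    unfolding v_def by (intro vec_tendstoI) simp
  moreover have "\<forall>\<^sub>F t in at_right 0. v t \<noteq> 0"
  proof -
    have "v t \<noteq> 0" if "t > 0" for t
    proof -
      have "v t $ i \<noteq> 0" using xi that by (simp add: v_def)
      then show ?thesis by auto
    qed
    then show ?thesis by (auto simp: eventually_at_filter)
  qed
  ultimately have "filterlim v (at 0) (at_right 0)" by (simp add: filterlim_at)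
  moreover have "\<forall>\<^sub>F y in at 0. \<exists>i. eval_series (partial i (lk f)) y \<noteq> 0"
    using nd by (simp add: nondegenerate_weighted_homogeneous_def isolated_singularity_at_0_def)
  ultimately have "\<forall>\<^sub>F t in at_right 0. \<exists>i. eval_series (partial i (lk f)) (v t) \<noteq> 0"
    by (rule eventually_compose_filterlim[rotated])
  moreover have "\<forall>\<^sub>F t in at_right 0. t > (0::real)" by (simp add: eventually_at_filter)
  ultimately have "\<forall>\<^sub>F t::real in at_right 0. False"
    by eventually_elim (use zero in auto)
  then show False by simp
qed

abbreviation Ig :: "complex ^ 'n ^ 'n \<Rightarrow> 'n set" where "Ig g \<equiv> fix_vars g"
abbreviation fg :: "complex ^ 'n ^ 'n \<Rightarrow> 'n cseries" where "fg g \<equiv> restrict_vars (fix_vars g) (lk f)"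

definition Fg :: "complex ^ 'n ^ 'n \<Rightarrow> 'n \<Rightarrow> 'n cpoly" where
  "Fg g i = pd i (pfilter (\<lambda>m. Poly_Mapping.keys m \<subseteq> Ig g) f)"

lemma lookup_fg: "lk (pfilter (\<lambda>m. Poly_Mapping.keys m \<subseteq> Ig g) f) = fg g"
  by (simp add: fun_eq_iff lookup_pfilter restrict_vars_def)

lemma keys_Fg:
  assumes "m \<in> Poly_Mapping.keys (Fg g i)"
  shows "m + Poly_Mapping.single i 1 \<in> Poly_Mapping.keys f" "Poly_Mapping.keys m \<subseteq> Ig g"
  using keys_pd[OF assms[unfolded Fg_def]] by (auto simp: keys_pfilter keys_add_monomial)

text \<open>The point is that the restriction has no further critical points. For \<open>j\<close>
  not fixed by \<open>g\<close>, invariance forces every monomial of the \<open>j\<close>-th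
  derivative to contain a moved variable, so this derivative vanishes on the fixed space; the other
  derivatives restrict to \<open>Fg g\<close>, and \<open>pd_f_zero_only\<close> applies.\<close>

lemma sector_locale:
  assumes g: "g \<in> G"
  shows "jacobian_quotient (Ig g) w H (Fg g) (fg g)"
proof (intro jacobian_quotient.intro graded_jacobian.intro jacobian_quotient_axioms.intro)
  show "diag_group H" by (rule H_group)
  show "w i > 0" for i by (rule w_pos)
  show "Poly_Mapping.keys m \<subseteq> Ig g" if "m \<in> Poly_Mapping.keys (Fg g i)" for i m
    by (rule keys_Fg(2)[OF that])
  show "wt w m = 1 - w i" if "m \<in> Poly_Mapping.keys (Fg g i)" for i m
    using f_wt[OF keys_Fg(1)[OF that]] by (simp add: wt_add wt_single eq_diff_eq)
  show "mon_val h m * h i = 1" if "m \<in> Poly_Mapping.keys (Fg g i)" "h \<in> H" for i m h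
    using f_inv[OF keys_Fg(1)[OF that(1)] that(2)] by (simp add: mon_val_add mon_val_single)
  show "partial i (fg g) = lk (Fg g i)" for i by (simp add: Fg_def lookup_pd lookup_fg)
next
  fix x i
  assume F0: "\<And>i. i \<in> Ig g \<Longrightarrow> ev x (Fg g i) = 0" and x0: "\<And>j. j \<notin> Ig g \<Longrightarrow> x j = 0"
  have Ig: "i \<in> Ig g \<longleftrightarrow> g $ i $ i = 1" for i using fix_vars_diagonal[OF diag[OF g]] by auto
  let ?P = "\<lambda>m. Poly_Mapping.keys m \<subseteq> Ig g"
  have "ev x (pd j f) = 0" for j
  proof (cases "j \<in> Ig g")
    case True
    have "pfilter ?P (pd j f) = Fg g j"
      using True by (intro poly_mapping_eqI)
        (auto simp: lookup_pfilter Fg_def lookup_pd partial_def keys_add_monomial)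
    then show ?thesis using ev_pfilter_vars[of "Ig g" x "pd j f"] x0 F0[OF True] by simp
  next
    case False
    have "lk (pd j f) m = 0" if m: "?P m" for m
    proof (rule ccontr)
      assume "lk (pd j f) m \<noteq> 0"
      then have "m + Poly_Mapping.single j 1 \<in> Poly_Mapping.keys f"
        by (intro keys_pd) (simp add: in_keys_iff)
      then have "mon_val (diag_of g) (m + Poly_Mapping.single j 1) = 1"
        by (rule f_inv) (use g in \<open>auto simp: H_def\<close>)
      then have "mon_val (diag_of g) m * g $ j $ j = 1" unfolding mon_val_add mon_val_single by simp
      moreover have "mon_val (diag_of g) m = 1"
        unfolding mon_val_def
      proof (rule prod.neutral, intro ballI)
        fix i show "g $ i $ i ^ lk m i = 1"
          using m Ig[of i] by (cases "i \<in> Ig g") (use in_keys_iff[of i m] in auto)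
      qed
      ultimately show False using False Ig[of j] by simp
    qed
    then have "pfilter ?P (pd j f) = 0" by (intro poly_mapping_eqI) (simp add: lookup_pfilter)
    then show ?thesis using ev_pfilter_vars[of "Ig g" x "pd j f"] x0 by simp
  qed
  then show "x i = 0" by (rule pd_f_zero_only)
qed

end

section \<open>Hodge numbers and ages\<close>

lemma ex_lookup:
  assumes "finite M"
  shows "\<exists>r. Poly_Mapping.keys r \<subseteq> M \<and> lk r = (\<lambda>m. if m \<in> M then y m else (0 :: complex))"
proof -
  have "finite {m. (if m \<in> M then y m else 0) \<noteq> 0}"
    by (rule finite_subset[OF _ assms]) auto
  then have "lk (Abs_poly_mapping (\<lambda>m. if m \<in> M then y m else 0)) = (\<lambda>m. if m \<in> M then y m else 0)"
    by (simp add: Abs_poly_mapping_inverse)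
  moreover from this have "Poly_Mapping.keys (Abs_poly_mapping (\<lambda>m. if m \<in> M then y m else 0)) \<subseteq> M"
    by (auto simp: in_keys_iff split: if_splits)
  ultimately show ?thesis by blast
qed

context lg_pair
begin

definition eul :: "complex ^ 'n ^ 'n \<Rightarrow> rat \<Rightarrow> int" where
  "eul g = graded_jacobian.euler (Ig g) w H"

abbreviation cs :: "complex ^ 'n ^ 'n \<Rightarrow> 'n cseries \<Rightarrow> 'n cseries set" where
  "cs g \<equiv> quotient_of_germs.coset (Ig g) (jacobian_ideal (Ig g) (fg g))"

lemma sector_simps:
  assumes g: "g \<in> G"
  shows "cs g a \<oplus>\<^bsub>sector f w G p q g\<^esub> cs g b = cs g (\<lambda>m. a m + b m)"
    "c \<odot>\<^bsub>sector f w G p q g\<^esub> cs g a = cs g (\<lambda>m. c * a m)"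
    "\<zero>\<^bsub>sector f w G p q g\<^esub> = cs g (\<lambda>m. 0)"
    "cs g a = cs g b \<longleftrightarrow> (\<lambda>m. a m - b m) \<in> jacobian_ideal (Ig g) (fg g)"
proof -
  interpret S: jacobian_quotient "Ig g" w H "Fg g" "fg g" by (rule sector_locale[OF g])
  show "cs g a \<oplus>\<^bsub>sector f w G p q g\<^esub> cs g b = cs g (\<lambda>m. a m + b m)"
    using S.jq.Q_simps(3)[of a b] by (simp add: sector_def Omega_def Let_def)
  show "c \<odot>\<^bsub>sector f w G p q g\<^esub> cs g a = cs g (\<lambda>m. c * a m)"
    using S.jq.Q_simps(4)[of c a] by (simp add: sector_def Omega_def Let_def)
  show "\<zero>\<^bsub>sector f w G p q g\<^esub> = cs g (\<lambda>m. 0)"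
    using S.jq.Q_simps(2) by (simp add: sector_def Omega_def Let_def S.jq.coset_0)
  show "cs g a = cs g b \<longleftrightarrow> (\<lambda>m. a m - b m) \<in> jacobian_ideal (Ig g) (fg g)"
    by (rule S.jq.coset_eq_iff)
qed

text \<open>Translates the definitions into the locale of the sector: \<open>act_form\<close>
  becomes \<open>act\<close>, and the Hodge space consists of the cosets of polynomials of weight
  \<open>q\<close>. Off the line \<open>p + q = card (Ig g)\<close> the basis is empty.\<close>

lemma invariants_basis:
  assumes g: "g \<in> G"
  shows "\<exists>M. finite M \<and> int (card M) = (if p + q = of_nat (card (Ig g)) then eul g q else 0) \<and>
    invariants (Ig g) G (hodge_space (Ig g) (fg g) w p q) = {cs g (lk r) | r. Poly_Mapping.keys r \<subseteq> M} \<and>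
    (\<forall>r. Poly_Mapping.keys r \<subseteq> M \<longrightarrow> lk r \<in> jacobian_ideal (Ig g) (fg g) \<longrightarrow> r = 0)"
proof -
  interpret S: jacobian_quotient "Ig g" w H "Fg g" "fg g" by (rule sector_locale[OF g])
  have act: "act_form (Ig g) g' = S.act (diag_of g')" for g'
    by (intro ext) (simp add: act_form_def S.act_def S.chi_empty)
  have invs: "invariants (Ig g) G V = {c \<in> V. \<forall>h\<in>H. S.act h ` c = c}" for V
    by (auto simp: invariants_def act H_def)
  show ?thesis
  proof (cases "p + q = of_nat (card (Ig g))")
    case True
    let ?A = "{k. Poly_Mapping.keys k \<subseteq> Ig g \<and> S.wtf {} k = q}"
    have mono: "monomial_form (Ig g) (fg g) k = S.jq.coset (lk (Poly_Mapping.single k 1))" for k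
    proof -
      have "lk (Poly_Mapping.single k 1) = (\<lambda>m. if m = k then 1 else (0::complex))"
        by (auto simp: lookup_single when_def fun_eq_iff)
      then show ?thesis by (simp only: monomial_form_def S.jq.coset_def)
    qed
    have "hodge_space (Ig g) (fg g) w p q =
        LinearCombinations.module.span complex_field S.jq.Q ((\<lambda>k. S.jq.coset (lk (Poly_Mapping.single k 1))) ` ?A)"
      using True by (simp add: hodge_space_def Omega_def mono S.wtf_def setcompr_eq_image)
    also have "\<dots> = {S.jq.coset (lk r) | r. Poly_Mapping.keys r \<subseteq> ?A}"
      by (rule S.jq.span_coset) simp
    finally have hs: "hodge_space (Ig g) (fg g) w p q = {S.jq.coset (lk r) | r. Poly_Mapping.keys r \<subseteq> ?A}" .
    obtain M where M: "finite M" "int (card M) = S.euler q"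
      "{c \<in> {S.jq.coset (lk p) | p. Poly_Mapping.keys p \<subseteq> ?A}. \<forall>h\<in>H. S.act h ` c = c} =
       {S.jq.coset (lk r) | r. Poly_Mapping.keys r \<subseteq> M}"
      "\<And>r. Poly_Mapping.keys r \<subseteq> M \<Longrightarrow> lk r \<in> jacobian_ideal (Ig g) (fg g) \<Longrightarrow> r = 0"
      by (rule S.invariant_basis[of q]) (rule that; assumption)
    have "\<forall>r. Poly_Mapping.keys r \<subseteq> M \<longrightarrow> lk r \<in> jacobian_ideal (Ig g) (fg g) \<longrightarrow> r = 0"
      by (intro allI impI) (rule M(4))
    then show ?thesis
      unfolding invs hs eul_def if_P[OF True]
      by (intro exI[of _ M] conjI[OF M(1) conjI[OF M(2) conjI[OF M(3)]]])
  next
    case False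
    have lk0: "lk (0 :: 'n cpoly) = (\<lambda>m. 0)" by (simp add: fun_eq_iff)
    have hs: "hodge_space (Ig g) (fg g) w p q = {S.jq.coset (\<lambda>m. 0)}"
      using False S.jq.Q_simps(2) by (simp add: hodge_space_def Omega_def S.jq.coset_0)
    have "invariants (Ig g) G (hodge_space (Ig g) (fg g) w p q) = {S.jq.coset (\<lambda>m. 0)}"
    proof -
      have "S.act h (\<lambda>m. 0) = (\<lambda>m. 0)" for h by (simp add: S.act_def)
      then have "S.act h ` S.jq.coset (\<lambda>m. 0) = S.jq.coset (\<lambda>m. 0)" if "h \<in> H" for h
        using S.act_coset[OF that, of "\<lambda>m. 0"] by simp
      then have "\<forall>h\<in>H. S.act h ` S.jq.coset (\<lambda>m. 0) = S.jq.coset (\<lambda>m. 0)" by blast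
      then show ?thesis unfolding invs hs by blast
    qed
    then show ?thesis
      using False by (intro exI[of _ "{}"]) (auto simp: lk0 intro: exI[of _ 0])
  qed
qed

text \<open>The bases \<open>M g\<close> of the sectors give coordinates on the direct sum, indexed
  by pairs of \<open>g\<close> and a monomial in \<open>M g\<close>. The age shifts both degrees and
  so moves the line \<open>p + q = card (Ig g)\<close> by \<open>2 * age g\<close>.\<close>

theorem hodge_number_eq:
  "int (hodge_number f w G p q) =
    (\<Sum>g\<in>G. if p + q = of_nat (card (Ig g)) + 2 * age g then eul g (q - age g) else 0)"
proof -
  have "\<forall>g\<in>G. \<exists>M. finite M \<and>
      int (card M) = (if p - age g + (q - age g) = of_nat (card (Ig g)) then eul g (q - age g) else 0) \<and>
      invariants (Ig g) G (hodge_space (Ig g) (fg g) w (p - age g) (q - age g)) =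
        {cs g (lk r) | r. Poly_Mapping.keys r \<subseteq> M} \<and>
      (\<forall>r. Poly_Mapping.keys r \<subseteq> M \<longrightarrow> lk r \<in> jacobian_ideal (Ig g) (fg g) \<longrightarrow> r = 0)"
    using invariants_basis by blast
  from bchoice[OF this] obtain M where *: "\<forall>g\<in>G. finite (M g) \<and>
      int (card (M g)) = (if p - age g + (q - age g) = of_nat (card (Ig g)) then eul g (q - age g) else 0) \<and>
      invariants (Ig g) G (hodge_space (Ig g) (fg g) w (p - age g) (q - age g)) =
        {cs g (lk r) | r. Poly_Mapping.keys r \<subseteq> M g} \<and>
      (\<forall>r. Poly_Mapping.keys r \<subseteq> M g \<longrightarrow> lk r \<in> jacobian_ideal (Ig g) (fg g) \<longrightarrow> r = 0)" ..
  have M: "finite (M g)"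
    "int (card (M g)) = (if p - age g + (q - age g) = of_nat (card (Ig g)) then eul g (q - age g) else 0)"
    "invariants (Ig g) G (hodge_space (Ig g) (fg g) w (p - age g) (q - age g)) =
        {cs g (lk r) | r. Poly_Mapping.keys r \<subseteq> M g}"
    "Poly_Mapping.keys r \<subseteq> M g \<Longrightarrow> lk r \<in> jacobian_ideal (Ig g) (fg g) \<Longrightarrow> r = 0"
    if "g \<in> G" for g r
  proof -
    note ** = bspec[OF * that]
    show "finite (M g)" using ** by (rule conjunct1)
    show "int (card (M g)) = (if p - age g + (q - age g) = of_nat (card (Ig g)) then eul g (q - age g) else 0)"
      using ** by (elim conjE)
    show "invariants (Ig g) G (hodge_space (Ig g) (fg g) w (p - age g) (q - age g)) =
        {cs g (lk r) | r. Poly_Mapping.keys r \<subseteq> M g}"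
      using ** by (elim conjE)
    show "r = 0" if "Poly_Mapping.keys r \<subseteq> M g" "lk r \<in> jacobian_ideal (Ig g) (fg g)"
      using ** that by (elim conjE) blast
  qed
  define T where "T x = (\<lambda>g\<in>G. cs g (\<lambda>m. if m \<in> M g then x (g, m) else 0))" for x :: "_ \<Rightarrow> complex"
  let ?W = "orbifold_hodge_space f w G p q"
  have "vectorspace.dim complex_field ?W = card (Sigma G M)"
  proof (rule dim_parametrized[where T = T])
    show "finite (Sigma G M)" using finG M(1) by auto
    show "T (\<lambda>t. x t + y t) = T x \<oplus>\<^bsub>?W\<^esub> T y" for x y
      unfolding T_def orbifold_hodge_space_def finite_direct_sum_def
      by (auto simp: sector_simps restrict_def fun_eq_iff if_distrib cong: if_cong intro!: arg_cong[where f = "cs _"])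
    show "T (\<lambda>t. c * x t) = c \<odot>\<^bsub>?W\<^esub> T x" for c x
      unfolding T_def orbifold_hodge_space_def finite_direct_sum_def
      by (auto simp: sector_simps restrict_def fun_eq_iff if_distrib cong: if_cong intro!: arg_cong[where f = "cs _"])
    show zero: "T (\<lambda>t. 0) = \<zero>\<^bsub>?W\<^esub>"
      unfolding T_def orbifold_hodge_space_def finite_direct_sum_def
      by (auto simp: sector_simps restrict_def fun_eq_iff)
    have cW: "carrier ?W = (\<Pi>\<^sub>E g\<in>G. {cs g (lk r) | r. Poly_Mapping.keys r \<subseteq> M g})"
      unfolding orbifold_hodge_space_def finite_direct_sum_def
      using M(3) by (auto simp: sector_def Let_def cong: PiE_cong)
    show "carrier ?W = {T x | x. \<forall>t. t \<notin> Sigma G M \<longrightarrow> x t = 0}"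
      unfolding cW
    proof (intro equalityI subsetI)
      fix c assume c: "c \<in> (\<Pi>\<^sub>E g\<in>G. {cs g (lk r) | r. Poly_Mapping.keys r \<subseteq> M g})"
      then have "\<forall>g\<in>G. \<exists>r. c g = cs g (lk r) \<and> Poly_Mapping.keys r \<subseteq> M g" by (auto simp: PiE_iff)
      from bchoice[OF this] obtain r where r: "\<And>g. g \<in> G \<Longrightarrow> c g = cs g (lk (r g)) \<and> Poly_Mapping.keys (r g) \<subseteq> M g"
        by auto
      define x where "x t = (if t \<in> Sigma G M then lk (r (fst t)) (snd t) else 0)" for t
      have "c g = T x g" for g
      proof (cases "g \<in> G")
        case True
        have "(\<lambda>m. if m \<in> M g then x (g, m) else 0) = lk (r g)"
          using r[OF True] True in_keys_iff[of _ "r g"] by (auto simp: x_def fun_eq_iff)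
        then show ?thesis using r[OF True] True by (simp add: T_def)
      qed (use c in \<open>auto simp: T_def PiE_iff extensional_def\<close>)
      then have "c = T x" by (simp add: fun_eq_iff)
      moreover have "\<forall>t. t \<notin> Sigma G M \<longrightarrow> x t = 0" by (simp add: x_def)
      ultimately show "c \<in> {T x | x. \<forall>t. t \<notin> Sigma G M \<longrightarrow> x t = 0}" by blast
    next
      fix c assume "c \<in> {T x | x. \<forall>t. t \<notin> Sigma G M \<longrightarrow> x t = 0}"
      then obtain x where x: "c = T x" by blast
      have "\<exists>r. cs g (\<lambda>m. if m \<in> M g then x (g, m) else 0) = cs g (lk r) \<and> Poly_Mapping.keys r \<subseteq> M g"
        if "g \<in> G" for g
        using ex_lookup[OF M(1)[OF that], of "\<lambda>m. x (g, m)"] by metis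
      then show "c \<in> (\<Pi>\<^sub>E g\<in>G. {cs g (lk r) | r. Poly_Mapping.keys r \<subseteq> M g})"
        by (auto simp: x T_def)
    qed
    fix x :: "(complex ^ 'n ^ 'n) \<times> 'n monomial \<Rightarrow> complex"
    assume x0: "\<And>t. t \<notin> Sigma G M \<Longrightarrow> x t = 0" and "T x = \<zero>\<^bsub>?W\<^esub>"
    then have T0: "T x g = T (\<lambda>t. 0) g" for g by (simp add: zero)
    have "x (g, m) = 0" if g: "g \<in> G" and m: "m \<in> M g" for g m
    proof -
      from ex_lookup[OF M(1)[OF g], of "\<lambda>m. x (g, m)"]
      obtain r where r: "Poly_Mapping.keys r \<subseteq> M g" "lk r = (\<lambda>m. if m \<in> M g then x (g, m) else 0)"
        by (elim exE conjE)
      have "T x g = cs g (lk r)" using g by (simp add: T_def r(2))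
      moreover have "T (\<lambda>t. 0) g = cs g (\<lambda>m. 0)" using g by (simp add: T_def)
      ultimately have "cs g (lk r) = cs g (\<lambda>m. 0)" using T0[of g] by simp
      then have "lk r \<in> jacobian_ideal (Ig g) (fg g)" by (simp add: sector_simps(4)[OF g])
      then have "r = 0" by (rule M(4)[OF g r(1)])
      then show ?thesis using fun_cong[OF r(2), of m] m by simp
    qed
    then show "x = (\<lambda>t. 0)" using x0 by (auto simp: fun_eq_iff)
  qed
  then have "int (hodge_number f w G p q) = (\<Sum>g\<in>G. int (card (M g)))"
    using finG M(1) by (simp add: hodge_number_def card_SigmaI)
  also have "\<dots> = (\<Sum>g\<in>G. if p + q = of_nat (card (Ig g)) + 2 * age g then eul g (q - age g) else 0)"
    by (intro sum.cong refl) (auto simp: M(2) algebra_simps)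
  finally show ?thesis .
qed

section \<open>Order and age of a group element\<close>

lemma diag_power: "g \<in> G \<Longrightarrow> g [^]\<^bsub>SL\<^esub> (n::nat) \<in> G \<and> diag_of (g [^]\<^bsub>SL\<^esub> n) = (\<lambda>i. g $ i $ i ^ n)"
proof (induction n)
  case 0
  then show ?case using G_one by (auto simp: SL_def nat_pow_def fun_eq_iff mat_def)
next
  case (Suc n)
  interpret SL: group "SL :: (complex ^ 'n ^ 'n) monoid" by (rule group_SL)
  have "g [^]\<^bsub>SL\<^esub> Suc n = g [^]\<^bsub>SL\<^esub> n ** g" by (simp add: SL_def)
  then show ?case using Suc G_mult diag_mult[of "g [^]\<^bsub>SL\<^esub> n" g] by (auto simp: fun_eq_iff)
qed

lemma ord_pos: "g \<in> G \<Longrightarrow> group.ord SL g > 0"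
proof -
  assume g: "g \<in> G"
  interpret SL: group "SL :: (complex ^ 'n ^ 'n) monoid" by (rule group_SL)
  interpret G: group "SL\<lparr>carrier := G\<rparr>" by (rule subgroup.subgroup_is_group[OF sub group_SL])
  have gS: "g \<in> carrier SL" using g subgroup.subset[OF sub] by auto
  have "g [^]\<^bsub>SL\<^esub> card G = \<one>\<^bsub>SL\<^esub>"
    using G.pow_order_eq_1[of g] g SL.nat_pow_consistent[of g "card G" G] by (simp add: order_def)
  then have "SL.ord g dvd card G" using gS by (simp add: SL.pow_eq_id)
  moreover have "card G > 0" using finG g by (auto simp: card_gt_0_iff)
  ultimately show ?thesis by (metis dvd_0_left_iff gr0I less_irrefl)
qed

text \<open>Each diagonal entry is \<open>rt r k\<close> for a unique \<open>k < r\<close>, and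
  \<open>k / r\<close> is its normalized argument; this frees the age from the order
  \<open>r\<close>.\<close>

lemma age_eq: "g \<in> G \<Longrightarrow> (of_rat (age g) :: real) = (\<Sum>i\<in>UNIV. Arg2pi (g $ i $ i) / (2 * pi))"
proof -
  assume g: "g \<in> G"
  interpret SL: group "SL :: (complex ^ 'n ^ 'n) monoid" by (rule group_SL)
  have gS: "g \<in> carrier SL" using g subgroup.subset[OF sub] by auto
  define r where "r = SL.ord g"
  have r: "r > 0" unfolding r_def by (rule ord_pos[OF g])
  have "g [^]\<^bsub>SL\<^esub> r = \<one>\<^bsub>SL\<^esub>" using gS by (simp add: r_def)
  then have "(\<lambda>i. g $ i $ i ^ r) = diag_of (mat 1 :: complex ^ 'n ^ 'n)"
    using diag_power[OF g, of r] by (simp add: SL_def)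
  then have root: "g $ i $ i ^ r = 1" for i by (simp add: fun_eq_iff mat_def)
  have rt_exp: "exp (2 * of_real pi * \<i> * of_nat a / of_nat r) = rt r a" for a
    by (simp add: rt_def cis_conv_exp mult_ac)
  define a where "a i = (THE a::nat. a < r \<and> g $ i $ i = exp (2 * of_real pi * \<i> * of_nat a / of_nat r))" for i
  have "real (a i) / real r = Arg2pi (g $ i $ i) / (2 * pi)" for i
  proof -
    have "g $ i $ i \<in> rt r ` {..<r}"
      using bij_betw_imp_surj_on[OF bij_rt[OF r]] root by (simp add: roots1_def)
    then obtain k where k: "k < r" "g $ i $ i = rt r k" by auto
    have "a i = k"
      unfolding a_def rt_exp
    proof (rule the_equality)
      fix b assume "b < r \<and> g $ i $ i = rt r b"
      then show "b = k" using k bij_betw_imp_inj_on[OF bij_rt[OF r]] by (auto simp: inj_on_def)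
    qed (use k in simp)
    moreover have "Arg2pi (rt r k) = 2 * pi * (real k / real r)"
      unfolding rt_def by (rule Arg2pi_cis') (use k in auto)
    ultimately show ?thesis using k by simp
  qed
  moreover have "age g = (\<Sum>i\<in>UNIV. of_nat (a i)) / of_nat r"
    by (simp add: age_def Let_def r_def a_def)
  ultimately show ?thesis by (simp add: of_rat_divide of_rat_sum sum_divide_distrib)
qed

text \<open>\<open>exp (2 * pi * \<i> * age g)\<close> is the product of the diagonal entries, that
  is \<open>det g = 1\<close>.\<close>

lemma age_Ints: "g \<in> G \<Longrightarrow> age g \<in> \<int>"
proof -
  assume g: "g \<in> G"
  interpret H: diag_group H by (rule H_group)
  have "cis (2 * pi * of_rat (age g)) = (\<Prod>i\<in>UNIV. cis (Arg2pi (g $ i $ i)))"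
    unfolding age_eq[OF g] by (simp add: sum_distrib_left cis_conv_exp exp_sum)
  also have "\<dots> = (\<Prod>i\<in>UNIV. g $ i $ i)"
  proof (rule prod.cong[OF refl])
    fix i
    have "norm (g $ i $ i) = 1" using H.norm_eq_1[of "diag_of g"] g by (auto simp: H_def)
    then show "cis (Arg2pi (g $ i $ i)) = g $ i $ i"
      using Arg2pi_eq[of "g $ i $ i"] by (simp add: cis_conv_exp)
  qed
  also have "\<dots> = det g" using diag[OF g] by (intro det_diagonal[symmetric]) (auto simp: is_diagonal_def)
  finally have "cis (2 * pi * of_rat (age g)) = 1" by (simp add: G_det[OF g])
  then obtain n :: int where n: "2 * pi * of_rat (age g) = 2 * pi * real_of_int n"
    by (auto simp: complex_eq_iff cos_one_2pi_int mult_ac)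
  then have "(of_rat (age g) :: real) = of_rat (of_int n)" by simp
  then show ?thesis by (simp only: of_rat_eq_iff) simp
qed

end

section \<open>The variance\<close>

context lg_pair
begin

lemma finite_eul: "g \<in> G \<Longrightarrow> finite {l. eul g l \<noteq> 0}"
proof -
  assume g: "g \<in> G"
  interpret S: jacobian_quotient "Ig g" w H "Fg g" "fg g" by (rule sector_locale[OF g])
  show ?thesis unfolding eul_def by (rule S.finite_euler)
qed

text \<open>In the sector of \<open>g\<close> the weight \<open>l\<close> occurs at the single
  bidegree \<open>pt g l\<close>. There \<open>p + q - n\<close> is \<open>2 * age g\<close> minus
  the number of variables moved by \<open>g\<close>; as the age is an integer, only the parity of
  that number enters the sign.\<close>

lemma sum_hodge_numbers:
  fixes \<psi> :: "rat \<Rightarrow> rat"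
  shows "Sum_any (\<lambda>(p, q). (-1) powi \<lfloor>(p - of_nat CARD('n)) + q\<rfloor> * \<psi> q * of_nat (hodge_number f w G p q)) =
    (\<Sum>g\<in>G. (-1) ^ card (- Ig g) * (\<Sum>l | eul g l \<noteq> 0. \<psi> (l + age g) * of_int (eul g l)))"
proof -
  let ?n = "of_nat CARD('n) :: rat"
  define pt where "pt g l = (of_nat (card (Ig g)) + age g - l, l + age g)" for g and l :: rat
  define L where "L g = {l. eul g l \<noteq> 0}" for g
  define c where "c g p q = (if p + q = of_nat (card (Ig g)) + 2 * age g then eul g (q - age g) else 0)" for g p q
  define s where "s p q = (-1 :: rat) powi \<lfloor>(p - ?n) + q\<rfloor> * \<psi> q" for p q
  define X where "X = (\<Union>g\<in>G. pt g ` L g)"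
  have L: "finite (L g)" if "g \<in> G" for g using finite_eul[OF that] by (simp add: L_def)
  have X: "finite X" unfolding X_def using finG L by auto
  have h: "of_nat (hodge_number f w G p q) = (\<Sum>g\<in>G. of_int (c g p q) :: rat)" for p q
  proof -
    have "of_nat (hodge_number f w G p q) = (of_int (int (hodge_number f w G p q)) :: rat)" by simp
    then show ?thesis unfolding hodge_number_eq c_def by simp
  qed
  have c_pt: "(p, q) \<in> pt g ` L g" if "c g p q \<noteq> 0" for g p q
  proof -
    from that have "p + q = of_nat (card (Ig g)) + 2 * age g" "eul g (q - age g) \<noteq> 0"
      by (auto simp: c_def split: if_splits)
    then show ?thesis by (intro image_eqI[of _ _ "q - age g"]) (auto simp: pt_def L_def algebra_simps)
  qed
  have "Sum_any (\<lambda>(p, q). s p q * of_nat (hodge_number f w G p q)) =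
      (\<Sum>(p, q)\<in>X. s p q * of_nat (hodge_number f w G p q))"
  proof (rule Sum_any.expand_superset[OF X], clarify)
    fix p q assume "s p q * of_nat (hodge_number f w G p q) \<noteq> 0"
    then have "(\<Sum>g\<in>G. of_int (c g p q) :: rat) \<noteq> 0" by (auto simp: h)
    then obtain g where g: "g \<in> G" "of_int (c g p q) \<noteq> (0 :: rat)" by (rule sum.not_neutral_contains_not_neutral)
    then have "(p, q) \<in> pt g ` L g" by (intro c_pt) simp
    then show "(p, q) \<in> X" unfolding X_def using g(1) by (rule UN_I[rotated])
  qed
  also have "\<dots> = (\<Sum>g\<in>G. \<Sum>(p, q)\<in>X. s p q * of_int (c g p q))"
    unfolding h sum_distrib_left case_prod_unfold by (rule sum.swap)
  also have "\<dots> = (\<Sum>g\<in>G. (-1) ^ card (- Ig g) * (\<Sum>l\<in>L g. \<psi> (l + age g) * of_int (eul g l)))"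
  proof (rule sum.cong[OF refl])
    fix g assume g: "g \<in> G"
    obtain a where a: "age g = of_int a" using age_Ints[OF g] by (rule Ints_cases)
    have sgn: "(-1 :: rat) powi \<lfloor>of_nat (card (Ig g)) + 2 * age g - ?n\<rfloor> = (-1) ^ card (- Ig g)"
    proof -
      have "card (Ig g) + card (- Ig g) = CARD('n)"
        by (metis card_Un_disjoint Compl_partition disjoint_iff Compl_iff finite)
      then have "of_nat (card (Ig g)) + 2 * age g - ?n = of_int (2 * a - int (card (- Ig g)))"
        unfolding a by (simp flip: \<open>card (Ig g) + card (- Ig g) = CARD('n)\<close>)
      then have "\<lfloor>of_nat (card (Ig g)) + 2 * age g - ?n\<rfloor> = 2 * a - int (card (- Ig g))"
        by (simp only: floor_of_int)
      moreover have "(-1 :: rat) powi (2 * a - int (card (- Ig g))) = (-1) ^ card (- Ig g)"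
        by (cases "even (card (- Ig g))") (simp_all add: power_int_minus_left)
      ultimately show ?thesis by simp
    qed
    have "(\<Sum>(p, q)\<in>X. s p q * of_int (c g p q)) = (\<Sum>(p, q)\<in>pt g ` L g. s p q * of_int (c g p q))"
      using g c_pt[of g] X by (intro sum.mono_neutral_right) (force simp: X_def)+
    also have "\<dots> = (\<Sum>l\<in>L g. case pt g l of (p, q) \<Rightarrow> s p q * of_int (c g p q))"
      by (rule sum.reindex_cong[where l = "pt g"]) (auto simp: inj_on_def pt_def)
    also have "\<dots> = (\<Sum>l\<in>L g. (-1) ^ card (- Ig g) * (\<psi> (l + age g) * of_int (eul g l)))"
    proof (rule sum.cong[OF refl])
      fix l
      have "of_nat (card (Ig g)) + age g - l - ?n + (l + age g) = of_nat (card (Ig g)) + 2 * age g - ?n" by simp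
      then show "(case pt g l of (p, q) \<Rightarrow> s p q * of_int (c g p q)) =
          (-1) ^ card (- Ig g) * (\<psi> (l + age g) * of_int (eul g l))"
        unfolding pt_def s_def c_def prod.case by (simp only: sgn) (simp add: algebra_simps)
    qed
    finally show "(\<Sum>(p, q)\<in>X. s p q * of_int (c g p q)) =
        (-1) ^ card (- Ig g) * (\<Sum>l\<in>L g. \<psi> (l + age g) * of_int (eul g l))"
      by (simp add: sum_distrib_left)
  qed
  finally show ?thesis by (simp add: s_def L_def)
qed

text \<open>The signed generating function of the centred exponents \<open>q - n / 2\<close>. Being
  a finite sum of exponentials, it can be expanded at 0 termwise.\<close>

definition Q :: "real \<Rightarrow> complex" where
  "Q z = (\<Sum>g\<in>G. (-1) ^ card (- Ig g) *
    (\<Sum>l | eul g l \<noteq> 0. of_int (eul g l) * of_real (exp (of_rat (l + age g - of_nat CARD('n) / 2) * z))))"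

text \<open>The exponent \<open>age g - n / 2\<close> is a sum over all variables and the sign a
  product over the moved ones; distributed over the variables they turn \<open>factor\<close> into
  \<open>cfactor\<close>. By \<open>inj_diag\<close> the sum over \<open>G\<close> becomes one over
  \<open>H\<close>.\<close>

lemma Q_eq:
  assumes z: "z < 0"
  shows "Q z = 1 / of_nat (card H) *
    (\<Sum>g\<in>H. \<Sum>h\<in>H. \<Prod>i\<in>UNIV. cfactor (of_rat (w i)) (g i) (h i) z)"
proof -
  let ?e = "\<lambda>r. complex_of_real (exp (r * z))"
  have "(-1) ^ card (- Ig g) *
      (\<Sum>l | eul g l \<noteq> 0. of_int (eul g l) * ?e (of_rat (l + age g - of_nat CARD('n) / 2))) =
      1 / of_nat (card H) * (\<Sum>h\<in>H. \<Prod>i\<in>UNIV. cfactor (of_rat (w i)) (g $ i $ i) (h i) z)" if g: "g \<in> G" for g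
  proof -
    interpret S: jacobian_quotient "Ig g" w H "Fg g" "fg g" by (rule sector_locale[OF g])
    let ?a = "of_rat (age g) - of_nat CARD('n) / 2 :: real"
    have Ig: "i \<in> Ig g \<longleftrightarrow> g $ i $ i = 1" for i using fix_vars_diagonal[OF diag[OF g]] by auto
    have "of_rat (l + age g - of_nat CARD('n) / 2) = of_rat l + ?a" for l
      by (simp add: of_rat_add of_rat_diff of_rat_divide)
    then have "?e (of_rat (l + age g - of_nat CARD('n) / 2)) = ?e (of_rat l) * ?e ?a" for l
      by (simp only: distrib_right exp_add of_real_mult)
    then have "(\<Sum>l | eul g l \<noteq> 0. of_int (eul g l) * ?e (of_rat (l + age g - of_nat CARD('n) / 2))) =
        (\<Sum>l | S.euler l \<noteq> 0. of_int (S.euler l) * ?e (of_rat l)) * ?e ?a"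
      by (simp only: eul_def sum_distrib_right mult.assoc)
    also have "\<dots> = (\<Sum>h\<in>H. \<Prod>i\<in>Ig g. factor (of_rat (w i)) (h i) z) / of_nat (card H) * ?e ?a"
      by (simp only: S.poincare_series[OF z])
    finally have 1: "(\<Sum>l | eul g l \<noteq> 0. of_int (eul g l) * ?e (of_rat (l + age g - of_nat CARD('n) / 2))) =
        (\<Sum>h\<in>H. \<Prod>i\<in>Ig g. factor (of_rat (w i)) (h i) z) / of_nat (card H) * ?e ?a" .
    have 2: "(\<Prod>i\<in>UNIV. cfactor (of_rat (w i)) (g $ i $ i) (h i) z) =
        ?e ?a * ((-1) ^ card (- Ig g) * (\<Prod>i\<in>Ig g. factor (of_rat (w i)) (h i) z))" for h
    proof -
      let ?k = "\<lambda>i. if i \<in> Ig g then factor (of_rat (w i)) (h i) z else -1"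
      have "(\<Prod>i\<in>UNIV. cfactor (of_rat (w i)) (g $ i $ i) (h i) z) =
          (\<Prod>i\<in>UNIV. ?e (Arg2pi (g $ i $ i) / (2 * pi) - 1 / 2) * ?k i)"
        using Arg2pi_cis'[of 0] by (intro prod.cong refl) (simp add: cfactor_def Ig)
      also have "\<dots> = (\<Prod>i\<in>UNIV. ?e (Arg2pi (g $ i $ i) / (2 * pi) - 1 / 2)) * (\<Prod>i\<in>UNIV. ?k i)"
        by (rule prod.distrib)
      also have "(\<Prod>i\<in>UNIV. ?e (Arg2pi (g $ i $ i) / (2 * pi) - 1 / 2)) = ?e ?a"
      proof -
        have "?a = (\<Sum>i\<in>UNIV. Arg2pi (g $ i $ i) / (2 * pi) - 1 / 2)"
          by (simp add: age_eq[OF g] sum_subtractf)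
        then show ?thesis by (simp only: sum_distrib_right exp_sum[OF finite] of_real_prod)
      qed
      also have "(\<Prod>i\<in>UNIV. ?k i) = (-1) ^ card (- Ig g) * (\<Prod>i\<in>Ig g. factor (of_rat (w i)) (h i) z)"
        by (subst prod.If_cases) (simp_all add: mult.commute)
      finally show ?thesis .
    qed
    show ?thesis
      unfolding 1 2 by (simp add: sum_distrib_left sum_divide_distrib sum_distrib_right mult_ac)
  qed
  then have "Q z = (\<Sum>g\<in>G. 1 / of_nat (card H) * (\<Sum>h\<in>H. \<Prod>i\<in>UNIV. cfactor (of_rat (w i)) (g $ i $ i) (h i) z))"
    unfolding Q_def by (intro sum.cong refl)
  also have "\<dots> = 1 / of_nat (card H) * (\<Sum>g\<in>G. \<Sum>h\<in>H. \<Prod>i\<in>UNIV. cfactor (of_rat (w i)) (diag_of g i) (h i) z)"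
    by (simp only: sum_distrib_left)
  also have "(\<Sum>g\<in>G. \<Sum>h\<in>H. \<Prod>i\<in>UNIV. cfactor (of_rat (w i)) (diag_of g i) (h i) z) =
      (\<Sum>g\<in>diag_of ` G. \<Sum>h\<in>H. \<Prod>i\<in>UNIV. cfactor (of_rat (w i)) (g i) (h i) z)"
    by (simp only: sum.reindex[OF inj_diag] o_def)
  finally show ?thesis unfolding H_def[symmetric] .
qed

text \<open>Both numbers are instances of \<open>sum_hodge_numbers\<close>, with
  \<open>\<psi> q\<close> equal to 1 and to \<open>(q - n / 2)^2\<close>; the second order term of
  each exponential supplies the factor \<open>1 / 2\<close>.\<close>

lemma jet_Q:
  "\<exists>b. jet Q (of_rat (milnor_number f w G)) b (of_rat (variance f w G) / 2)"
proof -
  let ?n = "of_nat CARD('n) :: rat"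
  have "jet Q (\<Sum>g\<in>G. (-1) ^ card (- Ig g) * (\<Sum>l | eul g l \<noteq> 0. of_int (eul g l) * 1))
    (\<Sum>g\<in>G. (-1) ^ card (- Ig g) * (\<Sum>l | eul g l \<noteq> 0. of_int (eul g l) * of_real (of_rat (l + age g - ?n / 2))))
    (\<Sum>g\<in>G. (-1) ^ card (- Ig g) * (\<Sum>l | eul g l \<noteq> 0. of_int (eul g l) * ((of_real (of_rat (l + age g - ?n / 2)))\<^sup>2 / 2)))"
    unfolding Q_def by (intro jet_sum jet_cmult jet_exp finG finite_eul)
  moreover have "of_rat (milnor_number f w G) =
      (\<Sum>g\<in>G. (-1) ^ card (- Ig g) * (\<Sum>l | eul g l \<noteq> 0. of_int (eul g l) * (1::complex)))"
    using sum_hodge_numbers[of "\<lambda>_. 1"]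
    by (simp add: milnor_number_def of_rat_sum of_rat_mult of_rat_power of_rat_minus)
  moreover have "of_rat (variance f w G) / 2 =
      (\<Sum>g\<in>G. (-1) ^ card (- Ig g) * (\<Sum>l | eul g l \<noteq> 0. of_int (eul g l) * ((of_real (of_rat (l + age g - ?n / 2)) :: complex)\<^sup>2 / 2)))"
    using sum_hodge_numbers[of "\<lambda>q. (q - ?n / 2)\<^sup>2"]
    by (simp add: variance_def of_rat_sum of_rat_mult of_rat_power of_rat_minus of_real_of_rat
        sum_divide_distrib sum_distrib_left mult_ac)
  ultimately show ?thesis by auto
qed

text \<open>\<open>jet_Q\<close> and the product formula \<open>Q_eq\<close> expand the same
  function. Uniqueness identifies the quadratic coefficients with the variance and the constant
  terms with the Milnor number, and \<open>sum_cval\<close> relates the two double sums.\<close>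

theorem variance_eq: "variance f w G = 1 / 12 * c_hat w * milnor_number f w G"
proof -
  interpret H: diag_group H by (rule H_group)
  let ?w = "\<lambda>i. of_rat (w i) :: complex"
  let ?C = "\<lambda>g h. \<Prod>i\<in>UNIV. cval (?w i) (g i) (h i)"
  let ?D = "\<lambda>g h. (\<Sum>i\<in>UNIV. lval (g i) (h i))\<^sup>2 + (\<Sum>i\<in>UNIV. qval (?w i) (g i) (h i))"
  let ?k = "1 / of_nat (card H) :: complex"
  let ?E = "\<Sum>g\<in>H. \<Sum>h\<in>H. ?C g h * (\<Sum>i\<in>UNIV. lval (g i) (h i))"
  have "jet (\<lambda>z. ?k * (\<Sum>g\<in>H. \<Sum>h\<in>H. \<Prod>i\<in>UNIV. cfactor (of_rat (w i)) (g i) (h i) z))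
    (?k * (\<Sum>g\<in>H. \<Sum>h\<in>H. ?C g h)) (?k * ?E) (?k * (\<Sum>g\<in>H. \<Sum>h\<in>H. ?C g h * ?D g h / 2))"
  proof (intro jet_cmult jet_sum H.fin jet_prod finite)
    fix g h :: "'n \<Rightarrow> complex" and i
    show "jet (cfactor (of_rat (w i)) (g i) (h i)) (cval (?w i) (g i) (h i))
      (cval (?w i) (g i) (h i) * lval (g i) (h i))
      (cval (?w i) (g i) (h i) * ((lval (g i) (h i))\<^sup>2 + qval (?w i) (g i) (h i)) / 2)"
      using jet_cfactor[of "of_rat (w i)" "g i" "h i"] w_pos[of i] by (simp add: of_real_of_rat)
  qed
  moreover have "\<forall>\<^sub>F z in at_left 0. ?k * (\<Sum>g\<in>H. \<Sum>h\<in>H. \<Prod>i\<in>UNIV. cfactor (of_rat (w i)) (g i) (h i) z) = Q z"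
    using Q_eq by (auto simp: eventually_at_filter)
  ultimately have Q: "jet Q (?k * (\<Sum>g\<in>H. \<Sum>h\<in>H. ?C g h)) (?k * ?E) (?k * (\<Sum>g\<in>H. \<Sum>h\<in>H. ?C g h * ?D g h / 2))"
    by (rule jet_cong[rotated])
  obtain b where b: "jet Q (of_rat (milnor_number f w G)) b (of_rat (variance f w G) / 2)"
    using jet_Q ..
  have "of_rat (variance f w G) / 2 = ?k * (\<Sum>g\<in>H. \<Sum>h\<in>H. ?C g h * ?D g h / 2)"
    by (rule jet_unique(3)[OF b Q])
  then have "of_rat (variance f w G) = ?k * (\<Sum>g\<in>H. \<Sum>h\<in>H. ?C g h * ?D g h)"
    by (simp flip: sum_divide_distrib)
  also have "\<dots> = ?k * ((\<Sum>i\<in>UNIV. 1 - 2 * ?w i) / 12 * (\<Sum>g\<in>H. \<Sum>h\<in>H. ?C g h))"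
    using w_pos by (subst H.sum_cval) (auto simp: less_imp_neq[symmetric])
  also have "\<dots> = (\<Sum>i\<in>UNIV. 1 - 2 * ?w i) / 12 * of_rat (milnor_number f w G)"
    by (simp add: jet_unique(1)[OF b Q])
  also have "(\<Sum>i\<in>UNIV. 1 - 2 * ?w i) = of_rat (c_hat w)"
    by (simp add: c_hat_def sum_subtractf sum_distrib_left of_rat_diff of_rat_mult of_rat_sum)
  also have "of_rat (c_hat w) / 12 * of_rat (milnor_number f w G) =
      (of_rat (1 / 12 * c_hat w * milnor_number f w G) :: complex)"
    by (simp add: of_rat_mult of_rat_divide)
  finally show ?thesis by (simp only: of_rat_eq_iff)
qed

end

theorem theorem19:
  fixes f :: "'n::finite cpoly" and w :: "'n \<Rightarrow> rat" and G :: "(complex ^ 'n ^ 'n) set"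
  assumes "nondegenerate_weighted_homogeneous f w"
    and "subgroup G SL" and "finite G" and "comm_group (SL\<lparr>carrier := G\<rparr>)"
    and "\<forall>g\<in>G. is_diagonal g"
    and "\<forall>g\<in>G. \<forall>x. eval_series (Poly_Mapping.lookup f) (g *v x) = eval_series (Poly_Mapping.lookup f) x"
  shows "variance f w G = 1 / 12 * c_hat w * milnor_number f w G"
proof -
  interpret lg_pair f w G
    by (rule lg_pair.intro) (use assms in auto)
  show ?thesis by (rule variance_eq)
qed

end
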